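(* Let $\mathbf{Raney}_{\mathcal I}$ and $\mathbf{Raney}_{\mathcal T}$ be the full subcategories of $\mathbf{Raney}$ of fiber-initial, respectively fiber-terminal, objects, and let $I_{\mathcal T}:\mathbf{Raney}_{\mathcal T}\hookrightarrow\mathbf{Raney}$ be the inclusion. There are morphisms of SFC-categories $$\mathbf{Raney}_{\mathcal T}\xrightarrow{\;I_{\mathcal T}\;}\mathbf{Raney}\xrightarrow{\;\mathsf{Filt}_{\mathcal{SE}}\mathcal O_{\mathcal R}\;}\mathbf{Raney}_{\mathcal I}.$$ Applying the functor $\mathsf{Dual}$ yields the following diagram in $\mathbf{RADJ}$, whose objects are the adjunctions (left adjoint first) (A1) $\mathsf{pt}_{\mathcal R}\dashv\mathsf{Filt}_{\mathcal{SE}}\mathcal O_{\mathcal R}\mathcal U$ between $\mathbf{Raney}_{\mathcal I}$ and $\mathbf{Top}^{\mathrm{op}}$, the adjunction $\mathsf{Dual}$ of $\mathbf{Raney}_{\mathcal I}$; (A2) $\mathsf{pt}_{\mathcal R}\dashv\mathcal U$ between $\mathbf{Raney}$ and $\mathbf{Top}^{\mathrm{op}}$, the adjunction $\mathsf{Dual}$ of $\mathbf{Raney}$; (A3) $\mathsf{pt}_{\mathcal R}\dashv\mathcal U$ between $\mathbf{Raney}_{\mathcal T}$ and $\mathbf{Top}_D^{\mathrm{op}}$, the adjunction $\mathsf{Dual}$ of $\mathbf{Raney}_{\mathcal T}$; (A4) $\mathsf{pt}_{\mathcal E}\dashv\Omega$ between $\mathbf{Frm}_{\mathcal E}$ and $\mathbf{Top}_D^{\mathrm{op}}$,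 the adjunction $\mathsf{Dual}$ of $\mathbf{Frm}_{\mathcal E}$; (A5) $\mathsf{pt}\dashv\Omega$ between $\mathbf{Frm}$ and $\mathbf{Top}^{\mathrm{op}}$, the adjunction $\mathsf{Dual}$ of $\mathbf{Frm}$; and whose morphisms are $\mathsf{Dual}(\mathsf{Filt}_{\mathcal{SE}}\mathcal O_{\mathcal R})$ from (A2) to (A1), with functors $\mathsf{Filt}_{\mathcal{SE}}\mathcal O_{\mathcal R}$ and the identity of $\mathbf{Top}^{\mathrm{op}}$; $\mathsf{Dual}(I_{\mathcal T})$ from (A3) to (A2), with functors the full inclusions $I_{\mathcal T}$ and $\mathbf{Top}_D^{\mathrm{op}}\hookrightarrow\mathbf{Top}^{\mathrm{op}}$; $\mathsf{Dual}(\mathcal O_{\mathcal R}I_{\mathcal T})$ from (A3) to (A4), with functors the equivalence $\mathcal O_{\mathcal R}I_{\mathcal T}:\mathbf{Raney}_{\mathcal T}\to\mathbf{Frm}_{\mathcal E}$ and the identity of $\mathbf{Top}_D^{\mathrm{op}}$; and the morphism from (A4) to (A5) given by the wide inclusion $\mathbf{Frm}_{\mathcal E}\hookrightarrow\mathbf{Frm}$ and the full inclusion $\mathbf{Top}_D^{\mathrm{op}}\hookrightarrow\mathbf{Top}^{\mathrm{op}}$. Moreover, $\mathsf{Dual}(\mathcal O_{\mathcal R}I_{\mathcal T})$ and $\mathsf{Dual}(I_{\mathcal T})$ are also in $\mathbf{SADJ}$.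
   Context: $\mathbf{Frm}$: frames and frame homomorphisms; $\mathbf 2=\{0<1\}$; $\mathbf{Top}$: topological spaces; $\mathbf{Top}_D$: the full subcategory of $T_D$-spaces (every point is the intersection of an open and a closed set); $\mathbb S$: the Sierpinski space; $|\cdot|$: underlying sets/functions. $\Omega(X)$ is the frame of opens; $\mathsf{pt}(L)=\mathbf{Frm}(L,\mathbf 2)$ with opens $\{f\mid f(a)=1\}$, $a\in L$. SFC-categories. For a faithful $U:\mathcal A\to\mathcal B$, a morphism $U(A)\to U(A')$ lifts if it is $U(p)$ for some $p:A\to A'$; a cartesian lift of a family $\{f_i:X\to U(C)\}$ is $(\overline X,\theta:U(\overline X)\cong X)$ such that $h:U(D)\to U(\overline X)$ lifts iff all $f_i\theta h$ lift. A PFC-category is $(\mathcal O_{\mathcal C},\mathcal C,\mathbf 2_{\mathcal C},\iota_{\mathcal C})$ with $\mathcal O_{\mathcal C}:\mathcal C\to\mathbf{Frm}$ faithful, $\mathbf 2_{\mathcal C}\in\mathcal C$, $\iota_{\mathcal C}:\mathcal O_{\mathcal C}\mathbf 2_{\mathcal C}\cong\mathbf 2$. $\mathbf{Top}_{\mathcal C}\subseteq\mathbf{Top}$ is the full subcategory of the $X$ such that $\{|\iota_{\mathcal C}^{-1}|\circ\chi_x:\mathbf{Top}(X,\mathbb S)\to|\mathcal O_{\mathcal C}\mathbf 2_{\mathcal C}|\mid x\in X\}$, $\chi_x(g)=g(x)$, has a cartesian lift $(\Omega_{\mathcal C}X,\theta_{\mathcal C,X})$ w.r.t. $|\mathcal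 O_{\mathcal C}(-)|$; $\mathsf{pt}_{\mathcal C}(C)=\mathcal C(C,\mathbf 2_{\mathcal C})$ with opens $\{f\mid\iota_{\mathcal C}(\mathcal O_{\mathcal C}f(a))=1\}$, $a\in\mathcal O_{\mathcal C}C$. It is an SFC-category if $\mathbb S$ and all $\mathsf{pt}_{\mathcal C}(C)$ lie in $\mathbf{Top}_{\mathcal C}$. A morphism of SFC-categories $(H,\alpha,i):\mathcal C\to\mathcal D$ is a functor $H$ with a natural isomorphism $\alpha:\mathcal O_{\mathcal D}H\to\mathcal O_{\mathcal C}$ and an isomorphism $i:H\mathbf 2_{\mathcal C}\to\mathbf 2_{\mathcal D}$ with $\iota_{\mathcal D}\mathcal O_{\mathcal D}(i)=\iota_{\mathcal C}\alpha_{\mathbf 2_{\mathcal C}}$, such that for $X\in\mathbf{Top}_{\mathcal C}$, $(H\Omega_{\mathcal C}X,\theta_{\mathcal C,X}|\alpha_{\Omega_{\mathcal C}X}|)$ is a cartesian lift w.r.t. $|\mathcal O_{\mathcal D}(-)|$ of $\{|\alpha_{\mathbf 2_{\mathcal C}}^{-1}||\iota_{\mathcal C}^{-1}|\chi_x\}$. A morphism is denoted by its functor $H$ when $\alpha$ and $i$ are clear; here they are identities. $\mathbf{Raney}$, $\mathbf{Raney}_{\mathcal I}$, $\mathbf{Raney}_{\mathcal T}$ are taken with distinguished object $\mathbf 2_{\mathcal R}$ and (the restrictions of) $\mathcal O_{\mathcal R}$; $\mathbf{Frm}_{\mathcal E}$ and $\mathbf{Frm}$ with distinguished object $\mathbf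 2$ and the inclusion into, respectively the identity of, $\mathbf{Frm}$; all isomorphisms $\iota$ are identities. Adjunction morphisms. For adjunctions $F\dashv G$ (unit $\eta$) and $P\dashv Q$ (counit $\delta$), a right adjunction morphism consists of functors $U,V$ and a mate-pair $\zeta:UG\to QV$, $\xi:PU\to VF$ (i.e. $\xi=\delta_{VF}\circ P\zeta_F\circ PU\eta$) with $\zeta$ invertible; it is strong if $\xi$ is also invertible. $\mathbf{RADJ}$ (resp. $\mathbf{SADJ}$) is the 2-category of adjunctions with right (resp. strong) adjunction morphisms. The 2-functor $\mathsf{Dual}$ from SFC-categories to $\mathbf{RADJ}$ sends an SFC-category to the adjunction $\mathsf{pt}_{\mathcal C}\dashv\Omega_{\mathcal C}$ between $\mathcal C$ and $\mathbf{Top}_{\mathcal C}^{\mathrm{op}}$ (on morphisms, $\mathsf{pt}_{\mathcal C}$ is precomposition and $\Omega_{\mathcal C}$ lifts precomposition). It sends a morphism $(H,\alpha,i):\mathcal C\to\mathcal D$ (for which $\mathbf{Top}_{\mathcal C}\subseteq\mathbf{Top}_{\mathcal D}$) to the right adjunction morphism given by $H$, the inclusion $\mathbf{Top}_{\mathcal C}^{\mathrm{op}}\subseteq\mathbf{Top}_{\mathcal D}^{\mathrm{op}}$, the isomorphism $\zeta^H_X:H\Omega_{\mathcal C}X\to\Omega_{\mathcal D}X$ with underlying function $\theta_{\mathcal D,X}^{-1}\theta_{\mathcal C,X}|\alpha_{\Omega_{\mathcal C}X}|$, and the continuous maps $\xi^H_C:\mathsf{pt}_{\mathcal C}C\to\mathsf{pt}_{\mathcal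 D}HC$, $f\mapsto i\circ H(f)$. Raney extensions. $\mathsf{Filt}(L)$ is the coframe of all filters of $L$ under reverse inclusion. In a coframe $K$, $x\setminus k$ is the least $c$ with $x\le k\vee c$; a subcolocale is a subset $A$ closed under all joins with $x\setminus k\in A$ for $x\in A,k\in K$. A meet $\bigwedge_ix_i$ is exact if $\bigwedge_i(x_i\vee y)=\bigwedge_ix_i\vee y$ for all $y$; $S\subseteq L$ is strongly exact if whenever $s\to y=y$ for all $s\in S$ then $\bigwedge S\to y=y$. $\mathsf{Filt}_{\mathcal E}(L)$, $\mathsf{Filt}_{\mathcal{SE}}(L)$: filters closed under exact, respectively strongly exact, meets. A Raney extension is $(L,\mathcal F)$ with $\mathcal F$ a subcolocale of $\mathsf{Filt}(L)$, $\mathsf{Filt}_{\mathcal E}(L)\subseteq\mathcal F\subseteq\mathsf{Filt}_{\mathcal{SE}}(L)$; a morphism $(L,\mathcal F)\to(M,\mathcal G)$ in $\mathbf{Raney}$ is a frame map $f$ with $f^{-1}(G)\in\mathcal F$ for all $G\in\mathcal G$. $\mathcal O_{\mathcal R}(L,\mathcal F)=L$; $\mathbf 2_{\mathcal R}=(\mathbf 2,\mathsf{Filt}(\mathbf 2))$. $\mathsf{pt}_{\mathcal R}(L,\mathcal F)=\mathbf{Raney}((L,\mathcal F),\mathbf 2_{\mathcal R})$ with opens $\{f\mid f(a)=1\}$, $a\in L$. $\mathcal U:\mathbf{Top}^{\mathrm{op}}\to\mathbf{Raney}$ sends $X$ to $(\Omega X,\mathcal U^*X)$, $\mathcal U^*X=\{\{U\in\Omega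 X\mid A\subseteq U\}\mid A\subseteq X\text{ an intersection of opens}\}$. The functor $\mathsf{Filt}_{\mathcal{SE}}:\mathbf{Frm}\to\mathbf{Raney}$ sends $L$ to $(L,\mathsf{Filt}_{\mathcal{SE}}(L))$. An object $C$ of a category with faithful $\mathcal O:\mathcal C\to\mathbf{Frm}$ is fiber-initial (fiber-terminal) if for every $D$ and isomorphism $\theta:\mathcal O(D)\cong\mathcal O(C)$ there is $p:C\to D$ with $\theta\circ\mathcal O(p)=\mathrm{id}$ (resp. $p:D\to C$ with $\mathcal O(p)=\theta$). $\mathbf{Frm}_{\mathcal E}$: frames with exact maps, i.e. frame maps $f:L\to M$ with $f^{-1}(F)\in\mathsf{Filt}_{\mathcal E}(L)$ for all $F\in\mathsf{Filt}_{\mathcal E}(M)$. $\mathsf{pt}_{\mathcal E}(L)=\mathbf{Frm}_{\mathcal E}(L,\mathbf 2)$ with opens $\{f\mid f(a)=1\}$, $a\in L$.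
   Formalization: In (A3) and (A4), Dual of Raney_T and of Frm_E is restricted to its T_0 spaces, which gives Top_D^op; unrestricted, it also contains non-T_0 spaces such as the two-point indiscrete space. The morphisms are proved for both versions. *)

theory Defs
  imports "HOL-Analysis.Abstract_Topological_Spaces" "HOL-Algebra.Complete_Lattice"
begin

section \<open>Universes of sets\<close>

text \<open>
  Frames, spaces and hom-sets must be small, and their category must be closed under
  power sets. We work over an arbitrary type \<open>'u\<close> which is a universe of sets: each element has
  a set of elements in \<open>'u\<close>, and the usual closure axioms hold. The axioms of
  infinity and foundation are not needed. The type of all ZF sets, with its membership
  relation, is an instance.
\<close>

class universe =
  fixes elts :: "'a \<Rightarrow> 'a set"
  assumes elts_inject: "elts x = elts y \<Longrightarrow> x = y"
    and elts_subset: "A \<subseteq> elts x \<Longrightarrow> \<exists>y. elts y = A"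
    and elts_replacement: "\<exists>y. elts y = f ` elts x"
    and elts_Union: "\<exists>y. elts y = (\<Union>z\<in>elts x. elts z)"
    and elts_Pow: "\<exists>y. elts y = {z. elts z \<subseteq> elts x}"

definition small :: "'u::universe set \<Rightarrow> bool" where
  "small A \<longleftrightarrow> (\<exists>x. elts x = A)"

definition vset :: "'u::universe set \<Rightarrow> 'u" where
  "vset A = (THE x. elts x = A)"

definition vpair :: "'u::universe \<Rightarrow> 'u \<Rightarrow> 'u" where
  "vpair x y = vset {vset {x}, vset {x, y}}"

text \<open>Functions between small sets are elements of the universe, coded by their graphs.\<close>

definition vgraph :: "'u::universe set \<Rightarrow> ('u \<Rightarrow> 'u) \<Rightarrow> 'u" where
  "vgraph A f = vset ((\<lambda>x. vpair x (f x)) ` A)"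

definition app :: "'u::universe \<Rightarrow> 'u \<Rightarrow> 'u" where
  "app f x = (THE y. vpair x y \<in> elts f)"

definition vfuns :: "'u::universe set \<Rightarrow> 'u set \<Rightarrow> 'u set" where
  "vfuns A B = {vgraph A f | f. f \<in> A \<rightarrow> B}"

definition vcomp :: "'u::universe \<Rightarrow> 'u \<Rightarrow> 'u" where
  "vcomp g f = vset {vpair x z | x y z. vpair x y \<in> elts f \<and> vpair y z \<in> elts g}"

definition vid :: "'u::universe set \<Rightarrow> 'u" where
  "vid A = vgraph A (\<lambda>x. x)"

definition v0 :: "'u::universe" where "v0 = vset {}"
definition v1 :: "'u::universe" where "v1 = vset {v0}"


section \<open>Categories, functors, adjunctions\<close>

text \<open>
  Hom-sets may overlap (the graph of a function does not determine its codomain), so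
  functors take the source and target objects as arguments of their action on arrows.
\<close>

record ('o, 'm) cat =
  Obj :: "'o set"
  Hom :: "'o \<Rightarrow> 'o \<Rightarrow> 'm set"
  Idt :: "'o \<Rightarrow> 'm"
  Comp :: "'m \<Rightarrow> 'm \<Rightarrow> 'm"  (infixl \<open>\<cdot>\<index>\<close> 70)

definition category :: "('o, 'm) cat \<Rightarrow> bool" where
  "category C \<longleftrightarrow>
     (\<forall>A\<in>Obj C. Idt C A \<in> Hom C A A) \<and>
     (\<forall>A\<in>Obj C. \<forall>B\<in>Obj C. \<forall>D\<in>Obj C. \<forall>f\<in>Hom C A B. \<forall>g\<in>Hom C B D. g \<cdot>\<^bsub>C\<^esub> f \<in> Hom C A D) \<and>
     (\<forall>A\<in>Obj C. \<forall>B\<in>Obj C. \<forall>f\<in>Hom C A B. f \<cdot>\<^bsub>C\<^esub> Idt C A = f \<and> Idt C B \<cdot>\<^bsub>C\<^esub> f = f) \<and>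
     (\<forall>A\<in>Obj C. \<forall>B\<in>Obj C. \<forall>D\<in>Obj C. \<forall>E\<in>Obj C.
        \<forall>f\<in>Hom C A B. \<forall>g\<in>Hom C B D. \<forall>h\<in>Hom C D E. h \<cdot>\<^bsub>C\<^esub> (g \<cdot>\<^bsub>C\<^esub> f) = (h \<cdot>\<^bsub>C\<^esub> g) \<cdot>\<^bsub>C\<^esub> f)"

definition op_cat :: "('o, 'm) cat \<Rightarrow> ('o, 'm) cat" where
  "op_cat C = \<lparr>Obj = Obj C, Hom = (\<lambda>A B. Hom C B A), Idt = Idt C, Comp = (\<lambda>g f. f \<cdot>\<^bsub>C\<^esub> g)\<rparr>"

definition full_subcat :: "('o, 'm) cat \<Rightarrow> 'o set \<Rightarrow> ('o, 'm) cat" where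
  "full_subcat C S = C\<lparr>Obj := Obj C \<inter> S\<rparr>"

definition is_inverse :: "('o, 'm) cat \<Rightarrow> 'o \<Rightarrow> 'o \<Rightarrow> 'm \<Rightarrow> 'm \<Rightarrow> bool" where
  "is_inverse C A B f g \<longleftrightarrow> g \<in> Hom C B A \<and> g \<cdot>\<^bsub>C\<^esub> f = Idt C A \<and> f \<cdot>\<^bsub>C\<^esub> g = Idt C B"

definition is_iso :: "('o, 'm) cat \<Rightarrow> 'o \<Rightarrow> 'o \<Rightarrow> 'm \<Rightarrow> bool" where
  "is_iso C A B f \<longleftrightarrow> f \<in> Hom C A B \<and> (\<exists>g. is_inverse C A B f g)"

definition inv_arr :: "('o, 'm) cat \<Rightarrow> 'o \<Rightarrow> 'o \<Rightarrow> 'm \<Rightarrow> 'm" where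
  "inv_arr C A B f = (THE g. is_inverse C A B f g)"

record ('o, 'm, 'p, 'n) func =
  Fobj :: "'o \<Rightarrow> 'p"
  Farr :: "'o \<Rightarrow> 'o \<Rightarrow> 'm \<Rightarrow> 'n"

definition is_functor :: "('o, 'm) cat \<Rightarrow> ('p, 'n) cat \<Rightarrow> ('o, 'm, 'p, 'n) func \<Rightarrow> bool" where
  "is_functor C D F \<longleftrightarrow>
     (\<forall>A\<in>Obj C. Fobj F A \<in> Obj D \<and> Farr F A A (Idt C A) = Idt D (Fobj F A)) \<and>
     (\<forall>A\<in>Obj C. \<forall>B\<in>Obj C. \<forall>f\<in>Hom C A B. Farr F A B f \<in> Hom D (Fobj F A) (Fobj F B)) \<and>
     (\<forall>A\<in>Obj C. \<forall>B\<in>Obj C. \<forall>E\<in>Obj C. \<forall>f\<in>Hom C A B. \<forall>g\<in>Hom C B E.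
        Farr F A E (g \<cdot>\<^bsub>C\<^esub> f) = Farr F B E g \<cdot>\<^bsub>D\<^esub> Farr F A B f)"

definition faithful :: "('o, 'm) cat \<Rightarrow> ('o, 'm, 'p, 'n) func \<Rightarrow> bool" where
  "faithful C F \<longleftrightarrow> (\<forall>A\<in>Obj C. \<forall>B\<in>Obj C. inj_on (Farr F A B) (Hom C A B))"

text \<open>Equality of functors, regardless of their values outside the source category.\<close>

definition functors_agree ::
  "('o, 'm) cat \<Rightarrow> ('o, 'm, 'p, 'n) func \<Rightarrow> ('o, 'm, 'p, 'n) func \<Rightarrow> bool" where
  "functors_agree C F G \<longleftrightarrow>
     (\<forall>A\<in>Obj C. Fobj F A = Fobj G A) \<and>
     (\<forall>A\<in>Obj C. \<forall>B\<in>Obj C. \<forall>f\<in>Hom C A B. Farr F A B f = Farr G A B f)"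

definition comp_func ::
  "('p, 'n, 'q, 'k) func \<Rightarrow> ('o, 'm, 'p, 'n) func \<Rightarrow> ('o, 'm, 'q, 'k) func"  (infixr \<open>\<circ>\<^sub>F\<close> 75) where
  "G \<circ>\<^sub>F F = \<lparr>Fobj = (\<lambda>A. Fobj G (Fobj F A)),
             Farr = (\<lambda>A B f. Farr G (Fobj F A) (Fobj F B) (Farr F A B f))\<rparr>"

text \<open>The inclusion of a subcategory; in particular the identity functor.\<close>

definition incl :: "('o, 'm, 'o, 'm) func" where
  "incl = \<lparr>Fobj = (\<lambda>A. A), Farr = (\<lambda>A B f. f)\<rparr>"

definition nat_trans ::
  "('o, 'm) cat \<Rightarrow> ('p, 'n) cat \<Rightarrow> ('o, 'm, 'p, 'n) func \<Rightarrow> ('o, 'm, 'p, 'n) func \<Rightarrow>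
   ('o \<Rightarrow> 'n) \<Rightarrow> bool" where
  "nat_trans C D F G t \<longleftrightarrow>
     (\<forall>A\<in>Obj C. t A \<in> Hom D (Fobj F A) (Fobj G A)) \<and>
     (\<forall>A\<in>Obj C. \<forall>B\<in>Obj C. \<forall>f\<in>Hom C A B. Farr G A B f \<cdot>\<^bsub>D\<^esub> t A = t B \<cdot>\<^bsub>D\<^esub> Farr F A B f)"

definition nat_iso ::
  "('o, 'm) cat \<Rightarrow> ('p, 'n) cat \<Rightarrow> ('o, 'm, 'p, 'n) func \<Rightarrow> ('o, 'm, 'p, 'n) func \<Rightarrow>
   ('o \<Rightarrow> 'n) \<Rightarrow> bool" where
  "nat_iso C D F G t \<longleftrightarrow>
     nat_trans C D F G t \<and> (\<forall>A\<in>Obj C. is_iso D (Fobj F A) (Fobj G A) (t A))"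

definition equivalence_functor ::
  "('o, 'm) cat \<Rightarrow> ('p, 'n) cat \<Rightarrow> ('o, 'm, 'p, 'n) func \<Rightarrow> bool" where
  "equivalence_functor C D F \<longleftrightarrow> is_functor C D F \<and>
     (\<exists>G s t. is_functor D C G \<and> nat_iso C C incl (G \<circ>\<^sub>F F) s \<and> nat_iso D D (F \<circ>\<^sub>F G) incl t)"

record ('o, 'm, 'p, 'n) adj =
  Lcat :: "('o, 'm) cat"
  Rcat :: "('p, 'n) cat"
  Ladj :: "('o, 'm, 'p, 'n) func"
  Radj :: "('p, 'n, 'o, 'm) func"
  Aunit :: "'o \<Rightarrow> 'm"
  Acounit :: "'p \<Rightarrow> 'n"

definition is_adjunction :: "('o, 'm, 'p, 'n) adj \<Rightarrow> bool" where
  "is_adjunction A \<longleftrightarrow>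
     category (Lcat A) \<and> category (Rcat A) \<and>
     is_functor (Lcat A) (Rcat A) (Ladj A) \<and> is_functor (Rcat A) (Lcat A) (Radj A) \<and>
     nat_trans (Lcat A) (Lcat A) incl (Radj A \<circ>\<^sub>F Ladj A) (Aunit A) \<and>
     nat_trans (Rcat A) (Rcat A) (Ladj A \<circ>\<^sub>F Radj A) incl (Acounit A) \<and>
     (\<forall>C\<in>Obj (Lcat A).
        Acounit A (Fobj (Ladj A) C) \<cdot>\<^bsub>Rcat A\<^esub>
          Farr (Ladj A) C (Fobj (Radj A) (Fobj (Ladj A) C)) (Aunit A C)
        = Idt (Rcat A) (Fobj (Ladj A) C)) \<and>
     (\<forall>D\<in>Obj (Rcat A).
        Farr (Radj A) (Fobj (Ladj A) (Fobj (Radj A) D)) D (Acounit A D) \<cdot>\<^bsub>Lcat A\<^esub>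
          Aunit A (Fobj (Radj A) D)
        = Idt (Lcat A) (Fobj (Radj A) D))"

definition adjunction_between ::
  "('o, 'm, 'p, 'n) adj \<Rightarrow> ('o, 'm) cat \<Rightarrow> ('p, 'n) cat \<Rightarrow>
   ('o, 'm, 'p, 'n) func \<Rightarrow> ('p, 'n, 'o, 'm) func \<Rightarrow> bool" where
  "adjunction_between A C D F G \<longleftrightarrow> is_adjunction A \<and> Lcat A = C \<and> Rcat A = D \<and>
     functors_agree C (Ladj A) F \<and> functors_agree D (Radj A) G"

record ('o, 'm, 'p, 'n, 'o2, 'm2, 'p2, 'n2) adj_mor =
  Lfun :: "('o, 'm, 'o2, 'm2) func"
  Rfun :: "('p, 'n, 'p2, 'n2) func"
  Mzeta :: "'p \<Rightarrow> 'm2"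
  Mxi :: "'o \<Rightarrow> 'n2"

definition right_adj_morphism ::
  "('o, 'm, 'p, 'n) adj \<Rightarrow> ('o2, 'm2, 'p2, 'n2) adj \<Rightarrow>
   ('o, 'm, 'p, 'n, 'o2, 'm2, 'p2, 'n2) adj_mor \<Rightarrow> bool" where
  "right_adj_morphism A B M \<longleftrightarrow>
     is_adjunction A \<and> is_adjunction B \<and>
     is_functor (Lcat A) (Lcat B) (Lfun M) \<and> is_functor (Rcat A) (Rcat B) (Rfun M) \<and>
     nat_iso (Rcat A) (Lcat B) (Lfun M \<circ>\<^sub>F Radj A) (Radj B \<circ>\<^sub>F Rfun M) (Mzeta M) \<and>
     nat_trans (Lcat A) (Rcat B) (Ladj B \<circ>\<^sub>F Lfun M) (Rfun M \<circ>\<^sub>F Ladj A) (Mxi M) \<and>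
     (\<forall>C\<in>Obj (Lcat A).
        let FC = Fobj (Ladj A) C;
            UC = Fobj (Lfun M) C;
            UGFC = Fobj (Lfun M) (Fobj (Radj A) FC);
            VFC = Fobj (Rfun M) FC
        in Mxi M C =
             Acounit B VFC \<cdot>\<^bsub>Rcat B\<^esub>
             Farr (Ladj B) UGFC (Fobj (Radj B) VFC) (Mzeta M FC) \<cdot>\<^bsub>Rcat B\<^esub>
             Farr (Ladj B) UC UGFC (Farr (Lfun M) C (Fobj (Radj A) FC) (Aunit A C)))"

definition strong_adj_morphism ::
  "('o, 'm, 'p, 'n) adj \<Rightarrow> ('o2, 'm2, 'p2, 'n2) adj \<Rightarrow>
   ('o, 'm, 'p, 'n, 'o2, 'm2, 'p2, 'n2) adj_mor \<Rightarrow> bool" where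
  "strong_adj_morphism A B M \<longleftrightarrow> right_adj_morphism A B M \<and>
     nat_iso (Lcat A) (Rcat B) (Ladj B \<circ>\<^sub>F Lfun M) (Rfun M \<circ>\<^sub>F Ladj A) (Mxi M)"


section \<open>Small sets, spaces and frames\<close>

definition Set_cat :: "('u::universe set, 'u) cat" where
  "Set_cat = \<lparr>Obj = {A. small A}, Hom = vfuns, Idt = vid, Comp = vcomp\<rparr>"

definition Top_cat :: "('u::universe topology, 'u) cat" where
  "Top_cat = \<lparr>Obj = {X. small (topspace X)},
     Hom = (\<lambda>X Y. {f \<in> vfuns (topspace X) (topspace Y). continuous_map X Y (app f)}),
     Idt = (\<lambda>X. vid (topspace X)), Comp = vcomp\<rparr>"

definition TD_space :: "'a topology \<Rightarrow> bool" where
  "TD_space X \<longleftrightarrow> (\<forall>x\<in>topspace X. \<exists>U C. openin X U \<and> closedin X C \<and> {x} = U \<inter> C)"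

definition TopD_cat :: "('u::universe topology, 'u) cat" where
  "TopD_cat = full_subcat Top_cat {X. TD_space X}"

definition Sierpinski :: "'u::universe topology" where
  "Sierpinski = topology (\<lambda>U. U \<in> {{}, {v1}, {v0, v1}})"

text \<open>
  The last conjunct normalises the order relation outside the carrier, so that frames are equal as
  soon as they have the same elements and the same order.
\<close>

definition frame :: "'a gorder \<Rightarrow> bool" where
  "frame L \<longleftrightarrow> complete_lattice L \<and>
     (\<forall>a\<in>carrier L. \<forall>B\<subseteq>carrier L. a \<sqinter>\<^bsub>L\<^esub> (\<Squnion>\<^bsub>L\<^esub> B) = \<Squnion>\<^bsub>L\<^esub> ((\<lambda>b. a \<sqinter>\<^bsub>L\<^esub> b) ` B)) \<and>
     (\<forall>x y. x \<sqsubseteq>\<^bsub>L\<^esub> y \<longrightarrow> x \<in> carrier L \<and> y \<in> carrier L)"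

definition frame_map :: "'a gorder \<Rightarrow> 'b gorder \<Rightarrow> ('a \<Rightarrow> 'b) \<Rightarrow> bool" where
  "frame_map L M f \<longleftrightarrow> f \<in> carrier L \<rightarrow> carrier M \<and>
     (\<forall>A\<subseteq>carrier L. f (\<Squnion>\<^bsub>L\<^esub> A) = \<Squnion>\<^bsub>M\<^esub> (f ` A)) \<and>
     f (\<top>\<^bsub>L\<^esub>) = \<top>\<^bsub>M\<^esub> \<and>
     (\<forall>a\<in>carrier L. \<forall>b\<in>carrier L. f (a \<sqinter>\<^bsub>L\<^esub> b) = f a \<sqinter>\<^bsub>M\<^esub> f b)"

definition Frm_cat :: "('u::universe gorder, 'u) cat" where
  "Frm_cat = \<lparr>Obj = {L. frame L \<and> small (carrier L)},
     Hom = (\<lambda>L M. {f \<in> vfuns (carrier L) (carrier M). frame_map L M (app f)}),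
     Idt = (\<lambda>L. vid (carrier L)), Comp = vcomp\<rparr>"

definition two :: "'u::universe gorder" where
  "two = \<lparr>carrier = {v0, v1}, eq = (=),
     le = (\<lambda>x y. x \<in> {v0, v1} \<and> y \<in> {v0, v1} \<and> (x = y \<or> x = v0))\<rparr>"

definition forget :: "('u::universe gorder, 'u, 'u set, 'u) func" where
  "forget = \<lparr>Fobj = carrier, Farr = (\<lambda>L M f. f)\<rparr>"

definition opens :: "'u::universe topology \<Rightarrow> 'u gorder" where
  "opens X = \<lparr>carrier = vset ` {U. openin X U}, eq = (=),
     le = (\<lambda>u v. u \<in> vset ` {U. openin X U} \<and> v \<in> vset ` {U. openin X U} \<and> elts u \<subseteq> elts v)\<rparr>"

text \<open>The action of \<open>\<Omega>\<close> on an arrow \<open>X \<rightarrow> Y\<close> of \<open>Top\<^sup>o\<^sup>p\<close>, i.e. a continuous map \<open>f: Y \<rightarrow> X\<close>.\<close>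

definition preimage_arr :: "'u::universe topology \<Rightarrow> 'u topology \<Rightarrow> 'u \<Rightarrow> 'u" where
  "preimage_arr X Y f =
     vgraph (carrier (opens X)) (\<lambda>v. vset {y \<in> topspace Y. app f y \<in> elts v})"

definition Omega :: "('u::universe topology, 'u, 'u gorder, 'u) func" where
  "Omega = \<lparr>Fobj = opens, Farr = preimage_arr\<rparr>"


section \<open>SFC-categories\<close>

definition lifts ::
  "('o, 'm) cat \<Rightarrow> ('o, 'm, 'p, 'n) func \<Rightarrow> 'o \<Rightarrow> 'o \<Rightarrow> 'n \<Rightarrow> bool" where
  "lifts A U D E h \<longleftrightarrow> (\<exists>p\<in>Hom A D E. Farr U D E p = h)"

text \<open>\<open>(Y, t)\<close> is a cartesian lift of the family \<open>\<Phi>\<close> of arrows \<open>X \<rightarrow> U C\<close>.\<close>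

definition cartesian_lift ::
  "('o, 'm) cat \<Rightarrow> ('p, 'n) cat \<Rightarrow> ('o, 'm, 'p, 'n) func \<Rightarrow> 'p \<Rightarrow> 'o \<Rightarrow> 'n set \<Rightarrow>
   'o \<Rightarrow> 'n \<Rightarrow> bool" where
  "cartesian_lift A B U X C \<Phi> Y t \<longleftrightarrow>
     Y \<in> Obj A \<and> is_iso B (Fobj U Y) X t \<and>
     (\<forall>D\<in>Obj A. \<forall>h\<in>Hom B (Fobj U D) (Fobj U Y).
        lifts A U D Y h \<longleftrightarrow> (\<forall>f\<in>\<Phi>. lifts A U D C (f \<cdot>\<^bsub>B\<^esub> t \<cdot>\<^bsub>B\<^esub> h)))"

text \<open>
  A PFC-category, together with a choice \<open>(lift_ob X, lift_arr X)\<close> of the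
  cartesian lifts \<open>(\<Omega>\<^sub>C X, \<theta>\<^bsub>C,X\<^esub>)\<close>. As arrows of frames and of sets are graphs, the
  underlying function of a frame map is that frame map itself.
\<close>

record ('o, 'u) sfc =
  sfc_cat :: "('o, 'u) cat"
  sfc_O :: "('o, 'u, 'u gorder, 'u) func"
  sfc_two :: "'o"
  sfc_iota :: "'u"
  lift_ob :: "'u topology \<Rightarrow> 'o"
  lift_arr :: "'u topology \<Rightarrow> 'u"

definition is_pfc :: "('o, 'u::universe) sfc \<Rightarrow> bool" where
  "is_pfc P \<longleftrightarrow> category (sfc_cat P) \<and>
     is_functor (sfc_cat P) Frm_cat (sfc_O P) \<and> faithful (sfc_cat P) (sfc_O P) \<and>
     sfc_two P \<in> Obj (sfc_cat P) \<and>
     is_iso Frm_cat (Fobj (sfc_O P) (sfc_two P)) two (sfc_iota P)"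

definition und :: "('o, 'u::universe) sfc \<Rightarrow> ('o, 'u, 'u set, 'u) func" where
  "und P = forget \<circ>\<^sub>F sfc_O P"

definition chi :: "'u::universe topology \<Rightarrow> 'u \<Rightarrow> 'u" where
  "chi X x = vgraph (Hom Top_cat X Sierpinski) (\<lambda>g. app g x)"

definition point_arr :: "('o, 'u::universe) sfc \<Rightarrow> 'u topology \<Rightarrow> 'u \<Rightarrow> 'u" where
  "point_arr P X x =
     inv_arr Frm_cat (Fobj (sfc_O P) (sfc_two P)) two (sfc_iota P) \<cdot>\<^bsub>Set_cat\<^esub> chi X x"

definition is_sfc_lift :: "('o, 'u::universe) sfc \<Rightarrow> 'u topology \<Rightarrow> 'o \<Rightarrow> 'u \<Rightarrow> bool" where
  "is_sfc_lift P X Y t \<longleftrightarrow>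
     cartesian_lift (sfc_cat P) Set_cat (und P) (Hom Top_cat X Sierpinski) (sfc_two P)
       (point_arr P X ` topspace X) Y t"

definition Top_of :: "('o, 'u::universe) sfc \<Rightarrow> ('u topology, 'u) cat" where
  "Top_of P = full_subcat Top_cat {X. \<exists>Y t. is_sfc_lift P X Y t}"

definition pt_space :: "('o, 'u::universe) sfc \<Rightarrow> 'o \<Rightarrow> 'u topology" where
  "pt_space P C = topology (\<lambda>W. \<exists>a\<in>carrier (Fobj (sfc_O P) C).
     W = {f \<in> Hom (sfc_cat P) C (sfc_two P).
            app (sfc_iota P) (app (Farr (sfc_O P) C (sfc_two P) f) a) = v1})"

definition is_sfc :: "('o, 'u::universe) sfc \<Rightarrow> bool" where
  "is_sfc P \<longleftrightarrow> is_pfc P \<and>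
     Sierpinski \<in> Obj (Top_of P) \<and>
     (\<forall>C\<in>Obj (sfc_cat P). pt_space P C \<in> Obj (Top_of P)) \<and>
     (\<forall>X\<in>Obj (Top_of P). is_sfc_lift P X (lift_ob P X) (lift_arr P X))"

record ('o, 'p, 'u) sfc_mor =
  mor_H :: "('o, 'u, 'p, 'u) func"
  mor_alpha :: "'o \<Rightarrow> 'u"
  mor_i :: "'u"

definition sfc_morphism ::
  "('o, 'u::universe) sfc \<Rightarrow> ('p, 'u) sfc \<Rightarrow> ('o, 'p, 'u) sfc_mor \<Rightarrow> bool" where
  "sfc_morphism P Q m \<longleftrightarrow>
     is_sfc P \<and> is_sfc Q \<and>
     is_functor (sfc_cat P) (sfc_cat Q) (mor_H m) \<and>
     nat_iso (sfc_cat P) Frm_cat (sfc_O Q \<circ>\<^sub>F mor_H m) (sfc_O P) (mor_alpha m) \<and>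
     is_iso (sfc_cat Q) (Fobj (mor_H m) (sfc_two P)) (sfc_two Q) (mor_i m) \<and>
     sfc_iota Q \<cdot>\<^bsub>Frm_cat\<^esub> Farr (sfc_O Q) (Fobj (mor_H m) (sfc_two P)) (sfc_two Q) (mor_i m)
       = sfc_iota P \<cdot>\<^bsub>Frm_cat\<^esub> mor_alpha m (sfc_two P) \<and>
     (\<forall>X\<in>Obj (Top_of P).
        cartesian_lift (sfc_cat Q) Set_cat (und Q)
          (Hom Top_cat X Sierpinski) (Fobj (mor_H m) (sfc_two P))
          ((\<lambda>x. inv_arr Frm_cat (Fobj (sfc_O Q) (Fobj (mor_H m) (sfc_two P)))
                  (Fobj (sfc_O P) (sfc_two P)) (mor_alpha m (sfc_two P))
                \<cdot>\<^bsub>Set_cat\<^esub> point_arr P X x) ` topspace X)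
          (Fobj (mor_H m) (lift_ob P X))
          (lift_arr P X \<cdot>\<^bsub>Set_cat\<^esub> mor_alpha m (lift_ob P X)))"

text \<open>The morphism with functor \<open>H\<close> whose \<open>\<alpha>\<close> and \<open>i\<close> are identities.\<close>

definition strict_mor ::
  "('o, 'u::universe) sfc \<Rightarrow> ('p, 'u) sfc \<Rightarrow> ('o, 'u, 'p, 'u) func \<Rightarrow> ('o, 'p, 'u) sfc_mor" where
  "strict_mor P Q H = \<lparr>mor_H = H, mor_alpha = (\<lambda>C. Idt Frm_cat (Fobj (sfc_O P) C)),
     mor_i = Idt (sfc_cat Q) (sfc_two Q)\<rparr>"


section \<open>The 2-functor Dual\<close>

definition pt_func :: "('o, 'u::universe) sfc \<Rightarrow> ('o, 'u, 'u topology, 'u) func" where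
  "pt_func P = \<lparr>Fobj = pt_space P,
     Farr = (\<lambda>C D f. vgraph (Hom (sfc_cat P) D (sfc_two P)) (\<lambda>g. g \<cdot>\<^bsub>sfc_cat P\<^esub> f))\<rparr>"

text \<open>
  On an arrow \<open>X \<rightarrow> Y\<close> of \<open>Top\<^sup>o\<^sup>p\<close>, given by a continuous \<open>f: Y \<rightarrow> X\<close>, the functor \<open>\<Omega>\<^sub>C\<close> is the
  lift of the precomposition map from \<open>Top(X, S)\<close> to \<open>Top(Y, S)\<close>.
\<close>

definition Omega_func :: "('o, 'u::universe) sfc \<Rightarrow> ('u topology, 'u, 'o, 'u) func" where
  "Omega_func P = \<lparr>Fobj = lift_ob P,
     Farr = (\<lambda>X Y f. THE p. p \<in> Hom (sfc_cat P) (lift_ob P X) (lift_ob P Y) \<and>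
        lift_arr P Y \<cdot>\<^bsub>Set_cat\<^esub> Farr (und P) (lift_ob P X) (lift_ob P Y) p
        = vgraph (Hom Top_cat X Sierpinski) (\<lambda>g. g \<cdot>\<^bsub>Top_cat\<^esub> f) \<cdot>\<^bsub>Set_cat\<^esub> lift_arr P X)\<rparr>"

text \<open>The unit lifts the evaluation map; it sends \<open>a\<close> to \<open>f \<mapsto> \<iota>(O\<^sub>C f(a))\<close>.\<close>

definition dual_unit :: "('o, 'u::universe) sfc \<Rightarrow> 'o \<Rightarrow> 'u" where
  "dual_unit P C = (THE p. p \<in> Hom (sfc_cat P) C (lift_ob P (pt_space P C)) \<and>
     lift_arr P (pt_space P C) \<cdot>\<^bsub>Set_cat\<^esub> Farr (und P) C (lift_ob P (pt_space P C)) p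
     = vgraph (carrier (Fobj (sfc_O P) C)) (\<lambda>a.
         vgraph (Hom (sfc_cat P) C (sfc_two P)) (\<lambda>f.
           app (sfc_iota P) (app (Farr (sfc_O P) C (sfc_two P) f) a))))"

text \<open>The counit is the continuous map \<open>X \<rightarrow> pt\<^sub>C (\<Omega>\<^sub>C X)\<close> sending \<open>x\<close> to the lift of \<open>\<iota>\<^sup>-\<^sup>1 \<chi>\<^sub>x \<theta>\<close>.\<close>

definition dual_counit :: "('o, 'u::universe) sfc \<Rightarrow> 'u topology \<Rightarrow> 'u" where
  "dual_counit P X = vgraph (topspace X) (\<lambda>x.
     THE f. f \<in> Hom (sfc_cat P) (lift_ob P X) (sfc_two P) \<and>
       Farr (und P) (lift_ob P X) (sfc_two P) f = point_arr P X x \<cdot>\<^bsub>Set_cat\<^esub> lift_arr P X)"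

definition Dual :: "('o, 'u::universe) sfc \<Rightarrow> ('o, 'u, 'u topology, 'u) adj" where
  "Dual P = \<lparr>Lcat = sfc_cat P, Rcat = op_cat (Top_of P), Ladj = pt_func P, Radj = Omega_func P,
     Aunit = dual_unit P, Acounit = dual_counit P\<rparr>"

definition Dual_mor ::
  "('o, 'u::universe) sfc \<Rightarrow> ('p, 'u) sfc \<Rightarrow> ('o, 'p, 'u) sfc_mor \<Rightarrow>
   ('o, 'u, 'u topology, 'u, 'p, 'u, 'u topology, 'u) adj_mor" where
  "Dual_mor P Q m = \<lparr>Lfun = mor_H m, Rfun = incl,
     Mzeta = (\<lambda>X. THE p.
        p \<in> Hom (sfc_cat Q) (Fobj (mor_H m) (lift_ob P X)) (lift_ob Q X) \<and>
        Farr (und Q) (Fobj (mor_H m) (lift_ob P X)) (lift_ob Q X) p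
        = inv_arr Set_cat (Fobj (und Q) (lift_ob Q X)) (Hom Top_cat X Sierpinski) (lift_arr Q X)
          \<cdot>\<^bsub>Set_cat\<^esub> lift_arr P X \<cdot>\<^bsub>Set_cat\<^esub> mor_alpha m (lift_ob P X)),
     Mxi = (\<lambda>C. vgraph (Hom (sfc_cat P) C (sfc_two P))
        (\<lambda>f. mor_i m \<cdot>\<^bsub>sfc_cat Q\<^esub> Farr (mor_H m) C (sfc_two P) f))\<rparr>"

text \<open>
  Two-point indiscrete spaces are not \<open>T\<^sub>D\<close>, but they belong to \<open>Top_of P\<close> when \<open>P\<close> is
  \<open>Raney\<^sub>T\<close> or \<open>Frm\<^sub>E\<close>, because cartesian lifts only see the frame of opens. The category of
  \<open>T\<^sub>D\<close>-spaces is therefore obtained by retaining the \<open>T\<^sub>0\<close>-spaces of \<open>Top_of P\<close>.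
\<close>

definition T0_part :: "('o, 'm, 'a topology, 'n) adj \<Rightarrow> ('o, 'm, 'a topology, 'n) adj" where
  "T0_part A = A\<lparr>Rcat := full_subcat (Rcat A) {X. t0_space X}\<rparr>"


section \<open>Raney extensions\<close>

definition filters :: "'a gorder \<Rightarrow> 'a set set" where
  "filters L = {F. F \<subseteq> carrier L \<and> \<top>\<^bsub>L\<^esub> \<in> F \<and>
     (\<forall>a\<in>F. \<forall>b\<in>F. a \<sqinter>\<^bsub>L\<^esub> b \<in> F) \<and> (\<forall>a\<in>F. \<forall>b\<in>carrier L. a \<sqsubseteq>\<^bsub>L\<^esub> b \<longrightarrow> b \<in> F)}"

definition Filt :: "'a gorder \<Rightarrow> 'a set gorder" where
  "Filt L = \<lparr>carrier = filters L, eq = (=), le = (\<lambda>F G. G \<subseteq> F)\<rparr>"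

definition codiff :: "'a gorder \<Rightarrow> 'a \<Rightarrow> 'a \<Rightarrow> 'a" where
  "codiff K x k = (THE c. least K c {c \<in> carrier K. x \<sqsubseteq>\<^bsub>K\<^esub> k \<squnion>\<^bsub>K\<^esub> c})"

definition subcolocale :: "'a gorder \<Rightarrow> 'a set \<Rightarrow> bool" where
  "subcolocale K A \<longleftrightarrow> A \<subseteq> carrier K \<and> (\<forall>B\<subseteq>A. \<Squnion>\<^bsub>K\<^esub> B \<in> A) \<and>
     (\<forall>x\<in>A. \<forall>k\<in>carrier K. codiff K x k \<in> A)"

definition exact :: "'a gorder \<Rightarrow> 'a set \<Rightarrow> bool" where
  "exact L S \<longleftrightarrow> S \<subseteq> carrier L \<and>
     (\<forall>y\<in>carrier L. \<Sqinter>\<^bsub>L\<^esub> ((\<lambda>s. s \<squnion>\<^bsub>L\<^esub> y) ` S) = \<Sqinter>\<^bsub>L\<^esub> S \<squnion>\<^bsub>L\<^esub> y)"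

definition heyting_imp :: "'a gorder \<Rightarrow> 'a \<Rightarrow> 'a \<Rightarrow> 'a" where
  "heyting_imp L a b = \<Squnion>\<^bsub>L\<^esub> {c \<in> carrier L. c \<sqinter>\<^bsub>L\<^esub> a \<sqsubseteq>\<^bsub>L\<^esub> b}"

definition strongly_exact :: "'a gorder \<Rightarrow> 'a set \<Rightarrow> bool" where
  "strongly_exact L S \<longleftrightarrow> S \<subseteq> carrier L \<and>
     (\<forall>y\<in>carrier L. (\<forall>s\<in>S. heyting_imp L s y = y) \<longrightarrow> heyting_imp L (\<Sqinter>\<^bsub>L\<^esub> S) y = y)"

definition FiltE :: "'a gorder \<Rightarrow> 'a set set" where
  "FiltE L = {F \<in> filters L. \<forall>S\<subseteq>F. exact L S \<longrightarrow> \<Sqinter>\<^bsub>L\<^esub> S \<in> F}"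

definition FiltSE :: "'a gorder \<Rightarrow> 'a set set" where
  "FiltSE L = {F \<in> filters L. \<forall>S\<subseteq>F. strongly_exact L S \<longrightarrow> \<Sqinter>\<^bsub>L\<^esub> S \<in> F}"

type_synonym 'u raney = "'u gorder \<times> 'u set set"

definition Raney_cat :: "('u::universe raney, 'u) cat" where
  "Raney_cat = \<lparr>Obj = {(L, \<F>). L \<in> Obj Frm_cat \<and> subcolocale (Filt L) \<F> \<and>
                              FiltE L \<subseteq> \<F> \<and> \<F> \<subseteq> FiltSE L},
     Hom = (\<lambda>(L, \<F>) (M, \<G>). {f \<in> Hom Frm_cat L M.
                              \<forall>G\<in>\<G>. {a \<in> carrier L. app f a \<in> G} \<in> \<F>}),
     Idt = (\<lambda>(L, \<F>). Idt Frm_cat L), Comp = vcomp\<rparr>"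

definition O_R :: "('u::universe raney, 'u, 'u gorder, 'u) func" where
  "O_R = \<lparr>Fobj = fst, Farr = (\<lambda>A B f. f)\<rparr>"

definition two_R :: "'u::universe raney" where
  "two_R = (two, filters two)"

definition fiber_initial ::
  "('o, 'u::universe) cat \<Rightarrow> ('o, 'u, 'u gorder, 'u) func \<Rightarrow> 'o \<Rightarrow> bool" where
  "fiber_initial A U C \<longleftrightarrow> C \<in> Obj A \<and>
     (\<forall>D\<in>Obj A. \<forall>t. is_iso Frm_cat (Fobj U D) (Fobj U C) t \<longrightarrow>
        (\<exists>p\<in>Hom A C D. t \<cdot>\<^bsub>Frm_cat\<^esub> Farr U C D p = Idt Frm_cat (Fobj U C)))"

definition fiber_terminal ::
  "('o, 'u::universe) cat \<Rightarrow> ('o, 'u, 'u gorder, 'u) func \<Rightarrow> 'o \<Rightarrow> bool" where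
  "fiber_terminal A U C \<longleftrightarrow> C \<in> Obj A \<and>
     (\<forall>D\<in>Obj A. \<forall>t. is_iso Frm_cat (Fobj U D) (Fobj U C) t \<longrightarrow>
        (\<exists>p\<in>Hom A D C. Farr U D C p = t))"

definition RaneyI_cat :: "('u::universe raney, 'u) cat" where
  "RaneyI_cat = full_subcat Raney_cat {C. fiber_initial Raney_cat O_R C}"

definition RaneyT_cat :: "('u::universe raney, 'u) cat" where
  "RaneyT_cat = full_subcat Raney_cat {C. fiber_terminal Raney_cat O_R C}"

definition FrmE_cat :: "('u::universe gorder, 'u) cat" where
  "FrmE_cat = Frm_cat\<lparr>Hom := (\<lambda>L M. {f \<in> Hom Frm_cat L M.
     \<forall>F\<in>FiltE M. {a \<in> carrier L. app f a \<in> F} \<in> FiltE L})\<rparr>"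

definition FiltSE_func :: "('u::universe gorder, 'u, 'u raney, 'u) func" where
  "FiltSE_func = \<lparr>Fobj = (\<lambda>L. (L, FiltSE L)), Farr = (\<lambda>L M f. f)\<rparr>"

definition saturated_filters :: "'u::universe topology \<Rightarrow> 'u set set" where
  "saturated_filters X = {{u \<in> carrier (opens X). A \<subseteq> elts u} | A.
     \<exists>\<V>. (\<forall>V\<in>\<V>. openin X V) \<and> A = topspace X \<inter> \<Inter>\<V>}"

definition U_func :: "('u::universe topology, 'u, 'u raney, 'u) func" where
  "U_func = \<lparr>Fobj = (\<lambda>X. (opens X, saturated_filters X)), Farr = preimage_arr\<rparr>"

text \<open>The functors \<open>pt\<^sub>R\<close>, \<open>pt\<^sub>E\<close> and \<open>pt\<close> into \<open>Top\<^sup>o\<^sup>p\<close>.\<close>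

definition hom_space :: "'u::universe set \<Rightarrow> 'u set \<Rightarrow> 'u topology" where
  "hom_space H A = topology (\<lambda>W. \<exists>a\<in>A. W = {f \<in> H. app f a = v1})"

definition pt_R :: "('u::universe raney, 'u, 'u topology, 'u) func" where
  "pt_R = \<lparr>Fobj = (\<lambda>C. hom_space (Hom Raney_cat C two_R) (carrier (fst C))),
     Farr = (\<lambda>C D f. vgraph (Hom Raney_cat D two_R) (\<lambda>g. vcomp g f))\<rparr>"

definition pt_E :: "('u::universe gorder, 'u, 'u topology, 'u) func" where
  "pt_E = \<lparr>Fobj = (\<lambda>L. hom_space (Hom FrmE_cat L two) (carrier L)),
     Farr = (\<lambda>L M f. vgraph (Hom FrmE_cat M two) (\<lambda>g. vcomp g f))\<rparr>"

definition pt :: "('u::universe gorder, 'u, 'u topology, 'u) func" where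
  "pt = \<lparr>Fobj = (\<lambda>L. hom_space (Hom Frm_cat L two) (carrier L)),
     Farr = (\<lambda>L M f. vgraph (Hom Frm_cat M two) (\<lambda>g. vcomp g f))\<rparr>"


section \<open>The five SFC-categories\<close>

text \<open>
  In all of them the chosen lift of \<open>X\<close> has \<open>\<Omega> X\<close> as its underlying frame, and \<open>\<theta>\<close> sends an open
  set to its characteristic map.
\<close>

definition char_arr :: "'u::universe topology \<Rightarrow> 'u" where
  "char_arr X = vgraph (carrier (opens X))
     (\<lambda>u. vgraph (topspace X) (\<lambda>x. if x \<in> elts u then v1 else v0))"

definition sfc_Raney :: "('u::universe raney, 'u) sfc" where
  "sfc_Raney = \<lparr>sfc_cat = Raney_cat, sfc_O = O_R, sfc_two = two_R, sfc_iota = Idt Frm_cat two,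
     lift_ob = Fobj U_func, lift_arr = char_arr\<rparr>"

definition sfc_RaneyI :: "('u::universe raney, 'u) sfc" where
  "sfc_RaneyI = \<lparr>sfc_cat = RaneyI_cat, sfc_O = O_R, sfc_two = two_R, sfc_iota = Idt Frm_cat two,
     lift_ob = Fobj (FiltSE_func \<circ>\<^sub>F O_R \<circ>\<^sub>F U_func), lift_arr = char_arr\<rparr>"

definition sfc_RaneyT :: "('u::universe raney, 'u) sfc" where
  "sfc_RaneyT = \<lparr>sfc_cat = RaneyT_cat, sfc_O = O_R, sfc_two = two_R, sfc_iota = Idt Frm_cat two,
     lift_ob = Fobj U_func, lift_arr = char_arr\<rparr>"

definition sfc_FrmE :: "('u::universe gorder, 'u) sfc" where
  "sfc_FrmE = \<lparr>sfc_cat = FrmE_cat, sfc_O = incl, sfc_two = two, sfc_iota = Idt Frm_cat two,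
     lift_ob = Fobj Omega, lift_arr = char_arr\<rparr>"

definition sfc_Frm :: "('u::universe gorder, 'u) sfc" where
  "sfc_Frm = \<lparr>sfc_cat = Frm_cat, sfc_O = incl, sfc_two = two, sfc_iota = Idt Frm_cat two,
     lift_ob = Fobj Omega, lift_arr = char_arr\<rparr>"

definition mor_Filt :: "('u::universe raney, 'u raney, 'u) sfc_mor" where
  "mor_Filt = strict_mor sfc_Raney sfc_RaneyI (FiltSE_func \<circ>\<^sub>F O_R)"

definition mor_IT :: "('u::universe raney, 'u raney, 'u) sfc_mor" where
  "mor_IT = strict_mor sfc_RaneyT sfc_Raney incl"

definition mor_OIT :: "('u::universe raney, 'u gorder, 'u) sfc_mor" where
  "mor_OIT = strict_mor sfc_RaneyT sfc_FrmE (O_R \<circ>\<^sub>F incl)"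

definition mor_E :: "('u::universe gorder, 'u gorder, 'u) sfc_mor" where
  "mor_E = strict_mor sfc_FrmE sfc_Frm incl"

end

theory Submission
  imports Defs
begin

text \<open>
  Everything rests on one observation. A cartesian lift of the points of a space \<open>X\<close> can be taken to
  have the frame \<open>\<Omega> X\<close> of open sets as its underlying frame, because a function into \<open>\<Omega> X\<close> is a
  frame map iff its composites with all points \<open>\<Omega> X \<rightarrow> 2\<close> are (\<open>Frm_opens_iff\<close>), and any other lift
  is isomorphic to this one as a frame (\<open>sfc_lift_frame\<close>). So for each of the five categories it
  remains to know for which \<open>X\<close> the frame \<open>\<Omega> X\<close>, with suitable extra structure, has the property that
  a frame map into it is an arrow iff its composites with the points of \<open>X\<close> are. From this property
  the dual adjunction follows formally: the unit sends \<open>a\<close> to the open set of points that contain \<open>a\<close>,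
  the counit sends a point of \<open>X\<close> to the corresponding point of \<open>\<Omega> X\<close>, and \<open>\<Omega>\<close> acts on arrows by inverse
  images (\<open>concrete_sfc.is_adjunction\<close>). Likewise a functor over frames that preserves these lifts
  induces a right adjunction morphism, in which \<open>\<zeta>\<close> is an identity and \<open>\<xi>\<close> is the inclusion of the
  points of \<open>C\<close> into the points of \<open>H C\<close>; it is strong as soon as the two sets of points agree
  (\<open>concrete_sfc_mor.strong_adj_morphism\<close>).

  For Raney extensions the property holds for \<open>(\<Omega> X, \<U>\<^sup>* X)\<close> and all \<open>X\<close>. Indeed \<open>\<U>\<^sup>* X\<close> consists of the
  filters of open neighbourhoods of arbitrary subsets of \<open>X\<close>, hence of the intersections of
  neighbourhood filters of points. It is a subcolocale between the exact and the strongly exact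
  filters: neighbourhood filters are strongly exact (\<open>up_filter_FiltSE\<close>), and a filter is exact iff it is
  an intersection of filters \<open>{c. b \<sqsubseteq> a \<squnion> c}\<close> (\<open>FiltE_iff\<close>), which in \<open>\<Omega> X\<close> are the neighbourhood
  filters of the sets \<open>b - a\<close>.

  The exact and the strongly exact filters of a frame \<open>L\<close> form subcolocales themselves, and frame maps pull
  strongly exact filters back to strongly exact ones (\<open>vimage_FiltSE\<close>). So the fiber-initial objects
  are the pairs \<open>(L, Filt\<^sub>S\<^sub>E L)\<close>, with all frame maps as arrows, and the fiber-terminal objects are the
  pairs \<open>(L, Filt\<^sub>E L)\<close>, with the exact frame maps as arrows; the latter category is therefore
  isomorphic to that of frames and exact maps.

  For fiber-terminal extensions and for exact maps the spaces \<open>X\<close> are those whose points have exact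
  neighbourhood filters. The description of exact filters shows that, among \<open>T\<^sub>0\<close>-spaces, these are
  exactly the \<open>T\<^sub>D\<close>-spaces (\<open>TD_point_exact\<close>, \<open>T0_exact_TD\<close>), and that the space of exact points
  of a frame is \<open>T\<^sub>D\<close> (\<open>TD_pt_space\<close>).
\<close>

section \<open>Sets and functions coded in a universe\<close>

lemma elts_vset [simp]: "small A \<Longrightarrow> elts (vset A) = A"
  unfolding small_def vset_def
  by (metis (mono_tags, lifting) elts_inject theI)

lemma vset_elts [simp]: "vset (elts x) = x"
  by (metis elts_inject elts_vset small_def)

lemma small_elts [simp]: "small (elts x)"
  by (auto simp: small_def)

lemma small_subset: "small B \<Longrightarrow> A \<subseteq> B \<Longrightarrow> small A"
  unfolding small_def using elts_subset by metis

lemma small_empty [simp]: "small {}"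
  by (rule small_subset[OF small_elts empty_subsetI])

lemma small_image: "small A \<Longrightarrow> small (f ` A)" for A :: "'u::universe set" and f :: "'u \<Rightarrow> 'u"
  using elts_replacement[of f "vset A"] by (simp add: small_def[of "f ` A"])

lemma vset_inject: "small A \<Longrightarrow> small B \<Longrightarrow> vset A = vset B \<longleftrightarrow> A = B"
  by (metis elts_vset)

lemma Pow_image: "small A \<Longrightarrow> vset ` Pow A = {z. elts z \<subseteq> A}"
proof (rule subset_antisym)
  assume A: "small A"
  show "vset ` Pow A \<subseteq> {z. elts z \<subseteq> A}"
    using small_subset[OF A] by auto
  show "{z. elts z \<subseteq> A} \<subseteq> vset ` Pow A"
    by (metis (mono_tags, lifting) PowI imageI mem_Collect_eq subsetI vset_elts)
qed

lemma small_Pow: "small A \<Longrightarrow> small (vset ` Pow A)"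
  using elts_Pow[of "vset A"] by (simp add: Pow_image small_def[of "{z. elts z \<subseteq> A}"])

lemma small_UN:
  fixes A :: "'u::universe set" and F :: "'u \<Rightarrow> 'u set"
  shows "small A \<Longrightarrow> (\<And>x. x \<in> A \<Longrightarrow> small (F x)) \<Longrightarrow> small (\<Union>x\<in>A. F x)"
proof -
  assume A: "small A" and F: "\<And>x. x \<in> A \<Longrightarrow> small (F x)"
  obtain a where a: "elts a = (\<lambda>x. vset (F x)) ` A"
    using small_image[OF A, of "\<lambda>x. vset (F x)"] unfolding small_def by blast
  have "(\<Union>z\<in>elts a. elts z) = (\<Union>x\<in>A. F x)"
    using F by (simp add: a)
  then show ?thesis
    using elts_Union[of a] by (simp add: small_def)
qed

lemma elts_v0 [simp]: "elts v0 = {}"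
  by (simp add: v0_def)

lemma elts_eq_empty: "elts z = {} \<longleftrightarrow> z = v0"
  using elts_inject[of z v0] by auto

lemma small_v0: "small {v0}"
proof -
  have "{z. elts z \<subseteq> {}} = {v0 :: 'a}"
    by (simp add: elts_eq_empty)
  then show ?thesis
    using elts_Pow[of "v0 :: 'a"] unfolding small_def elts_v0 by simp
qed

lemma elts_v1 [simp]: "elts v1 = {v0}"
  by (simp add: v1_def small_v0)

lemma v0_neq_v1 [simp]: "v0 \<noteq> v1" "v1 \<noteq> v0"
  by (metis elts_v0 elts_v1 insert_not_empty)+

lemma small_v01 [simp]: "small {v0, v1}"
proof -
  have "{z. elts z \<subseteq> {v0}} = {v0, v1 :: 'a}"
  proof (rule subset_antisym)
    show "{z. elts z \<subseteq> {v0}} \<subseteq> {v0, v1 :: 'a}"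
    proof
      fix z :: 'a
      assume "z \<in> {z. elts z \<subseteq> {v0}}"
      then have "elts z = elts v0 \<or> elts z = elts v1"
        by (simp add: subset_singleton_iff)
      then show "z \<in> {v0, v1}"
        using elts_inject[of z v0] elts_inject[of z v1] by blast
    qed
  qed simp
  then show ?thesis
    using elts_Pow[of "v1 :: 'a"] unfolding small_def elts_v1 by simp
qed

lemma small_pair [simp]: "small {x, y}"
  using small_image[OF small_v01, of "\<lambda>z. if z = v0 then x else y"] by (simp add: insert_commute)

lemma small_single [simp]: "small {x}"
  using small_pair[of x x] by simp

lemma vpair_inject [simp]: "vpair x y = vpair x' y' \<longleftrightarrow> x = x' \<and> y = y'"
  by (auto simp: vpair_def vset_inject doubleton_eq_iff)

lemma elts_vgraph: "small A \<Longrightarrow> elts (vgraph A f) = (\<lambda>x. vpair x (f x)) ` A"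
  by (simp add: vgraph_def small_image)

lemma app_vgraph [simp]: "small A \<Longrightarrow> x \<in> A \<Longrightarrow> app (vgraph A f) x = f x"
  by (auto simp: app_def elts_vgraph)

lemma vgraph_cong: "(\<And>x. x \<in> A \<Longrightarrow> f x = g x) \<Longrightarrow> vgraph A f = vgraph A g"
  by (simp add: vgraph_def cong: image_cong)

lemma vgraph_in_vfuns: "f \<in> A \<rightarrow> B \<Longrightarrow> vgraph A f \<in> vfuns A B"
  by (auto simp: vfuns_def)

lemma vfuns_vgraph: "small A \<Longrightarrow> f \<in> vfuns A B \<Longrightarrow> vgraph A (app f) = f"
  unfolding vfuns_def using vgraph_cong[of A "app f"] by (clarsimp cong: vgraph_cong)

lemma vfuns_app: "small A \<Longrightarrow> f \<in> vfuns A B \<Longrightarrow> x \<in> A \<Longrightarrow> app f x \<in> B"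
  unfolding vfuns_def by auto

lemma vfuns_eqI:
  assumes "small A" "f \<in> vfuns A B" "g \<in> vfuns A C" "\<And>x. x \<in> A \<Longrightarrow> app f x = app g x"
  shows "f = g"
proof -
  have "vgraph A (app f) = vgraph A (app g)"
    by (rule vgraph_cong) (rule assms(4))
  then show ?thesis
    unfolding vfuns_vgraph[OF assms(1,2)] vfuns_vgraph[OF assms(1,3)] .
qed

lemma vcomp_eq:
  assumes "small A" "small B" "f \<in> vfuns A B" "g \<in> vfuns B C"
  shows "vcomp g f = vgraph A (\<lambda>x. app g (app f x))"
proof -
  have f: "elts f = (\<lambda>x. vpair x (app f x)) ` A"
    using elts_vgraph[OF assms(1), of "app f"] unfolding vfuns_vgraph[OF assms(1,3)] .
  have g: "elts g = (\<lambda>x. vpair x (app g x)) ` B"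
    using elts_vgraph[OF assms(2), of "app g"] unfolding vfuns_vgraph[OF assms(2,4)] .
  have "{vpair x z | x y z. vpair x y \<in> elts f \<and> vpair y z \<in> elts g}
      = (\<lambda>x. vpair x (app g (app f x))) ` A"
    unfolding f g using vfuns_app[OF assms(1,3)] by force
  then show ?thesis
    by (simp only: vcomp_def vgraph_def)
qed

lemma app_vcomp:
  assumes "small A" "small B" "f \<in> vfuns A B" "g \<in> vfuns B C" "x \<in> A"
  shows "app (vcomp g f) x = app g (app f x)"
  by (simp add: vcomp_eq[OF assms(1-4)] assms)

lemma vcomp_in_vfuns:
  assumes "small A" "small B" "f \<in> vfuns A B" "g \<in> vfuns B C"
  shows "vcomp g f \<in> vfuns A C"
  unfolding vcomp_eq[OF assms]
  by (rule vgraph_in_vfuns) (use assms vfuns_app in blast)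

lemma vcomp_assoc:
  assumes "small A" "small B" "small C" "f \<in> vfuns A B" "g \<in> vfuns B C" "h \<in> vfuns C D"
  shows "vcomp h (vcomp g f) = vcomp (vcomp h g) f"
proof (rule vfuns_eqI[OF assms(1)])
  note gf = vcomp_in_vfuns[OF assms(1,2,4,5)] and hg = vcomp_in_vfuns[OF assms(2,3,5,6)]
  show "vcomp h (vcomp g f) \<in> vfuns A D"
    by (rule vcomp_in_vfuns[OF assms(1,3) gf assms(6)])
  show "vcomp (vcomp h g) f \<in> vfuns A D"
    by (rule vcomp_in_vfuns[OF assms(1,2,4) hg])
  show "app (vcomp h (vcomp g f)) x = app (vcomp (vcomp h g) f) x" if "x \<in> A" for x
    using that vfuns_app[OF assms(1,4) that]
    by (simp add: app_vcomp[OF assms(1,3) gf assms(6)] app_vcomp[OF assms(1,2,4) hg]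
        app_vcomp[OF assms(1,2,4,5)] app_vcomp[OF assms(2,3,5,6)])
qed

lemma vid_in_vfuns: "A \<subseteq> B \<Longrightarrow> vid A \<in> vfuns A B"
  by (auto simp: vid_def intro: vgraph_in_vfuns)

lemma app_vid [simp]: "small A \<Longrightarrow> x \<in> A \<Longrightarrow> app (vid A) x = x"
  by (simp add: vid_def)

lemma vcomp_vid_right:
  assumes "small A" "f \<in> vfuns A B"
  shows "vcomp f (vid A) = f"
  unfolding vcomp_eq[OF assms(1,1) vid_in_vfuns[OF subset_refl] assms(2)]
  by (subst (2) vfuns_vgraph[OF assms, symmetric]) (simp add: assms(1) cong: vgraph_cong)

lemma vcomp_vid_left:
  assumes "small A" "small B" "f \<in> vfuns A B"
  shows "vcomp (vid B) f = f"
  unfolding vcomp_eq[OF assms vid_in_vfuns[OF subset_refl]]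
  by (subst (2) vfuns_vgraph[OF assms(1,3), symmetric])
    (simp add: assms(2) vfuns_app[OF assms(1,3)] cong: vgraph_cong)

lemma small_vfuns:
  assumes "small A" "small B"
  shows "small (vfuns A B)"
proof -
  have "small (\<Union>x\<in>A. vpair x ` B)"
    using assms by (simp add: small_UN small_image)
  then have "small {z. elts z \<subseteq> (\<Union>x\<in>A. vpair x ` B)}"
    using small_Pow Pow_image by metis
  then show ?thesis
    by (rule small_subset) (use assms in \<open>auto simp: vfuns_def elts_vgraph Pi_iff; blast\<close>)
qed

section \<open>Order theory of frames\<close>

lemma Upper_eq: "A \<subseteq> carrier L \<Longrightarrow> Upper L A = {u \<in> carrier L. \<forall>a\<in>A. a \<sqsubseteq>\<^bsub>L\<^esub> u}"
  unfolding Upper_def by blast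

lemma Lower_eq: "A \<subseteq> carrier L \<Longrightarrow> Lower L A = {u \<in> carrier L. \<forall>a\<in>A. u \<sqsubseteq>\<^bsub>L\<^esub> a}"
  unfolding Lower_def by blast

lemma lub_eqI:
  fixes L (structure)
  assumes "partial_order L" "A \<subseteq> carrier L" "s \<in> carrier L" "\<And>a. a \<in> A \<Longrightarrow> a \<sqsubseteq> s"
    "\<And>u. u \<in> carrier L \<Longrightarrow> (\<And>a. a \<in> A \<Longrightarrow> a \<sqsubseteq> u) \<Longrightarrow> s \<sqsubseteq> u"
  shows "\<Squnion>A = s"
proof -
  interpret partial_order L by fact
  have "least L s (Upper L A)"
    using assms(2-) by (simp add: least_def Upper_eq)
  then show ?thesis
    unfolding sup_def by (blast intro: some_equality least_unique)
qed

lemma glb_eqI: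
  fixes L (structure)
  assumes "partial_order L" "A \<subseteq> carrier L" "s \<in> carrier L" "\<And>a. a \<in> A \<Longrightarrow> s \<sqsubseteq> a"
    "\<And>u. u \<in> carrier L \<Longrightarrow> (\<And>a. a \<in> A \<Longrightarrow> u \<sqsubseteq> a) \<Longrightarrow> u \<sqsubseteq> s"
  shows "\<Sqinter>A = s"
proof -
  interpret partial_order L by fact
  have "greatest L s (Lower L A)"
    using assms(2-) by (simp add: greatest_def Lower_eq)
  then show ?thesis
    unfolding inf_def by (blast intro: some_equality greatest_unique)
qed

lemma top_eqI:
  fixes L (structure)
  assumes "partial_order L" "t \<in> carrier L" "\<And>a. a \<in> carrier L \<Longrightarrow> a \<sqsubseteq> t"
  shows "\<top> = t"
proof -
  interpret partial_order L by fact
  have "greatest L t (carrier L)"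
    using assms(2-) by (auto simp: greatest_def)
  then show ?thesis
    unfolding top_def by (blast intro: some_equality greatest_unique)
qed

text \<open>A partial order in which every subset has a supremum also has all infima.\<close>

lemma complete_lattice_if_sups:
  fixes L (structure)
  assumes "partial_order L"
    and "\<And>A. A \<subseteq> carrier L \<Longrightarrow> \<exists>s\<in>carrier L. (\<forall>a\<in>A. a \<sqsubseteq> s) \<and>
           (\<forall>u\<in>carrier L. (\<forall>a\<in>A. a \<sqsubseteq> u) \<longrightarrow> s \<sqsubseteq> u)"
  shows "complete_lattice L"
proof -
  interpret partial_order L by fact
  show ?thesis
  proof
    fix A assume A: "A \<subseteq> carrier L"
    obtain s where s: "s \<in> carrier L" "\<forall>a\<in>A. a \<sqsubseteq> s"
      "\<forall>u\<in>carrier L. (\<forall>a\<in>A. a \<sqsubseteq> u) \<longrightarrow> s \<sqsubseteq> u"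
      using assms(2)[OF A] by blast
    have "least L s (Upper L A)"
      using A s by (simp add: least_def Upper_eq)
    then show "\<exists>s. least L s (Upper L A)" ..
    have "Lower L A \<subseteq> carrier L"
      by simp
    then obtain i where i: "i \<in> carrier L" "\<forall>a\<in>Lower L A. a \<sqsubseteq> i"
      "\<forall>u\<in>carrier L. (\<forall>a\<in>Lower L A. a \<sqsubseteq> u) \<longrightarrow> i \<sqsubseteq> u"
      using assms(2) by blast
    moreover have "i \<sqsubseteq> a" if "a \<in> A" for a
      using i(3) A that by (auto simp: Lower_eq)
    ultimately have "greatest L i (Lower L A)"
      using A i(2) by (simp add: greatest_def Lower_eq)
    then show "\<exists>i. greatest L i (Lower L A)" ..
  qed
qed

text \<open>
  The order of a frame relates elements of the carrier only, so that transitivity and antisymmetry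
  need no carrier premises.
\<close>

locale frm =
  fixes L (structure)
  assumes frame: "frame L"
begin

sublocale complete_lattice L
  using frame by (simp add: frame_def)

lemma po: "partial_order L" ..

lemma le_carrier: "x \<sqsubseteq> y \<Longrightarrow> x \<in> carrier L \<and> y \<in> carrier L"
  using frame by (simp add: frame_def)

lemma trans': "x \<sqsubseteq> y \<Longrightarrow> y \<sqsubseteq> z \<Longrightarrow> x \<sqsubseteq> z"
  using le_carrier[of x y] le_carrier[of y z] le_trans[of x y z] by simp

lemma antisym': "x \<sqsubseteq> y \<Longrightarrow> y \<sqsubseteq> x \<Longrightarrow> x = y"
  using le_carrier[of x y] le_antisym[of x y] by simp

lemma le_meet_iff: "a \<in> carrier L \<Longrightarrow> b \<in> carrier L \<Longrightarrow> c \<sqsubseteq> a \<sqinter> b \<longleftrightarrow> c \<sqsubseteq> a \<and> c \<sqsubseteq> b"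
  by (meson le_carrier meet_le meet_left meet_right trans')

lemma join_le_iff: "a \<in> carrier L \<Longrightarrow> b \<in> carrier L \<Longrightarrow> a \<squnion> b \<sqsubseteq> c \<longleftrightarrow> a \<sqsubseteq> c \<and> b \<sqsubseteq> c"
  by (meson le_carrier join_le join_left join_right trans')

lemma le_inf_iff: "A \<subseteq> carrier L \<Longrightarrow> c \<in> carrier L \<Longrightarrow> c \<sqsubseteq> \<Sqinter>A \<longleftrightarrow> (\<forall>a\<in>A. c \<sqsubseteq> a)"
  by (meson inf_greatest inf_lower trans')

lemma meet_mono: "a \<sqsubseteq> a' \<Longrightarrow> b \<sqsubseteq> b' \<Longrightarrow> a \<sqinter> b \<sqsubseteq> a' \<sqinter> b'"
  by (meson le_carrier le_meet_iff meet_left meet_right trans')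

lemma join_mono: "a \<sqsubseteq> a' \<Longrightarrow> b \<sqsubseteq> b' \<Longrightarrow> a \<squnion> b \<sqsubseteq> a' \<squnion> b'"
  by (meson le_carrier join_le_iff join_left join_right trans')

lemma join_bottom: "x \<in> carrier L \<Longrightarrow> x \<squnion> \<bottom> = x"
  by (intro antisym') (simp_all add: join_le_iff join_left)

lemma meet_join_distrib:
  assumes "a \<in> carrier L" "b \<in> carrier L" "c \<in> carrier L"
  shows "a \<sqinter> (b \<squnion> c) = (a \<sqinter> b) \<squnion> (a \<sqinter> c)"
proof -
  have "a \<sqinter> \<Squnion>{b, c} = \<Squnion>((\<lambda>b. a \<sqinter> b) ` {b, c})"
    using frame assms by (simp add: frame_def)
  then show ?thesis
    by (simp add: join_def)
qed

text \<open>Case distinction along a join.\<close>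

lemma le_by_join:
  assumes "c \<sqsubseteq> a \<squnion> b" "a \<in> carrier L" "b \<in> carrier L" "c \<sqinter> a \<sqsubseteq> d" "c \<sqinter> b \<sqsubseteq> d"
  shows "c \<sqsubseteq> d"
proof -
  have c: "c \<in> carrier L"
    using assms(1) le_carrier by blast
  have "c \<sqsubseteq> c \<sqinter> (a \<squnion> b)"
    using assms c by (simp add: le_meet_iff)
  moreover have "c \<sqinter> (a \<squnion> b) \<sqsubseteq> d"
    using assms c by (simp add: meet_join_distrib join_le_iff)
  ultimately show ?thesis
    by (rule trans')
qed

lemma join_meet_distrib_le:
  assumes "a \<in> carrier L" "b \<in> carrier L" "k \<in> carrier L"
  shows "(k \<squnion> a) \<sqinter> (k \<squnion> b) \<sqsubseteq> k \<squnion> (a \<sqinter> b)"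
proof (rule le_by_join)
  let ?l = "(k \<squnion> a) \<sqinter> (k \<squnion> b)" and ?r = "k \<squnion> (a \<sqinter> b)"
  note [simp] = assms
  have r: "k \<sqsubseteq> ?r" "a \<sqinter> b \<sqsubseteq> ?r"
    by (simp_all add: join_left join_right)
  show "?l \<sqsubseteq> k \<squnion> a"
    by (simp add: meet_left)
  show "?l \<sqinter> k \<sqsubseteq> ?r"
    by (rule trans'[OF meet_right r(1)]) simp_all
  show "?l \<sqinter> a \<sqsubseteq> ?r"
  proof (rule le_by_join)
    show "?l \<sqinter> a \<sqsubseteq> k \<squnion> b"
      by (rule trans'[OF meet_left meet_right]) simp_all
    show "?l \<sqinter> a \<sqinter> k \<sqsubseteq> ?r"
      by (rule trans'[OF meet_right r(1)]) simp_all
    show "?l \<sqinter> a \<sqinter> b \<sqsubseteq> ?r"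
      by (rule trans'[OF meet_mono r(2)]) (simp_all add: meet_right)
  qed simp_all
qed (simp_all add: assms)

lemma imp_closed [simp]: "heyting_imp L a b \<in> carrier L"
  by (auto simp: heyting_imp_def intro!: sup_closed)

lemma le_imp_iff:
  assumes "a \<in> carrier L" "b \<in> carrier L" "c \<in> carrier L"
  shows "c \<sqsubseteq> heyting_imp L a b \<longleftrightarrow> c \<sqinter> a \<sqsubseteq> b"
proof
  let ?S = "{c \<in> carrier L. c \<sqinter> a \<sqsubseteq> b}"
  have S: "?S \<subseteq> carrier L"
    by blast
  assume "c \<sqsubseteq> heyting_imp L a b"
  then have "c \<sqinter> a \<sqsubseteq> \<Squnion>?S \<sqinter> a"
    unfolding heyting_imp_def using assms(1) by (intro meet_mono) simp_all
  moreover have "\<Squnion>?S \<sqinter> a = \<Squnion>((\<lambda>c. a \<sqinter> c) ` ?S)"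
    using frame S assms(1) unfolding frame_def meet_comm[of L _ a] by blast
  moreover have "\<Squnion>((\<lambda>c. a \<sqinter> c) ` ?S) \<sqsubseteq> b"
    using assms by (intro sup_least) (auto simp: meet_comm[of L a])
  ultimately show "c \<sqinter> a \<sqsubseteq> b"
    using trans'[of "c \<sqinter> a"] by simp
next
  assume "c \<sqinter> a \<sqsubseteq> b"
  then show "c \<sqsubseteq> heyting_imp L a b"
    unfolding heyting_imp_def using assms by (intro sup_upper) auto
qed

text \<open>Strong exactness becomes a statement about order and meets alone.\<close>

lemma imp_eq_iff:
  assumes "s \<in> carrier L" "y \<in> carrier L"
  shows "heyting_imp L s y = y \<longleftrightarrow> (\<forall>c\<in>carrier L. c \<sqinter> s \<sqsubseteq> y \<longrightarrow> c \<sqsubseteq> y)"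
proof
  assume "heyting_imp L s y = y"
  then show "\<forall>c\<in>carrier L. c \<sqinter> s \<sqsubseteq> y \<longrightarrow> c \<sqsubseteq> y"
    using le_imp_iff[OF assms] by simp
next
  assume "\<forall>c\<in>carrier L. c \<sqinter> s \<sqsubseteq> y \<longrightarrow> c \<sqsubseteq> y"
  then have "heyting_imp L s y \<sqsubseteq> y"
    using le_imp_iff[OF assms, of "heyting_imp L s y"] by simp
  moreover have "y \<sqsubseteq> heyting_imp L s y"
    using le_imp_iff[OF assms assms(2)] assms by (simp add: meet_left)
  ultimately show "heyting_imp L s y = y"
    by (rule antisym')
qed

end


section \<open>Exact and strongly exact filters\<close>

context frm
begin

lemma strongly_exact_iff:
  "strongly_exact L S \<longleftrightarrow> S \<subseteq> carrier L \<and>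
     (\<forall>y\<in>carrier L. (\<forall>s\<in>S. \<forall>c\<in>carrier L. c \<sqinter> s \<sqsubseteq> y \<longrightarrow> c \<sqsubseteq> y) \<longrightarrow>
        (\<forall>c\<in>carrier L. c \<sqinter> \<Sqinter>S \<sqsubseteq> y \<longrightarrow> c \<sqsubseteq> y))"
proof (cases "S \<subseteq> carrier L")
  case True
  then have "(\<forall>s\<in>S. heyting_imp L s y = y) \<longleftrightarrow>
      (\<forall>s\<in>S. \<forall>c\<in>carrier L. c \<sqinter> s \<sqsubseteq> y \<longrightarrow> c \<sqsubseteq> y)" if "y \<in> carrier L" for y
    using that by (intro ball_cong refl imp_eq_iff) auto
  with True show ?thesis
    by (simp add: strongly_exact_def imp_eq_iff)
qed (simp add: strongly_exact_def)

text \<open>If \<open>y\<close> lies above the meet of \<open>S\<close>, strong exactness forces \<open>y\<close> to be the top element.\<close>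

lemma strongly_exactD:
  assumes "strongly_exact L S" "y \<in> carrier L" "\<Sqinter>S \<sqsubseteq> y"
    and "\<And>s c. s \<in> S \<Longrightarrow> c \<in> carrier L \<Longrightarrow> c \<sqinter> s \<sqsubseteq> y \<Longrightarrow> c \<sqsubseteq> y"
  shows "c \<in> carrier L \<Longrightarrow> c \<sqsubseteq> y"
proof -
  assume c: "c \<in> carrier L"
  have S: "S \<subseteq> carrier L"
    using assms(1) by (simp add: strongly_exact_def)
  have "c \<sqinter> \<Sqinter>S \<sqsubseteq> y"
    by (rule trans'[OF meet_right assms(3)]) (simp_all add: c S)
  then show ?thesis
    using assms c unfolding strongly_exact_iff by blast
qed

lemma strongly_exact_imp_exact:
  assumes SE: "strongly_exact L S"
  shows "exact L S"
proof -
  have S: "S \<subseteq> carrier L"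
    using SE by (simp add: strongly_exact_def)
  have "\<Sqinter>((\<lambda>s. s \<squnion> y) ` S) = \<Sqinter>S \<squnion> y" if y: "y \<in> carrier L" for y
  proof -
    let ?T = "(\<lambda>s. s \<squnion> y) ` S" and ?z = "\<Sqinter>S \<squnion> y"
    \<comment> \<open>Testing strong exactness of \<open>S\<close> on \<open>?w\<close> gives \<open>?w = \<top>\<close>, that is \<open>\<Sqinter>?T \<sqsubseteq> ?z\<close>.\<close>
    let ?w = "heyting_imp L (\<Sqinter>?T) ?z"
    have T: "?T \<subseteq> carrier L"
      using S y by auto
    note [simp] = S T y
    have "?z \<sqsubseteq> ?w"
      by (simp add: le_imp_iff meet_left)
    then have m: "\<Sqinter>S \<sqsubseteq> ?w"
      by (rule trans'[rotated]) (simp add: join_left)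
    have "c \<sqsubseteq> ?w" if s: "s \<in> S" and c: "c \<in> carrier L" and cs: "c \<sqinter> s \<sqsubseteq> ?w" for s c
    proof -
      have sL: "s \<in> carrier L"
        using s S by blast
      note [simp] = c sL
      have "c \<sqinter> \<Sqinter>?T \<sqsubseteq> ?z"
      proof (rule le_by_join)
        have "\<Sqinter>?T \<sqsubseteq> s \<squnion> y"
          using s by (intro inf_lower[OF T] imageI)
        then show "c \<sqinter> \<Sqinter>?T \<sqsubseteq> s \<squnion> y"
          by (rule trans'[rotated]) (simp add: meet_right)
        have "c \<sqinter> s \<sqinter> \<Sqinter>?T \<sqsubseteq> ?z"
          using cs by (simp add: le_imp_iff)
        then show "c \<sqinter> \<Sqinter>?T \<sqinter> s \<sqsubseteq> ?z"
          by (simp add: meet_assoc meet_comm[of L s])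
        show "c \<sqinter> \<Sqinter>?T \<sqinter> y \<sqsubseteq> ?z"
          by (rule trans'[OF meet_right join_right]) simp_all
      qed simp_all
      then show ?thesis
        by (simp add: le_imp_iff)
    qed
    then have "\<Sqinter>?T \<sqsubseteq> ?w"
      using strongly_exactD[OF SE _ m] by simp
    then have "\<Sqinter>?T \<sqinter> \<Sqinter>?T \<sqsubseteq> ?z"
      by (simp add: le_imp_iff)
    then have "\<Sqinter>?T \<sqsubseteq> ?z"
      using trans'[of "\<Sqinter>?T" "\<Sqinter>?T \<sqinter> \<Sqinter>?T"] by (simp add: le_meet_iff)
    moreover have "?z \<sqsubseteq> \<Sqinter>?T"
      using S by (auto simp: le_inf_iff intro!: join_mono inf_lower[OF S])
    ultimately show ?thesis
      by (rule antisym')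
  qed
  with S show ?thesis
    by (simp add: exact_def)
qed

lemma FiltED: "F \<in> FiltE L \<Longrightarrow> S \<subseteq> F \<Longrightarrow> exact L S \<Longrightarrow> \<Sqinter>S \<in> F"
  by (simp add: FiltE_def)

lemma FiltSED: "F \<in> FiltSE L \<Longrightarrow> S \<subseteq> F \<Longrightarrow> strongly_exact L S \<Longrightarrow> \<Sqinter>S \<in> F"
  by (simp add: FiltSE_def)

lemma FiltE_subset_FiltSE: "FiltE L \<subseteq> FiltSE L"
  using strongly_exact_imp_exact by (auto simp: FiltE_def FiltSE_def)

lemma filtersD:
  assumes "F \<in> filters L"
  shows "F \<subseteq> carrier L" "\<top> \<in> F" "a \<in> F \<Longrightarrow> b \<in> F \<Longrightarrow> a \<sqinter> b \<in> F" "a \<in> F \<Longrightarrow> a \<sqsubseteq> b \<Longrightarrow> b \<in> F"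
  using assms le_carrier[of a b] by (auto simp: filters_def)

text \<open>
  A filter is exact iff it is an intersection of filters \<open>{c. b \<le> a \<squnion> c}\<close>, the co-differences of
  principal filters. This first-order description is what makes exact filters tractable.
\<close>

lemma FiltE_iff:
  "F \<in> FiltE L \<longleftrightarrow> F \<in> filters L \<and>
     (\<forall>x\<in>carrier L. (\<forall>a\<in>carrier L. \<forall>b\<in>carrier L. (\<forall>c\<in>F. b \<sqsubseteq> a \<squnion> c) \<longrightarrow> b \<sqsubseteq> a \<squnion> x) \<longrightarrow> x \<in> F)"
  (is "_ \<longleftrightarrow> _ \<and> (\<forall>x\<in>carrier L. ?sep x \<longrightarrow> x \<in> F)")
proof (intro iffI conjI ballI impI)
  assume F: "F \<in> FiltE L"
  then show FF: "F \<in> filters L"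
    by (simp add: FiltE_def)
  fix x assume x: "x \<in> carrier L" and sep: "?sep x"
  note FL = filtersD(1)[OF FF]
  \<comment> \<open>The meet of \<open>{c \<squnion> x | c \<in> F}\<close> is exact with value \<open>x\<close>.\<close>
  let ?S = "(\<lambda>c. c \<squnion> x) ` F"
  have S: "?S \<subseteq> F"
    using FL x filtersD(4)[OF FF] join_left by blast
  then have SL: "?S \<subseteq> carrier L"
    using FL by blast
  have le: "\<Sqinter>((\<lambda>s. s \<squnion> y) ` ?S) \<sqsubseteq> x \<squnion> y" if y: "y \<in> carrier L" for y
  proof -
    let ?T = "(\<lambda>s. s \<squnion> y) ` ?S" and ?b = "\<Sqinter>((\<lambda>s. s \<squnion> y) ` ?S)"
    have T: "?T \<subseteq> carrier L"
      using SL y by auto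
    have "?b \<sqsubseteq> (x \<squnion> y) \<squnion> c" if "c \<in> F" for c
    proof -
      have "?b \<sqsubseteq> c \<squnion> x \<squnion> y"
        using that T by (intro inf_lower) auto
      moreover have "c \<in> carrier L"
        using that FL by blast
      then have "c \<squnion> x \<squnion> y = x \<squnion> y \<squnion> c"
        using join_assoc[of c x y] join_comm[of L c "x \<squnion> y"] x y by simp
      ultimately show ?thesis
        by simp
    qed
    then have "?b \<sqsubseteq> (x \<squnion> y) \<squnion> x"
      using sep[rule_format, of "x \<squnion> y" ?b] x y T by simp
    moreover have "(x \<squnion> y) \<squnion> x \<sqsubseteq> x \<squnion> y"
      using x y by (simp add: join_le_iff join_left)
    ultimately show ?thesis
      by (rule trans')
  qed
  have bot: "\<Sqinter>?S = x"
  proof (rule antisym')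
    have "(\<lambda>s. s \<squnion> \<bottom>) ` ?S = (\<lambda>s. s) ` ?S"
      by (rule image_cong) (use SL join_bottom in auto)
    then show "\<Sqinter>?S \<sqsubseteq> x"
      using le[of "\<bottom>"] x by (simp add: join_bottom)
    show "x \<sqsubseteq> \<Sqinter>?S"
      using SL x FL by (auto simp: le_inf_iff intro!: join_right)
  qed
  have "exact L ?S"
    unfolding exact_def bot
  proof (intro conjI SL ballI antisym')
    fix y assume y: "y \<in> carrier L"
    then show "\<Sqinter>((\<lambda>s. s \<squnion> y) ` ?S) \<sqsubseteq> x \<squnion> y"
      by (rule le)
    have "(\<lambda>s. s \<squnion> y) ` ?S \<subseteq> carrier L"
      using SL y by auto
    then show "x \<squnion> y \<sqsubseteq> \<Sqinter>((\<lambda>s. s \<squnion> y) ` ?S)"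
      using x y FL by (auto simp: le_inf_iff intro!: join_mono join_right)
  qed
  then show "x \<in> F"
    using FiltED[OF F S] bot by simp
next
  assume "F \<in> filters L \<and> (\<forall>x\<in>carrier L. ?sep x \<longrightarrow> x \<in> F)"
  then have FF: "F \<in> filters L" and sepF: "\<And>x. x \<in> carrier L \<Longrightarrow> ?sep x \<Longrightarrow> x \<in> F"
    by blast+
  have "\<Sqinter>S \<in> F" if S: "S \<subseteq> F" "exact L S" for S
  proof (rule sepF, use S in \<open>simp add: exact_def\<close>, intro ballI impI)
    have SL: "S \<subseteq> carrier L"
      using S(2) by (simp add: exact_def)
    fix a b assume ab: "a \<in> carrier L" "b \<in> carrier L" "\<forall>c\<in>F. b \<sqsubseteq> a \<squnion> c"
    have "b \<sqsubseteq> \<Sqinter>((\<lambda>s. s \<squnion> a) ` S)"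
      using SL ab S(1) by (intro inf_greatest) (auto simp: join_comm)
    moreover have "\<Sqinter>((\<lambda>s. s \<squnion> a) ` S) = \<Sqinter>S \<squnion> a"
      using S(2) ab(1) by (simp add: exact_def)
    ultimately show "b \<sqsubseteq> a \<squnion> \<Sqinter>S"
      by (simp add: join_comm[of L a])
  qed
  then show "F \<in> FiltE L"
    using FF by (simp add: FiltE_def)
qed

text \<open>
  The set \<open>{c. \<forall>k\<in>K. k \<squnion> c \<in> F}\<close> is the co-difference of \<open>F\<close> and \<open>K\<close> in the coframe of filters, as
  shown in \<open>codiff_Filt\<close>. Exact and strongly exact filters are closed under it.
\<close>

lemma codiff_filter:
  assumes F: "F \<in> filters L" and K: "K \<in> filters L"
  shows "{c \<in> carrier L. \<forall>k\<in>K. k \<squnion> c \<in> F} \<in> filters L"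
proof -
  note KL = filtersD(1)[OF K] and F4 = filtersD(4)[OF F]
  show ?thesis
    unfolding filters_def
  proof (rule CollectI, intro conjI ballI impI)
    have "k \<squnion> \<top> \<in> F" if "k \<in> K" for k
      by (rule F4[OF filtersD(2)[OF F] join_right]) (use that KL in auto)
    then show "\<top> \<in> {c \<in> carrier L. \<forall>k\<in>K. k \<squnion> c \<in> F}"
      by simp
  next
    fix a b assume a: "a \<in> {c \<in> carrier L. \<forall>k\<in>K. k \<squnion> c \<in> F}"
      and b: "b \<in> {c \<in> carrier L. \<forall>k\<in>K. k \<squnion> c \<in> F}"
    have "k \<squnion> (a \<sqinter> b) \<in> F" if "k \<in> K" for k
      by (rule F4[OF filtersD(3)[OF F] join_meet_distrib_le]) (use a b that KL in auto)
    then show "a \<sqinter> b \<in> {c \<in> carrier L. \<forall>k\<in>K. k \<squnion> c \<in> F}"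
      using a b by simp
  next
    fix a b assume a: "a \<in> {c \<in> carrier L. \<forall>k\<in>K. k \<squnion> c \<in> F}"
      and b: "b \<in> carrier L" "a \<sqsubseteq> b"
    have "k \<squnion> b \<in> F" if "k \<in> K" for k
      by (rule F4[OF _ join_mono[OF le_refl b(2)]]) (use a that KL in auto)
    then show "b \<in> {c \<in> carrier L. \<forall>k\<in>K. k \<squnion> c \<in> F}"
      using b by simp
  qed blast
qed

lemma codiff_FiltE:
  assumes F: "F \<in> FiltE L" and K: "K \<in> filters L"
  shows "{c \<in> carrier L. \<forall>k\<in>K. k \<squnion> c \<in> F} \<in> FiltE L" (is "?G \<in> _")
  unfolding FiltE_iff
proof (intro conjI ballI impI)
  have FF: "F \<in> filters L"
    using F by (simp add: FiltE_def)
  show "?G \<in> filters L"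
    using FF K by (rule codiff_filter)
  fix x assume x: "x \<in> carrier L"
    and sep: "\<forall>a\<in>carrier L. \<forall>b\<in>carrier L. (\<forall>c\<in>?G. b \<sqsubseteq> a \<squnion> c) \<longrightarrow> b \<sqsubseteq> a \<squnion> x"
  have "k \<squnion> x \<in> F" if k: "k \<in> K" for k
  proof -
    have kL: "k \<in> carrier L"
      using k filtersD(1)[OF K] by blast
    have "b \<sqsubseteq> a \<squnion> (k \<squnion> x)"
      if ab: "a \<in> carrier L" "b \<in> carrier L" "\<forall>c\<in>F. b \<sqsubseteq> a \<squnion> c" for a b
    proof -
      have "b \<sqsubseteq> (a \<squnion> k) \<squnion> c" if "c \<in> ?G" for c
        using that ab k kL by (simp add: join_assoc)
      then have "b \<sqsubseteq> (a \<squnion> k) \<squnion> x"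
        using sep[rule_format, of "a \<squnion> k" b] ab kL by simp
      then show ?thesis
        using ab kL x by (simp add: join_assoc)
    qed
    then show ?thesis
      using F x kL unfolding FiltE_iff by simp
  qed
  with x show "x \<in> ?G"
    by blast
qed

lemma codiff_FiltSE:
  assumes F: "F \<in> FiltSE L" and K: "K \<in> filters L"
  shows "{c \<in> carrier L. \<forall>k\<in>K. k \<squnion> c \<in> F} \<in> FiltSE L" (is "?G \<in> _")
proof -
  have FF: "F \<in> filters L"
    using F by (simp add: FiltSE_def)
  have "k \<squnion> \<Sqinter>S \<in> F" if S: "S \<subseteq> ?G" "strongly_exact L S" and k: "k \<in> K" for S k
  proof -
    let ?T = "(\<lambda>s. s \<squnion> k) ` S"
    have kL: "k \<in> carrier L" and SL: "S \<subseteq> carrier L"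
      using k filtersD(1)[OF K] S(1) by blast+
    note [simp] = kL SL
    have inf: "\<Sqinter>?T = \<Sqinter>S \<squnion> k"
      using strongly_exact_imp_exact[OF S(2)] kL by (simp add: exact_def)
    \<comment> \<open>\<open>?T\<close> is strongly exact: test \<open>S\<close> on the implication \<open>c \<rightarrow> y\<close>.\<close>
    have "c \<sqsubseteq> y" if y: "y \<in> carrier L" and c: "c \<in> carrier L" and cT: "c \<sqinter> \<Sqinter>?T \<sqsubseteq> y"
      and T: "\<forall>t\<in>?T. \<forall>c\<in>carrier L. c \<sqinter> t \<sqsubseteq> y \<longrightarrow> c \<sqsubseteq> y" for y c
    proof -
      note [simp] = y c
      let ?w = "heyting_imp L c y"
      have cSk: "c \<sqinter> \<Sqinter>S \<sqsubseteq> y" "c \<sqinter> k \<sqsubseteq> y"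
        using cT by (simp_all add: inf meet_join_distrib join_le_iff)
      have "\<Sqinter>S \<sqsubseteq> ?w"
        using cSk by (simp add: le_imp_iff meet_comm)
      moreover have "d \<sqsubseteq> ?w" if s: "s \<in> S" and d: "d \<in> carrier L" and ds: "d \<sqinter> s \<sqsubseteq> ?w" for s d
      proof -
        have sL: "s \<in> carrier L"
          using s SL by blast
        note [simp] = sL d
        have "d \<sqinter> c \<sqinter> s \<sqsubseteq> y"
          using ds by (simp add: le_imp_iff meet_assoc meet_comm[of L c])
        moreover have "d \<sqinter> c \<sqinter> k \<sqsubseteq> y"
          by (rule trans'[OF _ cSk(2)]) (simp add: meet_assoc meet_right)
        ultimately have "d \<sqinter> c \<sqinter> (s \<squnion> k) \<sqsubseteq> y"
          by (simp add: meet_join_distrib join_le_iff)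
        then have "d \<sqinter> c \<sqsubseteq> y"
          using T s by simp
        then show ?thesis
          by (simp add: le_imp_iff)
      qed
      ultimately have "c \<sqsubseteq> ?w"
        using strongly_exactD[OF S(2), of ?w c] by simp
      then have "c \<sqinter> c \<sqsubseteq> y"
        by (simp add: le_imp_iff)
      then show ?thesis
        using trans'[of c "c \<sqinter> c" y] by (simp add: le_meet_iff)
    qed
    moreover have "?T \<subseteq> carrier L"
      using kL by (auto dest: subsetD[OF SL])
    ultimately have "strongly_exact L ?T"
      unfolding strongly_exact_iff by blast
    moreover have "?T \<subseteq> F"
      using S(1) k by (auto simp: join_comm)
    ultimately have "\<Sqinter>?T \<in> F"
      using FiltSED[OF F] by simp
    then show ?thesis
      by (simp add: inf join_comm)
  qed
  then have "\<Sqinter>S \<in> ?G" if "S \<subseteq> ?G" "strongly_exact L S" for S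
    using that inf_closed[of S] by blast
  with codiff_filter[OF FF K] show ?thesis
    by (simp add: FiltSE_def)
qed

lemma filters_Inter: "\<B> \<subseteq> filters L \<Longrightarrow> carrier L \<inter> \<Inter>\<B> \<in> filters L"
  unfolding filters_def using meet_closed top_closed by blast

lemma FiltE_Inter:
  assumes "\<B> \<subseteq> FiltE L"
  shows "carrier L \<inter> \<Inter>\<B> \<in> FiltE L"
proof -
  have "carrier L \<inter> \<Inter>\<B> \<in> filters L"
    by (rule filters_Inter) (use assms in \<open>auto simp: FiltE_def\<close>)
  moreover have "\<Sqinter>S \<in> F" if "F \<in> \<B>" "S \<subseteq> carrier L \<inter> \<Inter>\<B>" "exact L S" for F S
    by (rule FiltED) (use that assms in auto)
  ultimately show ?thesis
    by (simp add: FiltE_def)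
qed

lemma FiltSE_Inter:
  assumes "\<B> \<subseteq> FiltSE L"
  shows "carrier L \<inter> \<Inter>\<B> \<in> FiltSE L"
proof -
  have "carrier L \<inter> \<Inter>\<B> \<in> filters L"
    by (rule filters_Inter) (use assms in \<open>auto simp: FiltSE_def\<close>)
  moreover have "\<Sqinter>S \<in> F" if "F \<in> \<B>" "S \<subseteq> carrier L \<inter> \<Inter>\<B>" "strongly_exact L S" for F S
    by (rule FiltSED) (use that assms in auto)
  ultimately show ?thesis
    by (simp add: FiltSE_def)
qed

lemma Filt_po: "partial_order (Filt L)"
  by unfold_locales (auto simp: Filt_def)

lemma carrier_Filt: "carrier (Filt L) = filters L"
  by (simp add: Filt_def)

lemma le_Filt: "F \<sqsubseteq>\<^bsub>Filt L\<^esub> G \<longleftrightarrow> G \<subseteq> F"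
  by (simp add: Filt_def)

lemma Filt_sup: "\<B> \<subseteq> filters L \<Longrightarrow> \<Squnion>\<^bsub>Filt L\<^esub> \<B> = carrier L \<inter> \<Inter>\<B>"
  by (rule lub_eqI[OF Filt_po]) (use filters_Inter filtersD(1) in \<open>auto simp: Filt_def\<close>)

lemma Filt_join:
  assumes F: "F \<in> filters L" and G: "G \<in> filters L"
  shows "F \<squnion>\<^bsub>Filt L\<^esub> G = F \<inter> G"
  unfolding join_def using assms filtersD(1)[OF F] by (subst Filt_sup) auto

lemma codiff_Filt:
  assumes F: "F \<in> filters L" and K: "K \<in> filters L"
  shows "codiff (Filt L) F K = {c \<in> carrier L. \<forall>k\<in>K. k \<squnion> c \<in> F}" (is "_ = ?G")
proof -
  interpret Filt: partial_order "Filt L" by (rule Filt_po)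
  note KL = filtersD(1)[OF K]
  have GK: "?G \<inter> K \<subseteq> F"
  proof
    fix c assume "c \<in> ?G \<inter> K"
    then have "c \<squnion> c \<in> F" "c \<in> carrier L"
      using KL by auto
    moreover from this have "c \<squnion> c = c"
      by (intro antisym') (simp_all add: join_le_iff join_left)
    ultimately show "c \<in> F"
      by simp
  qed
  have "H \<subseteq> ?G" if H: "H \<in> filters L" and HK: "K \<inter> H \<subseteq> F" for H
  proof
    fix c assume c: "c \<in> H"
    then have cL: "c \<in> carrier L"
      using filtersD(1)[OF H] by blast
    have "k \<squnion> c \<in> F" if "k \<in> K" for k
      using HK filtersD(4)[OF K that join_left] filtersD(4)[OF H c join_right] cL that KL by blast
    with cL show "c \<in> ?G"
      by blast
  qed
  moreover have G: "?G \<in> filters L"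
    using F K by (rule codiff_filter)
  moreover have "{c \<in> carrier (Filt L). F \<sqsubseteq>\<^bsub>Filt L\<^esub> K \<squnion>\<^bsub>Filt L\<^esub> c} = {c \<in> filters L. K \<inter> c \<subseteq> F}"
    using K by (auto simp: Filt_join carrier_Filt le_Filt)
  ultimately have least: "least (Filt L) ?G {c \<in> carrier (Filt L). F \<sqsubseteq>\<^bsub>Filt L\<^esub> K \<squnion>\<^bsub>Filt L\<^esub> c}"
    using GK by (auto simp: least_def carrier_Filt le_Filt)
  then show ?thesis
    unfolding codiff_def by (rule the_equality) (rule Filt.least_unique[OF _ least])
qed

lemma subcolocale_iff:
  "subcolocale (Filt L) \<F> \<longleftrightarrow> \<F> \<subseteq> filters L \<and> (\<forall>\<B>\<subseteq>\<F>. carrier L \<inter> \<Inter>\<B> \<in> \<F>) \<and>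
     (\<forall>F\<in>\<F>. \<forall>K\<in>filters L. {c \<in> carrier L. \<forall>k\<in>K. k \<squnion> c \<in> F} \<in> \<F>)"
proof (cases "\<F> \<subseteq> filters L")
  case True
  have "(\<forall>\<B>\<subseteq>\<F>. \<Squnion>\<^bsub>Filt L\<^esub> \<B> \<in> \<F>) \<longleftrightarrow> (\<forall>\<B>\<subseteq>\<F>. carrier L \<inter> \<Inter>\<B> \<in> \<F>)"
    using True Filt_sup by (metis order_trans)
  moreover have "codiff (Filt L) F K = {c \<in> carrier L. \<forall>k\<in>K. k \<squnion> c \<in> F}"
    if "F \<in> \<F>" "K \<in> filters L" for F K
    using that True codiff_Filt by blast
  ultimately show ?thesis
    using True by (simp add: subcolocale_def Filt_def)
qed (simp add: subcolocale_def Filt_def)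

lemma subcolocale_FiltE: "subcolocale (Filt L) (FiltE L)"
  unfolding subcolocale_iff using FiltE_Inter codiff_FiltE by (auto simp: FiltE_def)

lemma subcolocale_FiltSE: "subcolocale (Filt L) (FiltSE L)"
  unfolding subcolocale_iff using FiltSE_Inter codiff_FiltSE by (auto simp: FiltSE_def)

end

section \<open>Frame maps\<close>

locale frm_map = L: frm L + M: frm M for L :: "'a gorder" and M :: "'b gorder" +
  fixes f
  assumes frame_map: "frame_map L M f"
begin

lemma f_closed [simp]: "a \<in> carrier L \<Longrightarrow> f a \<in> carrier M"
  using frame_map by (auto simp: frame_map_def)

lemma f_sup: "A \<subseteq> carrier L \<Longrightarrow> f (\<Squnion>\<^bsub>L\<^esub> A) = \<Squnion>\<^bsub>M\<^esub> (f ` A)"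
  using frame_map by (simp add: frame_map_def)

lemma f_top: "f \<top>\<^bsub>L\<^esub> = \<top>\<^bsub>M\<^esub>"
  using frame_map by (simp add: frame_map_def)

lemma f_meet: "a \<in> carrier L \<Longrightarrow> b \<in> carrier L \<Longrightarrow> f (a \<sqinter>\<^bsub>L\<^esub> b) = f a \<sqinter>\<^bsub>M\<^esub> f b"
  using frame_map by (simp add: frame_map_def)

lemma f_join: "a \<in> carrier L \<Longrightarrow> b \<in> carrier L \<Longrightarrow> f (a \<squnion>\<^bsub>L\<^esub> b) = f a \<squnion>\<^bsub>M\<^esub> f b"
  using f_sup[of "{a, b}"] by (simp add: join_def)

lemma f_mono: "a \<sqsubseteq>\<^bsub>L\<^esub> b \<Longrightarrow> f a \<sqsubseteq>\<^bsub>M\<^esub> f b"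
proof -
  assume ab: "a \<sqsubseteq>\<^bsub>L\<^esub> b"
  then have c: "a \<in> carrier L" "b \<in> carrier L"
    using L.le_carrier[of a b] by auto
  have "a \<sqinter>\<^bsub>L\<^esub> b = a"
    by (rule L.antisym') (use ab c in \<open>simp_all add: L.le_meet_iff L.meet_left\<close>)
  then have "f a = f a \<sqinter>\<^bsub>M\<^esub> f b"
    using f_meet[OF c] by simp
  then show ?thesis
    using M.meet_right[of "f a" "f b"] c by simp
qed

lemma vimage_filters:
  assumes "F \<in> filters M"
  shows "{a \<in> carrier L. f a \<in> F} \<in> filters L"
  unfolding filters_def
proof (rule CollectI, intro conjI ballI impI)
  note F = M.filtersD[OF assms]
  show "\<top>\<^bsub>L\<^esub> \<in> {a \<in> carrier L. f a \<in> F}"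
    using F(2) by (simp add: f_top)
  show "a \<sqinter>\<^bsub>L\<^esub> b \<in> {a \<in> carrier L. f a \<in> F}"
    if "a \<in> {a \<in> carrier L. f a \<in> F}" "b \<in> {a \<in> carrier L. f a \<in> F}" for a b
    using that F(3)[of "f a" "f b"] by (simp add: f_meet)
  show "b \<in> {a \<in> carrier L. f a \<in> F}"
    if "a \<in> {a \<in> carrier L. f a \<in> F}" "b \<in> carrier L" "a \<sqsubseteq>\<^bsub>L\<^esub> b" for a b
    using that F(4)[of "f a" "f b"] by (simp add: f_mono)
qed blast

text \<open>
  Frame maps preserve strongly exact meets. The test elements \<open>y\<close> of \<open>M\<close> are moved to \<open>L\<close> along the
  right adjoint \<open>f\<^sub>*\<close> of \<open>f\<close>.
\<close>

lemma strongly_exact_image: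
  assumes SE: "strongly_exact L S"
  shows "strongly_exact M (f ` S)" "\<Sqinter>\<^bsub>M\<^esub> (f ` S) = f (\<Sqinter>\<^bsub>L\<^esub> S)"
proof -
  let ?m = "\<Sqinter>\<^bsub>L\<^esub> S"
  have S: "S \<subseteq> carrier L"
    using SE by (simp add: strongly_exact_def)
  then have fS: "f ` S \<subseteq> carrier M"
    by auto
  have m: "?m \<in> carrier L"
    using S by simp
  note [simp] = m
  have key: "c \<sqsubseteq>\<^bsub>M\<^esub> y"
    if y: "y \<in> carrier M" and c: "c \<in> carrier M" and cm: "c \<sqinter>\<^bsub>M\<^esub> f ?m \<sqsubseteq>\<^bsub>M\<^esub> y"
      and dense: "\<And>s c. s \<in> S \<Longrightarrow> c \<in> carrier M \<Longrightarrow> c \<sqinter>\<^bsub>M\<^esub> f s \<sqsubseteq>\<^bsub>M\<^esub> y \<Longrightarrow> c \<sqsubseteq>\<^bsub>M\<^esub> y" for y c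
  proof -
    note [simp] = y c
    \<comment> \<open>\<open>?r\<close> is the value at \<open>c \<rightarrow> y\<close> of the right adjoint.\<close>
    let ?z = "heyting_imp M c y"
    let ?A = "{a \<in> carrier L. f a \<sqsubseteq>\<^bsub>M\<^esub> ?z}"
    let ?r = "\<Squnion>\<^bsub>L\<^esub> ?A"
    have A: "?A \<subseteq> carrier L"
      by blast
    then have r: "?r \<in> carrier L"
      by (rule L.sup_closed)
    have fr: "f ?r \<sqsubseteq>\<^bsub>M\<^esub> ?z"
      unfolding f_sup[OF A] by (rule M.sup_least) auto
    have adj: "a \<sqsubseteq>\<^bsub>L\<^esub> ?r \<longleftrightarrow> f a \<sqsubseteq>\<^bsub>M\<^esub> ?z" if "a \<in> carrier L" for a
    proof
      show "f a \<sqsubseteq>\<^bsub>M\<^esub> ?z" if "a \<sqsubseteq>\<^bsub>L\<^esub> ?r"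
        by (rule M.trans'[OF f_mono[OF that] fr])
      show "a \<sqsubseteq>\<^bsub>L\<^esub> ?r" if "f a \<sqsubseteq>\<^bsub>M\<^esub> ?z"
        by (rule L.sup_upper[OF A]) (use that \<open>a \<in> carrier L\<close> in simp)
    qed
    have "\<top>\<^bsub>L\<^esub> \<sqsubseteq>\<^bsub>L\<^esub> ?r"
    proof (rule L.strongly_exactD[OF SE r])
      show "?m \<sqsubseteq>\<^bsub>L\<^esub> ?r"
        using cm by (simp add: adj M.le_imp_iff meet_comm)
      fix s d assume s: "s \<in> S" and d: "d \<in> carrier L" and ds: "d \<sqinter>\<^bsub>L\<^esub> s \<sqsubseteq>\<^bsub>L\<^esub> ?r"
      have sL: "s \<in> carrier L"
        using s S by blast
      note [simp] = sL d
      have "f d \<sqinter>\<^bsub>M\<^esub> f s \<sqinter>\<^bsub>M\<^esub> c \<sqsubseteq>\<^bsub>M\<^esub> y"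
        using ds by (simp add: adj f_meet M.le_imp_iff)
      then have "f d \<sqinter>\<^bsub>M\<^esub> c \<sqinter>\<^bsub>M\<^esub> f s \<sqsubseteq>\<^bsub>M\<^esub> y"
        by (simp add: M.meet_assoc meet_comm[of M c])
      then have "f d \<sqinter>\<^bsub>M\<^esub> c \<sqsubseteq>\<^bsub>M\<^esub> y"
        using dense[OF s, of "f d \<sqinter>\<^bsub>M\<^esub> c"] by simp
      then show "d \<sqsubseteq>\<^bsub>L\<^esub> ?r"
        by (simp add: adj M.le_imp_iff)
    qed simp
    then have "\<top>\<^bsub>M\<^esub> \<sqsubseteq>\<^bsub>M\<^esub> ?z"
      by (simp add: adj f_top)
    then have "\<top>\<^bsub>M\<^esub> \<sqinter>\<^bsub>M\<^esub> c \<sqsubseteq>\<^bsub>M\<^esub> y"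
      by (simp add: M.le_imp_iff)
    moreover have "c \<sqsubseteq>\<^bsub>M\<^esub> \<top>\<^bsub>M\<^esub> \<sqinter>\<^bsub>M\<^esub> c"
      by (simp add: M.le_meet_iff)
    ultimately show ?thesis
      by (rule M.trans'[rotated])
  qed
  have m_le: "f ?m \<sqsubseteq>\<^bsub>M\<^esub> f s" if "s \<in> S" for s
    using that S by (intro f_mono L.inf_lower)
  show inf: "\<Sqinter>\<^bsub>M\<^esub> (f ` S) = f ?m"
  proof (rule glb_eqI[OF M.po fS])
    fix t assume t: "t \<in> carrier M" and le: "\<And>a. a \<in> f ` S \<Longrightarrow> t \<sqsubseteq>\<^bsub>M\<^esub> a"
    note [simp] = t
    \<comment> \<open>A lower bound \<open>t\<close> of the image lies below \<open>f ?m\<close>: apply \<open>key\<close> to \<open>t \<rightarrow> f ?m\<close>.\<close>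
    let ?y = "heyting_imp M t (f ?m)"
    have "t \<sqsubseteq>\<^bsub>M\<^esub> ?y"
    proof (rule key)
      have "f ?m \<sqsubseteq>\<^bsub>M\<^esub> ?y"
        by (simp add: M.le_imp_iff M.meet_left)
      then show "t \<sqinter>\<^bsub>M\<^esub> f ?m \<sqsubseteq>\<^bsub>M\<^esub> ?y"
        by (rule M.trans'[rotated]) (simp add: M.meet_right)
      fix s c assume s: "s \<in> S" and c: "c \<in> carrier M" and cs: "c \<sqinter>\<^bsub>M\<^esub> f s \<sqsubseteq>\<^bsub>M\<^esub> ?y"
      have sL: "s \<in> carrier L"
        using s S by blast
      note [simp] = sL c
      have "c \<sqinter>\<^bsub>M\<^esub> t \<sqsubseteq>\<^bsub>M\<^esub> c \<sqinter>\<^bsub>M\<^esub> f s \<sqinter>\<^bsub>M\<^esub> t"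
        using le[of "f s"] s M.trans'[OF M.meet_right, of c t]
        by (simp add: M.le_meet_iff M.meet_left M.meet_right)
      moreover have "c \<sqinter>\<^bsub>M\<^esub> f s \<sqinter>\<^bsub>M\<^esub> t \<sqsubseteq>\<^bsub>M\<^esub> f ?m"
        using cs by (simp add: M.le_imp_iff)
      ultimately have "c \<sqinter>\<^bsub>M\<^esub> t \<sqsubseteq>\<^bsub>M\<^esub> f ?m"
        by (rule M.trans')
      then show "c \<sqsubseteq>\<^bsub>M\<^esub> ?y"
        by (simp add: M.le_imp_iff)
    qed simp_all
    then have "t \<sqinter>\<^bsub>M\<^esub> t \<sqsubseteq>\<^bsub>M\<^esub> f ?m"
      by (simp add: M.le_imp_iff)
    moreover have "t \<sqsubseteq>\<^bsub>M\<^esub> t \<sqinter>\<^bsub>M\<^esub> t"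
      by (simp add: M.le_meet_iff)
    ultimately show "t \<sqsubseteq>\<^bsub>M\<^esub> f ?m"
      by (rule M.trans'[rotated])
  qed (use m_le in auto)
  show "strongly_exact M (f ` S)"
    unfolding M.strongly_exact_iff inf
  proof (intro conjI fS ballI impI)
    fix y c assume y: "y \<in> carrier M" and c: "c \<in> carrier M" "c \<sqinter>\<^bsub>M\<^esub> f ?m \<sqsubseteq>\<^bsub>M\<^esub> y"
      and "\<forall>s\<in>f ` S. \<forall>c\<in>carrier M. c \<sqinter>\<^bsub>M\<^esub> s \<sqsubseteq>\<^bsub>M\<^esub> y \<longrightarrow> c \<sqsubseteq>\<^bsub>M\<^esub> y"
    then show "c \<sqsubseteq>\<^bsub>M\<^esub> y"
      using key[OF y c] by blast
  qed
qed

lemma vimage_FiltSE: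
  assumes F: "F \<in> FiltSE M"
  shows "{a \<in> carrier L. f a \<in> F} \<in> FiltSE L"
proof -
  have "f (\<Sqinter>\<^bsub>L\<^esub> S) \<in> F" "\<Sqinter>\<^bsub>L\<^esub> S \<in> carrier L"
    if "S \<subseteq> {a \<in> carrier L. f a \<in> F}" "strongly_exact L S" for S
  proof -
    have "f ` S \<subseteq> F"
      using that(1) by auto
    then show "f (\<Sqinter>\<^bsub>L\<^esub> S) \<in> F"
      using M.FiltSED[OF F _ strongly_exact_image(1)[OF that(2)]] strongly_exact_image(2)[OF that(2)]
      by simp
    show "\<Sqinter>\<^bsub>L\<^esub> S \<in> carrier L"
      using that(2) by (simp add: strongly_exact_def)
  qed
  moreover have "F \<in> filters M"
    using F by (simp add: FiltSE_def)
  ultimately show ?thesis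
    using vimage_filters[of F] unfolding FiltSE_def by simp
qed

lemma inj_reflects_le:
  assumes "inj_on f (carrier L)" "a \<in> carrier L" "b \<in> carrier L" "f a \<sqsubseteq>\<^bsub>M\<^esub> f b"
  shows "a \<sqsubseteq>\<^bsub>L\<^esub> b"
proof -
  have "f a \<sqinter>\<^bsub>M\<^esub> f b = f a"
    by (rule M.antisym') (use assms in \<open>simp_all add: M.le_meet_iff M.meet_left\<close>)
  then have "f (a \<sqinter>\<^bsub>L\<^esub> b) = f a"
    using assms by (simp add: f_meet)
  then have "a \<sqinter>\<^bsub>L\<^esub> b = a"
    using inj_onD[OF assms(1)] assms(2,3) by simp
  then show ?thesis
    using L.meet_right[of a b] assms(2,3) by simp
qed

text \<open>
  Arbitrary frame maps need not pull exact filters back to exact filters, but isomorphisms do.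
\<close>

lemma bij_vimage_FiltE:
  assumes bij: "bij_betw f (carrier L) (carrier M)" and F: "F \<in> FiltE M"
  shows "{a \<in> carrier L. f a \<in> F} \<in> FiltE L"
  unfolding L.FiltE_iff
proof (intro conjI ballI impI)
  note surj = bij_betw_imp_surj_on[OF bij] and reflect = inj_reflects_le[OF bij_betw_imp_inj_on[OF bij]]
  have FF: "F \<in> filters M"
    using F by (simp add: FiltE_def)
  then show "{a \<in> carrier L. f a \<in> F} \<in> filters L"
    by (rule vimage_filters)
  fix x assume x: "x \<in> carrier L"
    and sep: "\<forall>a\<in>carrier L. \<forall>b\<in>carrier L.
      (\<forall>c\<in>{a \<in> carrier L. f a \<in> F}. b \<sqsubseteq>\<^bsub>L\<^esub> a \<squnion>\<^bsub>L\<^esub> c) \<longrightarrow> b \<sqsubseteq>\<^bsub>L\<^esub> a \<squnion>\<^bsub>L\<^esub> x"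
  have "f b \<sqsubseteq>\<^bsub>M\<^esub> f a \<squnion>\<^bsub>M\<^esub> f x"
    if ab: "a \<in> carrier L" "b \<in> carrier L" and le: "\<forall>c\<in>F. f b \<sqsubseteq>\<^bsub>M\<^esub> f a \<squnion>\<^bsub>M\<^esub> c" for a b
  proof -
    have "b \<sqsubseteq>\<^bsub>L\<^esub> a \<squnion>\<^bsub>L\<^esub> c" if "c \<in> {a \<in> carrier L. f a \<in> F}" for c
      by (rule reflect) (use le ab that in \<open>auto simp: f_join\<close>)
    then have "b \<sqsubseteq>\<^bsub>L\<^esub> a \<squnion>\<^bsub>L\<^esub> x"
      using sep[rule_format, OF ab] by simp
    then show ?thesis
      using f_mono[of b "a \<squnion>\<^bsub>L\<^esub> x"] x ab by (simp add: f_join)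
  qed
  then have "\<forall>a\<in>f ` carrier L. \<forall>b\<in>f ` carrier L. (\<forall>c\<in>F. b \<sqsubseteq>\<^bsub>M\<^esub> a \<squnion>\<^bsub>M\<^esub> c) \<longrightarrow> b \<sqsubseteq>\<^bsub>M\<^esub> a \<squnion>\<^bsub>M\<^esub> f x"
    by blast
  then have "f x \<in> F"
    using F x unfolding surj M.FiltE_iff by simp
  with x show "x \<in> {a \<in> carrier L. f a \<in> F}"
    by simp
qed

end

lemma frame_map_cong:
  assumes "frame L" "\<And>x. x \<in> carrier L \<Longrightarrow> f x = g x"
  shows "frame_map L M f \<longleftrightarrow> frame_map L M g"
proof -
  interpret L: frm L by unfold_locales fact
  have "f ` A = g ` A" if "A \<subseteq> carrier L" for A
    using that assms(2) by (intro image_cong) auto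
  then show ?thesis
    using assms(2) by (simp add: frame_map_def Pi_iff)
qed

lemma frame_map_comp:
  assumes "frame_map L M f" "frame_map M N g"
  shows "frame_map L N (\<lambda>x. g (f x))"
proof -
  have fA: "f ` A \<subseteq> carrier M" if "A \<subseteq> carrier L" for A
    using assms(1) that by (auto simp: frame_map_def)
  have "g (f (\<Squnion>\<^bsub>L\<^esub> A)) = \<Squnion>\<^bsub>N\<^esub> ((\<lambda>x. g (f x)) ` A)" if "A \<subseteq> carrier L" for A
    using assms that fA[OF that] by (simp add: frame_map_def image_image)
  then show ?thesis
    using assms by (auto simp: frame_map_def Pi_iff)
qed

lemma frame_map_id: "frame_map L L (\<lambda>x. x)"
  by (simp add: frame_map_def)

lemma frame_map_inv_into:
  assumes L: "frame L" and f: "frame_map L M f" and bij: "bij_betw f (carrier L) (carrier M)"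
  shows "frame_map M L (inv_into (carrier L) f)"
proof -
  interpret L: frm L by unfold_locales fact
  let ?g = "inv_into (carrier L) f"
  note inj = bij_betw_imp_inj_on[OF bij] and surj = bij_betw_imp_surj_on[OF bij]
  have g: "?g y \<in> carrier L" "f (?g y) = y" if "y \<in> carrier M" for y
    using that inv_into_into[of y f "carrier L"] f_inv_into_f[of y f "carrier L"] surj by simp_all
  have gI: "?g y = x" if "x \<in> carrier L" "f x = y" for x y
    using that inv_into_f_f[OF inj] by blast
  show ?thesis
    unfolding frame_map_def
  proof (intro conjI allI ballI impI)
    show "?g \<in> carrier M \<rightarrow> carrier L"
      using g by simp
    show "?g \<top>\<^bsub>M\<^esub> = \<top>\<^bsub>L\<^esub>"
      by (rule gI) (use f in \<open>simp_all add: frame_map_def\<close>)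
    fix A assume A: "A \<subseteq> carrier M"
    have gA: "?g ` A \<subseteq> carrier L"
      using A g by auto
    have "f ` ?g ` A = (\<lambda>y. y) ` A"
      unfolding image_image by (rule image_cong) (use A g in auto)
    then show "?g (\<Squnion>\<^bsub>M\<^esub> A) = \<Squnion>\<^bsub>L\<^esub> (?g ` A)"
      by (intro gI) (use f gA in \<open>simp_all add: frame_map_def\<close>)
  next
    fix a b assume "a \<in> carrier M" "b \<in> carrier M"
    then show "?g (a \<sqinter>\<^bsub>M\<^esub> b) = ?g a \<sqinter>\<^bsub>L\<^esub> ?g b"
      by (intro gI) (use f g in \<open>simp_all add: frame_map_def\<close>)
  qed
qed

section \<open>The frame \<open>2\<close> and frames of open sets\<close>

lemma carrier_two [simp]: "carrier two = {v0, v1}"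
  by (simp add: two_def)

lemma le_two: "x \<sqsubseteq>\<^bsub>two\<^esub> y \<longleftrightarrow> x \<in> {v0, v1} \<and> y \<in> {v0, v1} \<and> (x = y \<or> x = v0)"
  by (simp add: two_def)

lemma po_two: "partial_order two"
  by unfold_locales (auto simp: two_def)

lemma sup_two: "A \<subseteq> {v0, v1} \<Longrightarrow> \<Squnion>\<^bsub>two\<^esub> A = (if v1 \<in> A then v1 else v0)"
  by (rule lub_eqI[OF po_two]) (auto simp: le_two)

lemma top_two: "\<top>\<^bsub>two\<^esub> = v1"
  by (rule top_eqI[OF po_two]) (auto simp: le_two)

lemma meet_two: "x \<in> {v0, v1} \<Longrightarrow> y \<in> {v0, v1} \<Longrightarrow> x \<sqinter>\<^bsub>two\<^esub> y = (if x = v1 \<and> y = v1 then v1 else v0)"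
  unfolding meet_def by (rule glb_eqI[OF po_two]) (auto simp: le_two)

lemma complete_two: "complete_lattice two"
proof (rule complete_lattice_if_sups[OF po_two])
  fix A :: "'a set" assume "A \<subseteq> carrier two"
  then show "\<exists>s\<in>carrier two. (\<forall>a\<in>A. a \<sqsubseteq>\<^bsub>two\<^esub> s) \<and>
      (\<forall>u\<in>carrier two. (\<forall>a\<in>A. a \<sqsubseteq>\<^bsub>two\<^esub> u) \<longrightarrow> s \<sqsubseteq>\<^bsub>two\<^esub> u)"
    by (cases "v1 \<in> A") (auto simp: le_two)
qed

lemma frame_two: "frame two"
  unfolding frame_def
proof (intro conjI allI impI ballI complete_two)
  fix a :: 'a and B :: "'a set" assume a: "a \<in> carrier two" and B: "B \<subseteq> carrier two"
  then have "(\<lambda>b. a \<sqinter>\<^bsub>two\<^esub> b) ` B = (\<lambda>b. if a = v1 \<and> b = v1 then v1 else v0) ` B"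
    by (intro image_cong) (auto simp: meet_two)
  moreover have "\<dots> \<subseteq> {v0, v1}"
    by auto
  ultimately show "a \<sqinter>\<^bsub>two\<^esub> (\<Squnion>\<^bsub>two\<^esub> B) = \<Squnion>\<^bsub>two\<^esub> ((\<lambda>b. a \<sqinter>\<^bsub>two\<^esub> b) ` B)"
    using a B by (auto simp: sup_two meet_two image_iff)
qed (auto simp: le_two)

text \<open>Frame maps to \<open>2\<close> are the completely prime filters.\<close>

lemma frame_map_two_iff:
  assumes "frame L"
  shows "frame_map L two f \<longleftrightarrow> f \<in> carrier L \<rightarrow> {v0, v1} \<and>
     (\<forall>A\<subseteq>carrier L. f (\<Squnion>\<^bsub>L\<^esub> A) = v1 \<longleftrightarrow> (\<exists>a\<in>A. f a = v1)) \<and> f \<top>\<^bsub>L\<^esub> = v1 \<and>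
     (\<forall>a\<in>carrier L. \<forall>b\<in>carrier L. f (a \<sqinter>\<^bsub>L\<^esub> b) = v1 \<longleftrightarrow> f a = v1 \<and> f b = v1)"
proof (cases "f \<in> carrier L \<rightarrow> {v0, v1}")
  case f: True
  interpret L: frm L by unfold_locales fact
  have f01: "f a = v0 \<or> f a = v1" if "a \<in> carrier L" for a
    using f that by auto
  have eq: "x = y \<longleftrightarrow> (x = v1 \<longleftrightarrow> y = v1)" if "x \<in> {v0, v1}" "y \<in> {v0, v1}" for x y
    using that by auto
  have "f (\<Squnion>\<^bsub>L\<^esub> A) = \<Squnion>\<^bsub>two\<^esub> (f ` A) \<longleftrightarrow> (f (\<Squnion>\<^bsub>L\<^esub> A) = v1 \<longleftrightarrow> (\<exists>a\<in>A. f a = v1))"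
    if A: "A \<subseteq> carrier L" for A
  proof -
    have "f ` A \<subseteq> {v0, v1}"
      using f A by auto
    then have "\<Squnion>\<^bsub>two\<^esub> (f ` A) = (if \<exists>a\<in>A. f a = v1 then v1 else v0)"
      by (simp add: sup_two image_iff eq_commute[of v1])
    then show ?thesis
      using f01[OF L.sup_closed[OF A]] by auto
  qed
  moreover have "f (a \<sqinter>\<^bsub>L\<^esub> b) = f a \<sqinter>\<^bsub>two\<^esub> f b \<longleftrightarrow> (f (a \<sqinter>\<^bsub>L\<^esub> b) = v1 \<longleftrightarrow> f a = v1 \<and> f b = v1)"
    if ab: "a \<in> carrier L" "b \<in> carrier L" for a b
  proof -
    have "f a \<sqinter>\<^bsub>two\<^esub> f b = (if f a = v1 \<and> f b = v1 then v1 else v0)"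
      using f01[OF ab(1)] f01[OF ab(2)] by (intro meet_two) auto
    then show ?thesis
      using f01[OF L.meet_closed[OF ab]] by auto
  qed
  ultimately show ?thesis
    using f by (simp add: frame_map_def top_two)
next
  case False
  then show ?thesis
    by (simp add: frame_map_def)
qed

lemma FiltE_two: "FiltE two = filters two"
proof -
  interpret two: frm two by unfold_locales (rule frame_two)
  have inf: "\<Sqinter>\<^bsub>two\<^esub> S = (if v0 \<in> S then v0 else v1)" if "S \<subseteq> {v0, v1}" for S
    by (rule glb_eqI[OF po_two]) (use that in \<open>auto simp: le_two\<close>)
  have "\<Sqinter>\<^bsub>two\<^esub> S \<in> F" if "F \<in> filters two" "S \<subseteq> F" for F S
    using two.filtersD(1,2)[OF that(1)] that(2) inf[of S] by (auto simp: top_two)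
  then show ?thesis
    by (auto simp: FiltE_def)
qed

lemma FiltSE_two: "FiltSE two = filters two"
proof -
  interpret two: frm two by unfold_locales (rule frame_two)
  show ?thesis
    using two.FiltE_subset_FiltSE FiltE_two by (auto simp: FiltSE_def)
qed

lemma filters_two: "filters (two :: 'u::universe gorder) = {{v1}, {v0, v1}}"
proof (rule subset_antisym)
  interpret two: frm "two :: 'u gorder" by unfold_locales (rule frame_two)
  show "filters two \<subseteq> {{v1}, {v0, v1 :: 'u}}"
  proof
    fix F :: "'u set" assume "F \<in> filters two"
    from two.filtersD(1,2)[OF this] have "F \<subseteq> {v0, v1}" "v1 \<in> F"
      by (simp_all add: top_two)
    then show "F \<in> {{v1}, {v0, v1}}"
      by auto
  qed
  show "{{v1}, {v0, v1 :: 'u}} \<subseteq> filters two"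
    by (simp add: filters_def top_two meet_two le_two)
qed

locale small_space =
  fixes X :: "'u::universe topology"
  assumes small_X [simp]: "small (topspace X)"
begin

lemma small_open: "openin X U \<Longrightarrow> small U"
  using small_subset[OF small_X] openin_subset by blast

lemma opens_carrier_iff: "u \<in> carrier (opens X) \<longleftrightarrow> openin X (elts u)"
proof
  assume "u \<in> carrier (opens X)"
  then obtain U where "u = vset U" "openin X U"
    by (auto simp: opens_def)
  then show "openin X (elts u)"
    by (simp add: small_open)
next
  assume "openin X (elts u)"
  then have "vset (elts u) \<in> vset ` {U. openin X U}"
    by blast
  then show "u \<in> carrier (opens X)"
    by (simp add: opens_def)
qed

lemma vset_open [simp]: "openin X U \<Longrightarrow> vset U \<in> carrier (opens X)"
  by (simp add: opens_carrier_iff small_open)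

lemma elts_vset_open [simp]: "openin X U \<Longrightarrow> elts (vset U) = U"
  by (simp add: small_open)

lemma le_opens_iff: "u \<sqsubseteq>\<^bsub>opens X\<^esub> v \<longleftrightarrow> u \<in> carrier (opens X) \<and> v \<in> carrier (opens X) \<and> elts u \<subseteq> elts v"
  by (simp add: opens_def)

lemma opens_elts_subset: "u \<in> carrier (opens X) \<Longrightarrow> elts u \<subseteq> topspace X"
  by (simp add: opens_carrier_iff openin_subset)

lemma small_opens [simp]: "small (carrier (opens X))"
proof (rule small_subset[OF small_Pow[OF small_X]])
  show "carrier (opens X) \<subseteq> vset ` Pow (topspace X)"
    using openin_subset[of X] by (auto simp: opens_def)
qed

lemma po_opens: "partial_order (opens X)"
proof unfold_locales
  fix x y assume "x \<sqsubseteq>\<^bsub>opens X\<^esub> y" "y \<sqsubseteq>\<^bsub>opens X\<^esub> x"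
  then have "elts x = elts y"
    by (auto simp: le_opens_iff)
  then show "x .=\<^bsub>opens X\<^esub> y"
    using elts_inject by (simp add: opens_def)
qed (auto simp: le_opens_iff, auto simp: opens_def)

lemma openin_UN_elts: "A \<subseteq> carrier (opens X) \<Longrightarrow> openin X (\<Union>(elts ` A))"
  by (rule openin_Union) (auto simp: opens_carrier_iff)

lemma sup_opens: "A \<subseteq> carrier (opens X) \<Longrightarrow> \<Squnion>\<^bsub>opens X\<^esub> A = vset (\<Union>(elts ` A))"
  by (rule lub_eqI[OF po_opens]) (auto simp: le_opens_iff openin_UN_elts)

lemma top_opens: "\<top>\<^bsub>opens X\<^esub> = vset (topspace X)"
  by (rule top_eqI[OF po_opens]) (auto simp: le_opens_iff dest: opens_elts_subset)

lemma meet_opens: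
  "u \<in> carrier (opens X) \<Longrightarrow> v \<in> carrier (opens X) \<Longrightarrow> u \<sqinter>\<^bsub>opens X\<^esub> v = vset (elts u \<inter> elts v)"
  unfolding meet_def
  by (rule glb_eqI[OF po_opens]) (auto simp: le_opens_iff opens_carrier_iff openin_Int)

lemma join_opens:
  "u \<in> carrier (opens X) \<Longrightarrow> v \<in> carrier (opens X) \<Longrightarrow> u \<squnion>\<^bsub>opens X\<^esub> v = vset (elts u \<union> elts v)"
  unfolding join_def by (simp add: sup_opens)

lemma complete_opens: "complete_lattice (opens X)"
proof (rule complete_lattice_if_sups[OF po_opens])
  fix A assume "A \<subseteq> carrier (opens X)"
  then show "\<exists>s\<in>carrier (opens X). (\<forall>a\<in>A. a \<sqsubseteq>\<^bsub>opens X\<^esub> s) \<and>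
      (\<forall>u\<in>carrier (opens X). (\<forall>a\<in>A. a \<sqsubseteq>\<^bsub>opens X\<^esub> u) \<longrightarrow> s \<sqsubseteq>\<^bsub>opens X\<^esub> u)"
    by (intro bexI[of _ "vset (\<Union>(elts ` A))"]) (auto simp: le_opens_iff openin_UN_elts)
qed

lemma elts_sup_opens: "A \<subseteq> carrier (opens X) \<Longrightarrow> elts (\<Squnion>\<^bsub>opens X\<^esub> A) = \<Union>(elts ` A)"
  by (simp add: sup_opens openin_UN_elts)

lemma elts_top_opens: "elts \<top>\<^bsub>opens X\<^esub> = topspace X"
  by (simp add: top_opens)

lemma elts_meet_opens:
  "u \<in> carrier (opens X) \<Longrightarrow> v \<in> carrier (opens X) \<Longrightarrow> elts (u \<sqinter>\<^bsub>opens X\<^esub> v) = elts u \<inter> elts v"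
  by (simp add: meet_opens opens_carrier_iff openin_Int)

lemma elts_join_opens:
  "u \<in> carrier (opens X) \<Longrightarrow> v \<in> carrier (opens X) \<Longrightarrow> elts (u \<squnion>\<^bsub>opens X\<^esub> v) = elts u \<union> elts v"
  by (simp add: join_opens opens_carrier_iff openin_Un)

lemma frame_opens: "frame (opens X)"
  unfolding frame_def
proof (intro conjI allI impI ballI complete_opens)
  interpret complete_lattice "opens X" by (rule complete_opens)
  fix a B assume a: "a \<in> carrier (opens X)" and B: "B \<subseteq> carrier (opens X)"
  have im: "(\<lambda>b. a \<sqinter>\<^bsub>opens X\<^esub> b) ` B \<subseteq> carrier (opens X)"
    using a B by auto
  have "elts (a \<sqinter>\<^bsub>opens X\<^esub> (\<Squnion>\<^bsub>opens X\<^esub> B)) = (\<Union>b\<in>B. elts a \<inter> elts b)"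
    using a B by (simp add: elts_meet_opens elts_sup_opens)
  also have "\<dots> = elts (\<Squnion>\<^bsub>opens X\<^esub> ((\<lambda>b. a \<sqinter>\<^bsub>opens X\<^esub> b) ` B))"
    using a B by (simp add: elts_sup_opens[OF im] subset_iff elts_meet_opens)
  finally show "a \<sqinter>\<^bsub>opens X\<^esub> (\<Squnion>\<^bsub>opens X\<^esub> B) = \<Squnion>\<^bsub>opens X\<^esub> ((\<lambda>b. a \<sqinter>\<^bsub>opens X\<^esub> b) ` B)"
    by (rule elts_inject)
qed (auto simp: le_opens_iff)

text \<open>A map into a frame of opens is a frame map as soon as its values at all points are.\<close>

lemma frame_map_opensI:
  assumes L: "frame L" and h: "h \<in> carrier L \<rightarrow> carrier (opens X)"
    and pt: "\<And>x. x \<in> topspace X \<Longrightarrow> frame_map L (two :: 'u gorder) (\<lambda>a. if x \<in> elts (h a) then v1 else v0)"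
  shows "frame_map L (opens X) h"
proof -
  interpret L: frm L by unfold_locales fact
  have if_v1: "(if P then v1 else v0) = (v1 :: 'u) \<longleftrightarrow> P" for P
    by simp
  note pt = pt[unfolded frame_map_two_iff[OF L] if_v1, THEN conjunct2]
  have pt1: "x \<in> elts (h (\<Squnion>\<^bsub>L\<^esub> A)) \<longleftrightarrow> (\<exists>a\<in>A. x \<in> elts (h a))"
    if "x \<in> topspace X" "A \<subseteq> carrier L" for x A
    using pt[OF that(1), THEN conjunct1] that(2) by blast
  have pt2: "x \<in> elts (h \<top>\<^bsub>L\<^esub>)" if "x \<in> topspace X" for x
    using pt[OF that, THEN conjunct2, THEN conjunct1] .
  have pt3: "x \<in> elts (h (a \<sqinter>\<^bsub>L\<^esub> b)) \<longleftrightarrow> x \<in> elts (h a) \<and> x \<in> elts (h b)"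
    if "x \<in> topspace X" "a \<in> carrier L" "b \<in> carrier L" for x a b
    using pt[OF that(1), THEN conjunct2, THEN conjunct2] that(2,3) by blast
  have sub: "elts (h a) \<subseteq> topspace X" if "a \<in> carrier L" for a
    using h that by (intro opens_elts_subset) auto
  have hA: "h ` A \<subseteq> carrier (opens X)" if "A \<subseteq> carrier L" for A
    using h that by auto
  show ?thesis
    unfolding frame_map_def
  proof (intro conjI allI ballI impI h)
    fix A assume A: "A \<subseteq> carrier L"
    show "h (\<Squnion>\<^bsub>L\<^esub> A) = \<Squnion>\<^bsub>opens X\<^esub> (h ` A)"
    proof (rule elts_inject, unfold elts_sup_opens[OF hA[OF A]], rule subset_antisym)
      show "elts (h (\<Squnion>\<^bsub>L\<^esub> A)) \<subseteq> \<Union>(elts ` h ` A)"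
        using pt1[OF _ A] sub[OF L.sup_closed[OF A]] by auto
      show "\<Union>(elts ` h ` A) \<subseteq> elts (h (\<Squnion>\<^bsub>L\<^esub> A))"
        using pt1[OF _ A] sub A by blast
    qed
  next
    show "h \<top>\<^bsub>L\<^esub> = \<top>\<^bsub>opens X\<^esub>"
      by (rule elts_inject) (use pt2 sub[of "\<top>\<^bsub>L\<^esub>"] in \<open>auto simp: elts_top_opens\<close>)
  next
    fix a b assume ab: "a \<in> carrier L" "b \<in> carrier L"
    have "h a \<in> carrier (opens X)" "h b \<in> carrier (opens X)"
      using h ab by auto
    note eq = elts_meet_opens[OF this]
    show "h (a \<sqinter>\<^bsub>L\<^esub> b) = h a \<sqinter>\<^bsub>opens X\<^esub> h b"
    proof (rule elts_inject, unfold eq, rule subset_antisym)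
      show "elts (h (a \<sqinter>\<^bsub>L\<^esub> b)) \<subseteq> elts (h a) \<inter> elts (h b)"
        using pt3[OF _ ab] sub[OF L.meet_closed[OF ab]] by auto
      show "elts (h a) \<inter> elts (h b) \<subseteq> elts (h (a \<sqinter>\<^bsub>L\<^esub> b))"
        using pt3[OF _ ab] sub[OF ab(1)] by auto
    qed
  qed
qed

lemma frame_map_point:
  "x \<in> topspace X \<Longrightarrow> frame_map (opens X) (two :: 'u gorder) (\<lambda>u. if x \<in> elts u then v1 else v0)"
  unfolding frame_map_two_iff[OF frame_opens]
  by (auto simp: elts_sup_opens elts_top_opens elts_meet_opens)

end

section \<open>The categories of small sets, spaces and frames\<close>

lemma vcomp_vgraph:
  assumes "small A" "small B" "f \<in> A \<rightarrow> B"
  shows "vcomp (vgraph B g) (vgraph A f) = vgraph A (\<lambda>x. g (f x))"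
proof -
  \<comment> \<open>No codomain is required of \<open>g\<close>: \<open>vgraph B g\<close> is a function into the whole type.\<close>
  have "vcomp (vgraph B g) (vgraph A f) = vgraph A (\<lambda>x. app (vgraph B g) (app (vgraph A f) x))"
    by (rule vcomp_eq[OF assms(1,2) vgraph_in_vfuns[OF assms(3)] vgraph_in_vfuns[of g B UNIV]]) simp
  also have "\<dots> = vgraph A (\<lambda>x. g (f x))"
    by (rule vgraph_cong) (use assms in \<open>auto simp: Pi_iff\<close>)
  finally show ?thesis .
qed

lemma vcomp_vgraph_left:
  assumes "small A" "small B" "f \<in> vfuns A B"
  shows "vcomp (vgraph B g) f = vgraph A (\<lambda>x. g (app f x))"
  using vcomp_vgraph[OF assms(1,2), of "app f" g] vfuns_app[OF assms(1,3)]
  unfolding vfuns_vgraph[OF assms(1,3)] by simp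

text \<open>
  Categories of structured sets: \<open>U A\<close> is the underlying set of \<open>A\<close>, and arrows are graphs of
  functions between underlying sets.
\<close>

lemma categoryI:
  assumes "\<And>A. A \<in> Obj C \<Longrightarrow> small (U A)"
    and "\<And>A B f. A \<in> Obj C \<Longrightarrow> B \<in> Obj C \<Longrightarrow> f \<in> Hom C A B \<Longrightarrow> f \<in> vfuns (U A) (U B)"
    and "\<And>A. A \<in> Obj C \<Longrightarrow> Idt C A = vid (U A)"
    and "\<And>A. A \<in> Obj C \<Longrightarrow> vid (U A) \<in> Hom C A A"
    and "Comp C = vcomp"
    and "\<And>A B D f g. A \<in> Obj C \<Longrightarrow> B \<in> Obj C \<Longrightarrow> D \<in> Obj C \<Longrightarrow>
           f \<in> Hom C A B \<Longrightarrow> g \<in> Hom C B D \<Longrightarrow> vcomp g f \<in> Hom C A D"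
  shows "category C"
proof -
  have "vcomp f (Idt C A) = f" "vcomp (Idt C B) f = f"
    if "A \<in> Obj C" "B \<in> Obj C" "f \<in> Hom C A B" for A B f
    using vcomp_vid_right[OF assms(1)[OF that(1)] assms(2)[OF that]]
      vcomp_vid_left[OF assms(1)[OF that(1)] assms(1)[OF that(2)] assms(2)[OF that]]
    by (simp_all add: assms(3) that)
  moreover have "vcomp h (vcomp g f) = vcomp (vcomp h g) f"
    if "A \<in> Obj C" "B \<in> Obj C" "D \<in> Obj C" "E \<in> Obj C"
      "f \<in> Hom C A B" "g \<in> Hom C B D" "h \<in> Hom C D E" for A B D E f g h
    by (rule vcomp_assoc[OF assms(1)[OF that(1)] assms(1)[OF that(2)] assms(1)[OF that(3)]
      assms(2)[OF that(1,2,5)] assms(2)[OF that(2,3,6)] assms(2)[OF that(3,4,7)]])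
  ultimately show ?thesis
    using assms(3,4,6) unfolding category_def assms(5) by simp
qed

lemma categoryD:
  assumes "category C"
  shows "A \<in> Obj C \<Longrightarrow> Idt C A \<in> Hom C A A"
    and "\<lbrakk>A \<in> Obj C; B \<in> Obj C; D \<in> Obj C; f \<in> Hom C A B; g \<in> Hom C B D\<rbrakk> \<Longrightarrow> Comp C g f \<in> Hom C A D"
    and "\<lbrakk>A \<in> Obj C; B \<in> Obj C; f \<in> Hom C A B\<rbrakk> \<Longrightarrow> Comp C f (Idt C A) = f"
    and "\<lbrakk>A \<in> Obj C; B \<in> Obj C; f \<in> Hom C A B\<rbrakk> \<Longrightarrow> Comp C (Idt C B) f = f"
    and "\<lbrakk>A \<in> Obj C; B \<in> Obj C; D \<in> Obj C; E \<in> Obj C; f \<in> Hom C A B; g \<in> Hom C B D; h \<in> Hom C D E\<rbrakk>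
           \<Longrightarrow> Comp C h (Comp C g f) = Comp C (Comp C h g) f"
  using assms unfolding category_def by simp_all

lemma category_op: "category C \<Longrightarrow> category (op_cat C)"
  unfolding category_def op_cat_def by simp

lemma category_full_subcat: "category C \<Longrightarrow> category (full_subcat C S)"
  unfolding category_def full_subcat_def by auto

lemma inv_arr_eq:
  assumes C: "category C" and AB: "A \<in> Obj C" "B \<in> Obj C" and f: "f \<in> Hom C A B"
    and g: "is_inverse C A B f g"
  shows "inv_arr C A B f = g"
  unfolding inv_arr_def
proof (rule the_equality)
  show "is_inverse C A B f g"
    by (rule g)
  fix g' assume g': "is_inverse C A B f g'"
  note G = g[unfolded is_inverse_def] g'[unfolded is_inverse_def]
  have "g' = Comp C g' (Comp C f g)"
    using categoryD(3)[OF C AB(2,1)] G by simp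
  also have "\<dots> = Comp C (Comp C g' f) g"
    by (rule categoryD(5)[OF C AB(2,1,2,1)]) (use G f in simp_all)
  also have "\<dots> = g"
    using categoryD(4)[OF C AB(2,1)] G by simp
  finally show "g' = g" .
qed

lemma is_inverse_Idt: "category C \<Longrightarrow> A \<in> Obj C \<Longrightarrow> is_inverse C A A (Idt C A) (Idt C A)"
  by (simp add: category_def is_inverse_def)

lemma is_iso_Idt: "category C \<Longrightarrow> A \<in> Obj C \<Longrightarrow> is_iso C A A (Idt C A)"
  using is_inverse_Idt[of C A] categoryD(1)[of C A] unfolding is_iso_def by blast

lemma Set_cat_simps [simp]:
  "Obj Set_cat = {A. small A}" "Hom Set_cat = vfuns" "Idt Set_cat = vid" "Comp Set_cat = vcomp"
  by (simp_all add: Set_cat_def)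

lemma category_Set: "category Set_cat"
  by (rule categoryI[where U = "\<lambda>A. A"]) (auto intro: vid_in_vfuns vcomp_in_vfuns)

lemma Top_cat_simps [simp]:
  "X \<in> Obj Top_cat \<longleftrightarrow> small (topspace X)"
  "f \<in> Hom Top_cat X Y \<longleftrightarrow> f \<in> vfuns (topspace X) (topspace Y) \<and> continuous_map X Y (app f)"
  "Idt Top_cat X = vid (topspace X)" "Comp Top_cat = vcomp"
  by (simp_all add: Top_cat_def)

lemma vgraph_in_Top:
  assumes "small (topspace X)" "continuous_map X Y f"
  shows "vgraph (topspace X) f \<in> Hom Top_cat X Y"
proof -
  have "continuous_map X Y (app (vgraph (topspace X) f))"
    by (rule continuous_map_eq[OF assms(2)]) (simp add: assms(1))
  then show ?thesis
    using continuous_map_image_subset_topspace[OF assms(2)] by (auto intro!: vgraph_in_vfuns)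
qed

lemma category_Top: "category Top_cat"
proof (rule categoryI[where U = topspace])
  fix X Y Z :: "'a topology" and f g
  assume XYZ: "X \<in> Obj Top_cat" "Y \<in> Obj Top_cat" "Z \<in> Obj Top_cat"
    and f: "f \<in> Hom Top_cat X Y" and g: "g \<in> Hom Top_cat Y Z"
  have "vcomp g f = vgraph (topspace X) (\<lambda>x. app g (app f x))"
    by (rule vcomp_eq[where B = "topspace Y" and C = "topspace Z"]) (use XYZ f g in auto)
  moreover have "continuous_map X Z (\<lambda>x. app g (app f x))"
    using continuous_map_compose[of X Y "app f" Z "app g"] f g by (simp add: o_def)
  ultimately show "vcomp g f \<in> Hom Top_cat X Z"
    using vgraph_in_Top XYZ(1) by (metis Top_cat_simps(1))
next
  fix X :: "'a topology" assume "X \<in> Obj Top_cat"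
  then show "vid (topspace X) \<in> Hom Top_cat X X"
    unfolding vid_def using vgraph_in_Top[of X X "\<lambda>x. x"] by simp
qed simp_all

lemma Frm_cat_simps [simp]:
  "L \<in> Obj Frm_cat \<longleftrightarrow> frame L \<and> small (carrier L)"
  "f \<in> Hom Frm_cat L M \<longleftrightarrow> f \<in> vfuns (carrier L) (carrier M) \<and> frame_map L M (app f)"
  "Idt Frm_cat L = vid (carrier L)" "Comp Frm_cat = vcomp"
  by (simp_all add: Frm_cat_def)

lemma frame_map_vgraph:
  assumes "frame L" "small (carrier L)"
  shows "frame_map L M (app (vgraph (carrier L) f)) \<longleftrightarrow> frame_map L M f"
  by (rule frame_map_cong[OF assms(1)]) (simp add: assms(2))

lemma vgraph_in_Frm:
  assumes "frame L" "small (carrier L)" "frame_map L M f"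
  shows "vgraph (carrier L) f \<in> Hom Frm_cat L M"
proof -
  have "frame_map L M (app (vgraph (carrier L) f))"
    using assms by (simp add: frame_map_vgraph)
  moreover have "f \<in> carrier L \<rightarrow> carrier M"
    using assms(3) by (simp add: frame_map_def)
  ultimately show ?thesis
    by (simp add: vgraph_in_vfuns)
qed

lemma category_Frm: "category Frm_cat"
proof (rule categoryI[where U = carrier])
  fix L M N :: "'a gorder" and f g
  assume LMN: "L \<in> Obj Frm_cat" "M \<in> Obj Frm_cat" "N \<in> Obj Frm_cat"
    and f: "f \<in> Hom Frm_cat L M" and g: "g \<in> Hom Frm_cat M N"
  have "vcomp g f = vgraph (carrier L) (\<lambda>x. app g (app f x))"
    by (rule vcomp_eq[where B = "carrier M" and C = "carrier N"]) (use LMN f g in auto)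
  moreover have "frame_map L N (\<lambda>x. app g (app f x))"
    using f g by (auto intro: frame_map_comp)
  ultimately show "vcomp g f \<in> Hom Frm_cat L N"
    using vgraph_in_Frm[of L N] LMN(1) by simp
next
  fix L :: "'a gorder" assume "L \<in> Obj Frm_cat"
  then show "vid (carrier L) \<in> Hom Frm_cat L L"
    unfolding vid_def using vgraph_in_Frm[of L L "\<lambda>x. x"] frame_map_id by auto
qed simp_all

lemma two_Frm: "two \<in> Obj Frm_cat"
  by (simp add: frame_two)

lemma opens_Frm: "small (topspace X) \<Longrightarrow> opens X \<in> Obj Frm_cat"
  by (simp add: small_space.frame_opens small_space.small_opens small_space.intro)


section \<open>Points and characteristic maps\<close>

lemma openin_Sierpinski: "openin Sierpinski U \<longleftrightarrow> U \<in> {{}, {v1}, {v0, v1}}"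
proof -
  have "istopology (\<lambda>U. U \<in> {{}, {v1}, {v0, v1 :: 'a}})"
    unfolding istopology_def
  proof (intro conjI allI impI)
    fix \<K> assume "\<forall>K\<in>\<K>. K \<in> {{}, {v1}, {v0, v1 :: 'a}}"
    then show "\<Union>\<K> \<in> {{}, {v1}, {v0, v1}}"
      by (cases "{v0, v1} \<in> \<K>"; cases "{v1} \<in> \<K>") auto
  qed auto
  then show ?thesis
    by (simp add: Sierpinski_def topology_inverse')
qed

lemma topspace_Sierpinski [simp]: "topspace Sierpinski = {v0, v1}"
  unfolding topspace_def openin_Sierpinski by auto

text \<open>The frame map \<open>\<Omega> X \<rightarrow> 2\<close> given by a point \<open>x\<close>.\<close>

definition point :: "'u::universe topology \<Rightarrow> 'u \<Rightarrow> 'u" where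
  "point X x = vgraph (carrier (opens X)) (\<lambda>u. if x \<in> elts u then v1 else v0)"

text \<open>The characteristic map of a subset of \<open>X\<close>; it is continuous for open sets.\<close>

definition char_map :: "'u::universe topology \<Rightarrow> 'u set \<Rightarrow> 'u" where
  "char_map X U = vgraph (topspace X) (\<lambda>x. if x \<in> U then v1 else v0)"

context small_space
begin

lemma char_map_in: "openin X U \<Longrightarrow> char_map X U \<in> Hom Top_cat X Sierpinski"
  unfolding char_map_def
proof (rule vgraph_in_Top[OF small_X])
  assume U: "openin X U"
  have *: "openin X {x \<in> topspace X. (if x \<in> U then v1 else v0 :: 'u) \<in> V}" if "openin Sierpinski V" for V
  proof -
    have "{x \<in> topspace X. (if x \<in> U then v1 else v0 :: 'u) \<in> V} \<in> {{}, U, topspace X}"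
      using that openin_subset[OF U] unfolding openin_Sierpinski by auto
    then show ?thesis
      unfolding insert_iff using U by (elim disjE) (simp_all only: openin_empty openin_topspace empty_iff)
  qed
  show "continuous_map X (Sierpinski :: 'u topology) (\<lambda>x. if x \<in> U then v1 else v0)"
    unfolding continuous_map_def topspace_Sierpinski
    by (intro conjI allI impI *) simp_all
qed

lemma Hom_Sierpinski:
  assumes "g \<in> Hom Top_cat X Sierpinski"
  shows "openin X {x \<in> topspace X. app g x = v1}" "char_map X {x \<in> topspace X. app g x = v1} = g"
proof -
  have g: "g \<in> vfuns (topspace X) {v0, v1}" "continuous_map X Sierpinski (app g)"
    using assms by auto
  have "openin X {x \<in> topspace X. app g x \<in> {v1}}"
    using g(2) unfolding continuous_map_def openin_Sierpinski by blast
  then show "openin X {x \<in> topspace X. app g x = v1}"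
    by simp
  have "char_map X {x \<in> topspace X. app g x = v1} = vgraph (topspace X) (app g)"
    unfolding char_map_def by (rule vgraph_cong) (use vfuns_app[OF small_X g(1)] in fastforce)
  then show "char_map X {x \<in> topspace X. app g x = v1} = g"
    by (simp add: vfuns_vgraph[OF small_X g(1)])
qed

lemma small_Hom_Sierpinski [simp]: "small (Hom Top_cat X Sierpinski)"
proof (rule small_subset)
  show "small (vfuns (topspace X) {v0, v1})"
    by (rule small_vfuns) simp_all
  show "Hom Top_cat X Sierpinski \<subseteq> vfuns (topspace X) {v0, v1}"
    by auto
qed

lemma char_map_inject:
  assumes "openin X U" "openin X V" "char_map X U = char_map X V"
  shows "U = V"
proof -
  have *: "app (char_map X W) x = v1 \<longleftrightarrow> x \<in> W" if "x \<in> topspace X" for x W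
    using that by (simp add: char_map_def)
  have "x \<in> U \<longleftrightarrow> x \<in> V" if "x \<in> topspace X" for x
    using *[OF that, of U] *[OF that, of V] assms(3) by simp
  then show ?thesis
    using openin_subset[OF assms(1)] openin_subset[OF assms(2)] by blast
qed

lemma char_arr_eq: "char_arr X = vgraph (carrier (opens X)) (\<lambda>u. char_map X (elts u))"
  by (simp add: char_arr_def char_map_def)

lemma char_arr_in: "char_arr X \<in> vfuns (carrier (opens X)) (Hom Top_cat X Sierpinski)"
  unfolding char_arr_eq
  by (intro vgraph_in_vfuns funcsetI char_map_in) (simp add: opens_carrier_iff)

lemma app_char_arr: "u \<in> carrier (opens X) \<Longrightarrow> app (char_arr X) u = char_map X (elts u)"
  by (simp add: char_arr_eq)

text \<open>Continuous maps \<open>X \<rightarrow> \<S>\<close> correspond to open sets of \<open>X\<close>.\<close>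

lemma char_arr_inverse:
  "is_inverse Set_cat (carrier (opens X)) (Hom Top_cat X Sierpinski) (char_arr X)
     (vgraph (Hom Top_cat X Sierpinski) (\<lambda>g. vset {x \<in> topspace X. app g x = v1}))"
proof -
  let ?S = "Hom Top_cat X Sierpinski" and ?O = "carrier (opens X)"
  let ?g = "\<lambda>g. vset {x \<in> topspace X. app g x = v1}"
  have g: "?g \<in> ?S \<rightarrow> ?O"
    by (intro funcsetI vset_open Hom_Sierpinski(1))
  have c: "(\<lambda>u. char_map X (elts u)) \<in> ?O \<rightarrow> ?S"
    by (intro funcsetI char_map_in) (simp add: opens_carrier_iff)
  have "vcomp (vgraph ?S ?g) (char_arr X) = vgraph ?O (\<lambda>u. ?g (char_map X (elts u)))"
    unfolding char_arr_eq by (rule vcomp_vgraph[OF small_opens small_Hom_Sierpinski c])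
  also have "\<dots> = vid ?O"
    unfolding vid_def
  proof (rule vgraph_cong)
    fix u assume u: "u \<in> ?O"
    have "{x \<in> topspace X. app (char_map X (elts u)) x = v1} = elts u"
      using opens_elts_subset[OF u] by (auto simp: char_map_def split: if_splits)
    then show "?g (char_map X (elts u)) = u"
      by simp
  qed
  finally have 1: "vcomp (vgraph ?S ?g) (char_arr X) = vid ?O" .
  have "vcomp (char_arr X) (vgraph ?S ?g) = vgraph ?S (\<lambda>h. char_map X (elts (?g h)))"
    unfolding char_arr_eq by (rule vcomp_vgraph[OF small_Hom_Sierpinski small_opens g])
  also have "\<dots> = vid ?S"
    unfolding vid_def by (rule vgraph_cong) (simp add: Hom_Sierpinski del: Top_cat_simps)
  finally show ?thesis
    using 1 g by (simp add: is_inverse_def vgraph_in_vfuns del: Top_cat_simps)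
qed

lemma is_iso_char_arr: "is_iso Set_cat (carrier (opens X)) (Hom Top_cat X Sierpinski) (char_arr X)"
  using char_arr_inverse char_arr_in by (auto simp: is_iso_def)

lemma inv_char_arr:
  "vcomp (inv_arr Set_cat (carrier (opens X)) (Hom Top_cat X Sierpinski) (char_arr X)) (char_arr X)
     = vid (carrier (opens X))"
proof -
  have "inv_arr Set_cat (carrier (opens X)) (Hom Top_cat X Sierpinski) (char_arr X)
      = vgraph (Hom Top_cat X Sierpinski) (\<lambda>g. vset {x \<in> topspace X. app g x = v1})"
    by (rule inv_arr_eq[OF category_Set _ _ _ char_arr_inverse]) (use char_arr_in in simp_all)
  then show ?thesis
    using char_arr_inverse by (simp add: is_inverse_def)
qed

lemma char_arr_cancel:
  assumes A: "small A" and p: "p \<in> vfuns A (carrier (opens X))" and q: "q \<in> vfuns A (carrier (opens X))"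
    and eq: "vcomp (char_arr X) p = vcomp (char_arr X) q"
  shows "p = q"
proof (rule vfuns_eqI[OF A p q])
  fix x assume x: "x \<in> A"
  have px: "app p x \<in> carrier (opens X)" and qx: "app q x \<in> carrier (opens X)"
    using vfuns_app[OF A p x] vfuns_app[OF A q x] .
  have "char_map X (elts (app p x)) = char_map X (elts (app q x))"
    using arg_cong[OF eq, of "\<lambda>f. app f x"] app_vcomp[OF A small_opens p char_arr_in x]
      app_vcomp[OF A small_opens q char_arr_in x] by (simp add: app_char_arr px qx)
  then have "elts (app p x) = elts (app q x)"
    by (rule char_map_inject[rotated 2]) (use px qx in \<open>simp_all add: opens_carrier_iff\<close>)
  then show "app p x = app q x"
    by (rule elts_inject)
qed

lemma chi_char_arr:
  assumes "x \<in> topspace X"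
  shows "vcomp (chi X x) (char_arr X) = point X x"
  unfolding chi_def point_def vcomp_vgraph_left[OF small_opens small_Hom_Sierpinski char_arr_in]
  by (rule vgraph_cong) (use assms in \<open>simp add: app_char_arr char_map_def\<close>)

lemma point_in: "x \<in> topspace X \<Longrightarrow> point X x \<in> Hom Frm_cat (opens X) two"
  unfolding point_def by (rule vgraph_in_Frm[OF frame_opens small_opens frame_map_point])

lemma app_point [simp]: "u \<in> carrier (opens X) \<Longrightarrow> app (point X x) u = (if x \<in> elts u then v1 else v0)"
  by (simp add: point_def)

lemma vcomp_point:
  assumes "small A" "h \<in> vfuns A (carrier (opens X))"
  shows "vcomp (point X x) h = vgraph A (\<lambda>a. if x \<in> elts (app h a) then v1 else v0)"
  unfolding point_def by (rule vcomp_vgraph_left[OF assms(1) small_opens assms(2)])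

text \<open>A function into \<open>\<Omega> X\<close> is a frame map iff its composites with all points are.\<close>

lemma Frm_opens_iff:
  assumes L: "L \<in> Obj Frm_cat" and h: "h \<in> vfuns (carrier L) (carrier (opens X))"
  shows "h \<in> Hom Frm_cat L (opens X) \<longleftrightarrow> (\<forall>x\<in>topspace X. vcomp (point X x) h \<in> Hom Frm_cat L two)"
proof (intro iffI ballI)
  fix x assume hx: "h \<in> Hom Frm_cat L (opens X)" "x \<in> topspace X"
  show "vcomp (point X x) h \<in> Hom Frm_cat L two"
    by (rule categoryD(2)[OF category_Frm L opens_Frm[OF small_X] two_Frm hx(1) point_in[OF hx(2)],
          unfolded Frm_cat_simps(4)])
next
  assume *: "\<forall>x\<in>topspace X. vcomp (point X x) h \<in> Hom Frm_cat L two"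
  have L': "frame L" "small (carrier L)"
    using L by auto
  have "frame_map L (opens X) (app h)"
  proof (rule frame_map_opensI[OF L'(1)])
    show "app h \<in> carrier L \<rightarrow> carrier (opens X)"
      using vfuns_app[OF L'(2) h] by simp
    fix x assume "x \<in> topspace X"
    then have "frame_map L two (app (vcomp (point X x) h))"
      using * by simp
    then show "frame_map L (two :: 'u gorder) (\<lambda>a. if x \<in> elts (app h a) then v1 else v0)"
      unfolding vcomp_point[OF L'(2) h] frame_map_vgraph[OF L'] .
  qed
  with h show "h \<in> Hom Frm_cat L (opens X)"
    by simp
qed

end

text \<open>Taking inverse images turns the point \<open>y\<close> into the point \<open>f y\<close>.\<close>

lemma preimage_arr_in:
  assumes X: "small (topspace X)" and Y: "small (topspace Y)" and f: "f \<in> Hom Top_cat Y X"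
  shows "preimage_arr X Y f \<in> vfuns (carrier (opens X)) (carrier (opens Y))"
    and "u \<in> carrier (opens X) \<Longrightarrow> elts (app (preimage_arr X Y f) u) = {y \<in> topspace Y. app f y \<in> elts u}"
    and "y \<in> topspace Y \<Longrightarrow> vcomp (point Y y) (preimage_arr X Y f) = point X (app f y)"
proof -
  interpret X: small_space X by unfold_locales fact
  interpret Y: small_space Y by unfold_locales fact
  have op: "openin Y {y \<in> topspace Y. app f y \<in> elts u}" if "u \<in> carrier (opens X)" for u
    using f that unfolding X.opens_carrier_iff by (auto simp: continuous_map_def)
  show in_vfuns: "preimage_arr X Y f \<in> vfuns (carrier (opens X)) (carrier (opens Y))"
    unfolding preimage_arr_def by (rule vgraph_in_vfuns) (use op in auto)
  show el: "elts (app (preimage_arr X Y f) u) = {y \<in> topspace Y. app f y \<in> elts u}"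
    if "u \<in> carrier (opens X)" for u
    using op that by (simp add: preimage_arr_def)
  show "vcomp (point Y y) (preimage_arr X Y f) = point X (app f y)" if "y \<in> topspace Y"
    by (subst Y.vcomp_point[OF X.small_opens in_vfuns], unfold point_def, rule vgraph_cong)
      (use that in \<open>simp add: el\<close>)
qed

section \<open>Concrete SFC-categories\<close>

text \<open>
  All five categories consist of frames with extra structure: arrows are graphs of frame maps,
  composition is composition of graphs, and the underlying-frame functor does nothing to arrows.
\<close>

locale concrete_pfc =
  fixes P :: "('o, 'u::universe) sfc"
  assumes Comp_eq: "Comp (sfc_cat P) = vcomp"
    and O_Obj: "A \<in> Obj (sfc_cat P) \<Longrightarrow> Fobj (sfc_O P) A \<in> Obj Frm_cat"
    and O_arr: "Farr (sfc_O P) A B f = f"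
    and Hom_Frm: "A \<in> Obj (sfc_cat P) \<Longrightarrow> B \<in> Obj (sfc_cat P) \<Longrightarrow> f \<in> Hom (sfc_cat P) A B \<Longrightarrow>
      f \<in> Hom Frm_cat (Fobj (sfc_O P) A) (Fobj (sfc_O P) B)"
    and Idt_eq: "A \<in> Obj (sfc_cat P) \<Longrightarrow> Idt (sfc_cat P) A = vid (carrier (Fobj (sfc_O P) A))"
    and vid_in: "A \<in> Obj (sfc_cat P) \<Longrightarrow> vid (carrier (Fobj (sfc_O P) A)) \<in> Hom (sfc_cat P) A A"
    and comp_in: "A \<in> Obj (sfc_cat P) \<Longrightarrow> B \<in> Obj (sfc_cat P) \<Longrightarrow> D \<in> Obj (sfc_cat P) \<Longrightarrow>
      f \<in> Hom (sfc_cat P) A B \<Longrightarrow> g \<in> Hom (sfc_cat P) B D \<Longrightarrow> vcomp g f \<in> Hom (sfc_cat P) A D"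
    and two_Obj: "sfc_two P \<in> Obj (sfc_cat P)"
    and O_two: "Fobj (sfc_O P) (sfc_two P) = two"
    and iota_eq: "sfc_iota P = Idt Frm_cat two"
begin

abbreviation "\<C> \<equiv> sfc_cat P"
abbreviation "\<O> A \<equiv> Fobj (sfc_O P) A"
abbreviation "\<t> \<equiv> sfc_two P"

lemma frame_O: "A \<in> Obj \<C> \<Longrightarrow> frame (\<O> A)" and small_O [simp]: "A \<in> Obj \<C> \<Longrightarrow> small (carrier (\<O> A))"
  using O_Obj by auto

lemma Hom_vfuns:
  "A \<in> Obj \<C> \<Longrightarrow> B \<in> Obj \<C> \<Longrightarrow> f \<in> Hom \<C> A B \<Longrightarrow> f \<in> vfuns (carrier (\<O> A)) (carrier (\<O> B))"
  using Hom_Frm[of A B f] by simp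

lemma Hom_two_vfuns: "A \<in> Obj \<C> \<Longrightarrow> f \<in> Hom \<C> A \<t> \<Longrightarrow> f \<in> vfuns (carrier (\<O> A)) {v0, v1}"
  using Hom_vfuns[OF _ two_Obj] by (simp add: O_two)

lemma app_two: "A \<in> Obj \<C> \<Longrightarrow> f \<in> Hom \<C> A \<t> \<Longrightarrow> a \<in> carrier (\<O> A) \<Longrightarrow> app f a = v0 \<or> app f a = v1"
  using vfuns_app[OF small_O Hom_two_vfuns] by blast

lemma category_C: "category \<C>"
  by (rule categoryI[where U = "\<lambda>A. carrier (\<O> A)"])
    (auto simp: Comp_eq Idt_eq vid_in comp_in Hom_vfuns)

lemma und_simps [simp]: "Fobj (und P) A = carrier (\<O> A)" "Farr (und P) A B f = f"
  by (simp_all add: und_def comp_func_def forget_def O_arr)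

lemma is_pfc: "is_pfc P"
  unfolding is_pfc_def
proof (intro conjI category_C two_Obj)
  show "is_functor \<C> Frm_cat (sfc_O P)"
    using O_Obj Hom_Frm by (simp add: is_functor_def O_arr Comp_eq Idt_eq)
  show "faithful \<C> (sfc_O P)"
    by (simp add: faithful_def O_arr inj_on_def)
  show "is_iso Frm_cat (\<O> \<t>) two (sfc_iota P)"
    unfolding O_two iota_eq by (rule is_iso_Idt[OF category_Frm two_Frm])
qed

lemma inv_iota: "inv_arr Frm_cat two two (Idt Frm_cat two) = Idt Frm_cat two"
  by (rule inv_arr_eq[OF category_Frm two_Frm two_Frm categoryD(1)[OF category_Frm two_Frm]
        is_inverse_Idt[OF category_Frm two_Frm]])

lemma point_arr_eq:
  assumes "small (topspace X)" "x \<in> topspace X"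
  shows "point_arr P X x = chi X x"
proof -
  interpret small_space X by unfold_locales fact
  have "chi X x \<in> vfuns (Hom Top_cat X Sierpinski) (carrier two)"
    unfolding chi_def
  proof (rule vgraph_in_vfuns, rule funcsetI)
    fix g :: 'u assume "g \<in> Hom Top_cat X Sierpinski"
    then show "app g x \<in> carrier two"
      using vfuns_app[OF assms(1) _ assms(2), of g "{v0, v1}"] by simp
  qed
  then show ?thesis
    unfolding point_arr_def O_two iota_eq inv_iota
    by (simp add: vcomp_vid_left[OF small_Hom_Sierpinski] del: Top_cat_simps)
qed

text \<open>The basic open set of the spectrum of \<open>C\<close> given by \<open>a\<close>: the points of \<open>C\<close> that contain \<open>a\<close>.\<close>

definition sigma :: "'o \<Rightarrow> 'u \<Rightarrow> 'u set" where
  "sigma C a = {f \<in> Hom \<C> C \<t>. app f a = v1}"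

lemma small_Hom_two [simp]: "C \<in> Obj \<C> \<Longrightarrow> small (Hom \<C> C \<t>)"
  by (rule small_subset[OF small_vfuns[OF small_O small_v01]]) (use Hom_two_vfuns in auto)

lemma pt_space_eq:
  assumes C: "C \<in> Obj \<C>"
  shows "pt_space P C = hom_space (Hom \<C> C \<t>) (carrier (\<O> C))"
proof -
  have "{f \<in> Hom \<C> C \<t>. app (sfc_iota P) (app (Farr (sfc_O P) C \<t> f) a) = v1} = sigma C a"
    if "a \<in> carrier (\<O> C)" for a
    using app_two[OF C _ that] unfolding iota_eq by (auto simp: O_arr sigma_def)
  then show ?thesis
    unfolding pt_space_def hom_space_def by (simp add: sigma_def cong: bex_cong)
qed

text \<open>As the points are frame maps, the sets \<open>sigma C a\<close> are all the open sets.\<close>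

lemma openin_pt_space:
  assumes C: "C \<in> Obj \<C>"
  shows "openin (pt_space P C) W \<longleftrightarrow> (\<exists>a\<in>carrier (\<O> C). W = sigma C a)"
proof -
  interpret L: frm "\<O> C" by unfold_locales (rule frame_O[OF C])
  let ?op = "\<lambda>W. \<exists>a\<in>carrier (\<O> C). W = sigma C a"
  have fm: "frame_map (\<O> C) two (app f)" if "f \<in> Hom \<C> C \<t>" for f
    using Hom_Frm[OF C two_Obj that] by (simp add: O_two)
  note fm = fm[unfolded frame_map_two_iff[OF frame_O[OF C]]]
  have "istopology ?op"
    unfolding istopology_def
  proof (intro conjI allI impI)
    fix S T assume "?op S" "?op T"
    then obtain a b where "a \<in> carrier (\<O> C)" "b \<in> carrier (\<O> C)" "S = sigma C a" "T = sigma C b"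
      by blast
    then show "?op (S \<inter> T)"
      using fm by (intro bexI[of _ "a \<sqinter>\<^bsub>\<O> C\<^esub> b"]) (auto simp: sigma_def)
  next
    fix \<K> assume K: "\<forall>K\<in>\<K>. ?op K"
    let ?A = "{a \<in> carrier (\<O> C). sigma C a \<in> \<K>}"
    have A: "?A \<subseteq> carrier (\<O> C)"
      by blast
    have "sigma C (\<Squnion>\<^bsub>\<O> C\<^esub> ?A) = (\<Union>a\<in>?A. sigma C a)"
      using fm A by (auto simp: sigma_def)
    also have "\<dots> = \<Union>\<K>"
    proof (rule subset_antisym)
      show "\<Union>\<K> \<subseteq> (\<Union>a\<in>?A. sigma C a)"
      proof
        fix f assume "f \<in> \<Union>\<K>"
        then obtain W where W: "W \<in> \<K>" "f \<in> W" ..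
        then obtain a where "a \<in> carrier (\<O> C)" "W = sigma C a"
          using K by meson
        with W show "f \<in> (\<Union>a\<in>?A. sigma C a)"
          by auto
      qed
    qed auto
    finally show "?op (\<Union>\<K>)"
      using L.sup_closed[OF A] by blast
  qed
  then show ?thesis
    unfolding pt_space_eq[OF C] hom_space_def sigma_def by (simp add: topology_inverse')
qed

lemma topspace_pt_space [simp]:
  assumes C: "C \<in> Obj \<C>"
  shows "topspace (pt_space P C) = Hom \<C> C \<t>"
proof -
  interpret L: frm "\<O> C" by unfold_locales (rule frame_O[OF C])
  have "sigma C (\<top>\<^bsub>\<O> C\<^esub>) = Hom \<C> C \<t>"
    using Hom_Frm[OF C two_Obj] by (auto simp: sigma_def O_two frame_map_two_iff[OF frame_O[OF C]])
  moreover have "sigma C a \<subseteq> Hom \<C> C \<t>" for a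
    by (auto simp: sigma_def)
  ultimately show ?thesis
    unfolding topspace_def openin_pt_space[OF C] using L.top_closed by blast
qed

lemma small_pt_space: "C \<in> Obj \<C> \<Longrightarrow> small_space (pt_space P C)"
  by unfold_locales simp

text \<open>
  Any cartesian lift of the family of points of \<open>X\<close> is isomorphic, as a frame, to \<open>\<Omega> X\<close>. The lifting
  property applied to the identity shows that the points of \<open>X\<close> become arrows to \<open>2\<close>; hence the
  bijection with \<open>\<Omega> X\<close> is a frame map.
\<close>

lemma sfc_lift_frame:
  assumes X: "small (topspace X)" and lift: "is_sfc_lift P X Y t"
  shows "Y \<in> Obj \<C> \<and> (\<exists>g\<in>Hom Frm_cat (\<O> Y) (opens X).
    bij_betw (app g) (carrier (\<O> Y)) (carrier (opens X)) \<and>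
    (\<forall>x\<in>topspace X. vcomp (point X x) g \<in> Hom \<C> Y \<t>))"
proof -
  interpret small_space X by unfold_locales fact
  let ?S = "Hom Top_cat X Sierpinski"
  let ?c = "\<lambda>g. vset {x \<in> topspace X. app g x = v1}"
  let ?g = "vcomp (vgraph ?S ?c) t"
  note lift = lift[unfolded is_sfc_lift_def cartesian_lift_def]
  have Y: "Y \<in> Obj \<C>"
    using lift by simp
  obtain s where t: "t \<in> vfuns (carrier (\<O> Y)) ?S" and s: "s \<in> vfuns ?S (carrier (\<O> Y))"
    "vcomp s t = vid (carrier (\<O> Y))" "vcomp t s = vid ?S"
    using lift by (auto simp: is_iso_def is_inverse_def simp del: Top_cat_simps)
  note inv = char_arr_inverse[unfolded is_inverse_def]
  have c: "vgraph ?S ?c \<in> vfuns ?S (carrier (opens X))"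
    using inv by simp
  have g: "?g \<in> vfuns (carrier (\<O> Y)) (carrier (opens X))"
    by (rule vcomp_in_vfuns[OF small_O[OF Y] small_Hom_Sierpinski t c])
  have "vcomp (char_arr X) ?g = vcomp (vcomp (char_arr X) (vgraph ?S ?c)) t"
    by (rule vcomp_assoc[OF small_O[OF Y] small_Hom_Sierpinski small_opens t c char_arr_in])
  also have "vcomp (char_arr X) (vgraph ?S ?c) = vid ?S"
    using inv by simp
  also have "vcomp (vid ?S) t = t"
    by (rule vcomp_vid_left[OF small_O[OF Y] small_Hom_Sierpinski t])
  finally have cg: "vcomp (char_arr X) ?g = t" .
  have "vcomp (point X x) ?g \<in> Hom \<C> Y \<t>" if x: "x \<in> topspace X" for x
  proof -
    have vid: "vid (carrier (\<O> Y)) \<in> vfuns (carrier (\<O> Y)) (carrier (\<O> Y))"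
      by (rule vid_in_vfuns) simp
    have "lifts \<C> (und P) Y Y (vid (carrier (\<O> Y)))"
      using vid_in[OF Y] by (simp add: lifts_def)
    then have "lifts \<C> (und P) Y \<t> (vcomp (vcomp (point_arr P X x) t) (vid (carrier (\<O> Y))))"
      using lift Y vid x by simp
    then have "vcomp (vcomp (chi X x) t) (vid (carrier (\<O> Y))) \<in> Hom \<C> Y \<t>"
      by (simp add: lifts_def point_arr_eq[OF X x])
    moreover have chi: "chi X x \<in> vfuns ?S UNIV"
      unfolding chi_def by (rule vgraph_in_vfuns) simp
    moreover have "vcomp (vcomp (chi X x) t) (vid (carrier (\<O> Y))) = vcomp (chi X x) t"
      by (rule vcomp_vid_right[OF small_O[OF Y] vcomp_in_vfuns[OF small_O[OF Y] small_Hom_Sierpinski t chi]])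
    moreover have "vcomp (chi X x) t = vcomp (point X x) ?g"
      unfolding chi_char_arr[OF x, symmetric]
      using vcomp_assoc[OF small_O[OF Y] small_opens small_Hom_Sierpinski g char_arr_in chi] cg by simp
    ultimately show ?thesis
      by simp
  qed
  note pts = this
  have "?g \<in> Hom Frm_cat (\<O> Y) (opens X)"
    unfolding Frm_opens_iff[OF O_Obj[OF Y] g] using pts Hom_Frm[OF Y two_Obj] by (simp add: O_two)
  moreover have "bij_betw (app ?g) (carrier (\<O> Y)) (carrier (opens X))"
  proof (rule bij_betw_byWitness[where f' = "\<lambda>u. app s (app (char_arr X) u)"])
    show "\<forall>a\<in>carrier (\<O> Y). app s (app (char_arr X) (app ?g a)) = a"
    proof
      fix a assume a: "a \<in> carrier (\<O> Y)"
      have "app (char_arr X) (app ?g a) = app t a"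
        using app_vcomp[OF small_O[OF Y] small_opens g char_arr_in a] cg by simp
      then show "app s (app (char_arr X) (app ?g a)) = a"
        using app_vcomp[OF small_O[OF Y] small_Hom_Sierpinski t s(1) a] s(2) Y a by simp
    qed
    show "\<forall>u\<in>carrier (opens X). app ?g (app s (app (char_arr X) u)) = u"
    proof
      fix u assume u: "u \<in> carrier (opens X)"
      have h: "app (char_arr X) u \<in> ?S"
        by (rule vfuns_app[OF small_opens char_arr_in u])
      have "app t (app s (app (char_arr X) u)) = app (char_arr X) u"
        using app_vcomp[OF small_Hom_Sierpinski small_O[OF Y] s(1) t h] s(3)
          app_vid[OF small_Hom_Sierpinski h] by simp
      then have "app ?g (app s (app (char_arr X) u)) = app (vgraph ?S ?c) (app (char_arr X) u)"
        using app_vcomp[OF small_O[OF Y] small_Hom_Sierpinski t c vfuns_app[OF small_Hom_Sierpinski s(1) h]]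
        by simp
      also have "\<dots> = u"
        using app_vcomp[OF small_opens small_Hom_Sierpinski char_arr_in c u] inv u by simp
      finally show "app ?g (app s (app (char_arr X) u)) = u" .
    qed
    show "app ?g ` carrier (\<O> Y) \<subseteq> carrier (opens X)"
      using vfuns_app[OF small_O[OF Y] g] by blast
    show "(\<lambda>u. app s (app (char_arr X) u)) ` carrier (opens X) \<subseteq> carrier (\<O> Y)"
      using vfuns_app[OF small_Hom_Sierpinski s(1) vfuns_app[OF small_opens char_arr_in]] by blast
  qed
  ultimately show ?thesis
    using Y pts by blast
qed

end

text \<open>
  The spaces \<open>K\<close> of \<open>Top\<^sub>C\<close> and the lifts \<open>\<Omega>\<^sub>C X\<close>: an arrow to \<open>\<Omega>\<^sub>C X\<close> is a frame map to \<open>\<Omega> X\<close> whose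
  composites with the points of \<open>X\<close> are arrows. The assumption \<open>K_if\<close> says that \<open>K\<close> is large
  enough: by \<open>sfc_lift_frame\<close> it applies to every space that has a cartesian lift.
\<close>

locale concrete_sfc = concrete_pfc P for P :: "('o, 'u::universe) sfc" +
  fixes K :: "'u topology set"
  assumes K_small: "X \<in> K \<Longrightarrow> small (topspace X)"
    and lift_Obj: "X \<in> K \<Longrightarrow> lift_ob P X \<in> Obj (sfc_cat P)"
    and O_lift: "X \<in> K \<Longrightarrow> Fobj (sfc_O P) (lift_ob P X) = opens X"
    and lift_arr_eq: "lift_arr P = char_arr"
    and Hom_lift: "X \<in> K \<Longrightarrow> D \<in> Obj (sfc_cat P) \<Longrightarrow> h \<in> Hom Frm_cat (Fobj (sfc_O P) D) (opens X) \<Longrightarrow>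
      h \<in> Hom (sfc_cat P) D (lift_ob P X) \<longleftrightarrow>
        (\<forall>x\<in>topspace X. vcomp (point X x) h \<in> Hom (sfc_cat P) D (sfc_two P))"
    and K_if: "small (topspace X) \<Longrightarrow> Y \<in> Obj (sfc_cat P) \<Longrightarrow>
      g \<in> Hom Frm_cat (Fobj (sfc_O P) Y) (opens X) \<Longrightarrow>
      bij_betw (app g) (carrier (Fobj (sfc_O P) Y)) (carrier (opens X)) \<Longrightarrow>
      (\<And>x. x \<in> topspace X \<Longrightarrow> vcomp (point X x) g \<in> Hom (sfc_cat P) Y (sfc_two P)) \<Longrightarrow> X \<in> K"
    and Sierpinski_K: "Sierpinski \<in> K"
    and pt_K: "C \<in> Obj (sfc_cat P) \<Longrightarrow> pt_space P C \<in> K"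
begin

lemma space: "X \<in> K \<Longrightarrow> small_space X"
  by unfold_locales (rule K_small)

lemma Hom_lift_iff:
  assumes X: "X \<in> K" and D: "D \<in> Obj \<C>" and h: "h \<in> vfuns (carrier (\<O> D)) (carrier (opens X))"
  shows "h \<in> Hom \<C> D (lift_ob P X) \<longleftrightarrow> (\<forall>x\<in>topspace X. vcomp (point X x) h \<in> Hom \<C> D \<t>)"
proof -
  interpret small_space X by (rule space[OF X])
  have "h \<in> Hom Frm_cat (\<O> D) (opens X)" if "h \<in> Hom \<C> D (lift_ob P X)"
    using Hom_Frm[OF D lift_Obj[OF X] that] by (simp add: O_lift[OF X])
  moreover have "h \<in> Hom Frm_cat (\<O> D) (opens X)" if "\<forall>x\<in>topspace X. vcomp (point X x) h \<in> Hom \<C> D \<t>"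
    unfolding Frm_opens_iff[OF O_Obj[OF D] h] using that Hom_Frm[OF D two_Obj] by (simp add: O_two)
  ultimately show ?thesis
    using Hom_lift[OF X D] by blast
qed

lemma is_sfc_lift:
  assumes X: "X \<in> K"
  shows "is_sfc_lift P X (lift_ob P X) (char_arr X)"
proof -
  interpret small_space X by (rule space[OF X])
  have "vcomp (vcomp (point_arr P X x) (char_arr X)) h = vcomp (point X x) h"
    if "x \<in> topspace X" for x h
    by (simp add: point_arr_eq[OF K_small[OF X] that] chi_char_arr[OF that])
  then show ?thesis
    unfolding is_sfc_lift_def cartesian_lift_def
    using lift_Obj[OF X] is_iso_char_arr Hom_lift_iff[OF X]
    by (simp add: O_lift[OF X] lifts_def del: Top_cat_simps)
qed

lemma Top_of_eq: "Top_of P = full_subcat Top_cat K"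
proof -
  have *: "(\<exists>Y t. is_sfc_lift P X Y t) \<longleftrightarrow> X \<in> K" if X: "small (topspace X)" for X
  proof
    assume "\<exists>Y t. is_sfc_lift P X Y t"
    then show "X \<in> K"
      using sfc_lift_frame[OF X] K_if[OF X] by metis
  next
    assume "X \<in> K"
    then show "\<exists>Y t. is_sfc_lift P X Y t"
      using is_sfc_lift by metis
  qed
  have "Obj Top_cat \<inter> {X. \<exists>Y t. is_sfc_lift P X Y t} = Obj Top_cat \<inter> K"
    unfolding Int_def mem_Collect_eq by (intro Collect_cong conj_cong refl *) simp
  then show ?thesis
    by (simp only: Top_of_def full_subcat_def)
qed

lemma Obj_Top_of: "X \<in> Obj (Top_of P) \<longleftrightarrow> X \<in> K"
  using K_small by (auto simp: Top_of_eq full_subcat_def)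

lemma is_sfc: "is_sfc P"
  using is_pfc Sierpinski_K pt_K is_sfc_lift
  by (simp add: is_sfc_def Ball_def Obj_Top_of lift_arr_eq)

subsection \<open>The dual adjunction\<close>

text \<open>The unit of the dual adjunction sends \<open>a\<close> to the open set of points containing \<open>a\<close>.\<close>

definition unit_arr :: "'o \<Rightarrow> 'u" where
  "unit_arr C = vgraph (carrier (\<O> C)) (\<lambda>a. vset (sigma C a))"

text \<open>The counit sends \<open>x\<close> to the point \<open>\<Omega>\<^sub>C X \<rightarrow> 2\<close> that it defines.\<close>

definition counit_arr :: "'u topology \<Rightarrow> 'u" where
  "counit_arr X = vgraph (topspace X) (point X)"

text \<open>The action of the spectrum on arrows \<open>A \<rightarrow> B\<close> is precomposition.\<close>

definition pt_arr :: "'o \<Rightarrow> 'o \<Rightarrow> 'u \<Rightarrow> 'u" where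
  "pt_arr A B f = vgraph (Hom \<C> B \<t>) (\<lambda>g. vcomp g f)"

lemma mem_sigma: "f \<in> sigma C a \<longleftrightarrow> f \<in> Hom \<C> C \<t> \<and> app f a = v1"
  by (simp add: sigma_def)

lemma if_v01: "a = v0 \<or> a = v1 \<Longrightarrow> (if a = v1 then v1 else v0) = a"
  by auto

lemma sigma_open: "C \<in> Obj \<C> \<Longrightarrow> a \<in> carrier (\<O> C) \<Longrightarrow> openin (pt_space P C) (sigma C a)"
  using openin_pt_space by blast

lemma opens_pt_space:
  assumes C: "C \<in> Obj \<C>"
  shows "u \<in> carrier (opens (pt_space P C)) \<longleftrightarrow> (\<exists>a\<in>carrier (\<O> C). u = vset (sigma C a))"
proof -
  interpret small_space "pt_space P C" by (rule small_pt_space[OF C])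
  show ?thesis
    using sigma_open[OF C] openin_pt_space[OF C] unfolding opens_carrier_iff
    by (metis elts_vset_open vset_elts)
qed

lemma elts_sigma [simp]: "C \<in> Obj \<C> \<Longrightarrow> a \<in> carrier (\<O> C) \<Longrightarrow> elts (vset (sigma C a)) = sigma C a"
  by (rule small_space.elts_vset_open[OF small_pt_space sigma_open])

lemma unit_vfuns: "C \<in> Obj \<C> \<Longrightarrow> unit_arr C \<in> vfuns (carrier (\<O> C)) (carrier (opens (pt_space P C)))"
  unfolding unit_arr_def by (rule vgraph_in_vfuns) (use opens_pt_space in blast)

lemma app_unit [simp]: "C \<in> Obj \<C> \<Longrightarrow> a \<in> carrier (\<O> C) \<Longrightarrow> app (unit_arr C) a = vset (sigma C a)"
  by (simp add: unit_arr_def)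

text \<open>Every point of \<open>C\<close> factors through the unit; this is one of the triangle identities.\<close>

lemma point_unit:
  assumes C: "C \<in> Obj \<C>" and f: "f \<in> Hom \<C> C \<t>"
  shows "vcomp (point (pt_space P C) f) (unit_arr C) = f"
proof -
  interpret small_space "pt_space P C" by (rule small_pt_space[OF C])
  have "vcomp (point (pt_space P C) f) (unit_arr C) = vgraph (carrier (\<O> C)) (app f)"
    unfolding vcomp_point[OF small_O[OF C] unit_vfuns[OF C]]
    by (rule vgraph_cong) (use C f app_two[OF C f] in \<open>simp add: mem_sigma if_v01\<close>)
  then show ?thesis
    by (simp add: vfuns_vgraph[OF small_O[OF C] Hom_two_vfuns[OF C f]])
qed

lemma unit_in:
  assumes C: "C \<in> Obj \<C>"
  shows "unit_arr C \<in> Hom \<C> C (lift_ob P (pt_space P C))"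
  unfolding Hom_lift_iff[OF pt_K[OF C] C unit_vfuns[OF C]]
  using point_unit[OF C] by (simp add: C)

lemma dual_unit_eq:
  assumes C: "C \<in> Obj \<C>"
  shows "dual_unit P C = unit_arr C"
proof -
  interpret small_space "pt_space P C" by (rule small_pt_space[OF C])
  let ?X = "pt_space P C"
  let ?e = "vgraph (carrier (\<O> C)) (\<lambda>a. vgraph (Hom \<C> C \<t>)
     (\<lambda>f. app (sfc_iota P) (app (Farr (sfc_O P) C \<t> f) a)))"
  have e: "vcomp (char_arr ?X) (unit_arr C) = ?e"
  proof -
    have "vcomp (char_arr ?X) (unit_arr C) = vgraph (carrier (\<O> C)) (\<lambda>a. char_map ?X (elts (app (unit_arr C) a)))"
      unfolding char_arr_eq by (rule vcomp_vgraph_left[OF small_O[OF C] small_opens unit_vfuns[OF C]])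
    also have "\<dots> = ?e"
    proof (rule vgraph_cong)
      fix a assume a: "a \<in> carrier (\<O> C)"
      show "char_map ?X (elts (app (unit_arr C) a))
        = vgraph (Hom \<C> C \<t>) (\<lambda>f. app (sfc_iota P) (app (Farr (sfc_O P) C \<t> f) a))"
        unfolding char_map_def topspace_pt_space[OF C]
        by (rule vgraph_cong) (use C a app_two[OF C _ a] in \<open>simp add: mem_sigma if_v01 O_arr iota_eq\<close>)
    qed
    finally show ?thesis .
  qed
  show ?thesis
    unfolding dual_unit_def lift_arr_eq und_simps Set_cat_simps
  proof (rule the_equality)
    show "unit_arr C \<in> Hom \<C> C (lift_ob P ?X) \<and> vcomp (char_arr ?X) (unit_arr C) = ?e"
      using unit_in[OF C] e by simp
    fix p assume p: "p \<in> Hom \<C> C (lift_ob P ?X) \<and> vcomp (char_arr ?X) p = ?e"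
    then have "p \<in> vfuns (carrier (\<O> C)) (carrier (opens ?X))"
      using Hom_vfuns[OF C lift_Obj[OF pt_K[OF C]]] by (simp add: O_lift[OF pt_K[OF C]])
    then show "p = unit_arr C"
      by (rule char_arr_cancel[OF small_O[OF C] _ unit_vfuns[OF C]]) (use p e in simp)
  qed
qed

lemma point_Hom:
  assumes X: "X \<in> K" and x: "x \<in> topspace X"
  shows "point X x \<in> Hom \<C> (lift_ob P X) \<t>"
proof -
  interpret small_space X by (rule space[OF X])
  have vid: "vid (carrier (opens X)) \<in> Hom \<C> (lift_ob P X) (lift_ob P X)"
    using vid_in[OF lift_Obj[OF X]] by (simp add: O_lift[OF X])
  have "vid (carrier (opens X)) \<in> vfuns (carrier (\<O> (lift_ob P X))) (carrier (opens X))"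
    by (simp add: O_lift[OF X] vid_in_vfuns)
  then have "vcomp (point X x) (vid (carrier (opens X))) \<in> Hom \<C> (lift_ob P X) \<t>"
    using Hom_lift_iff[OF X lift_Obj[OF X]] vid x by blast
  moreover have "point X x \<in> vfuns (carrier (opens X)) (carrier two)"
    using point_in[OF x] by simp
  ultimately show ?thesis
    by (simp only: vcomp_vid_right[OF small_opens])
qed

lemma dual_counit_eq:
  assumes X: "X \<in> K"
  shows "dual_counit P X = counit_arr X"
  unfolding dual_counit_def counit_arr_def
proof (rule vgraph_cong)
  interpret small_space X by (rule space[OF X])
  fix x assume x: "x \<in> topspace X"
  show "(THE f. f \<in> Hom \<C> (lift_ob P X) \<t> \<and> Farr (und P) (lift_ob P X) \<t> f =
      point_arr P X x \<cdot>\<^bsub>Set_cat\<^esub> lift_arr P X) = point X x"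
    by (rule the_equality)
      (use point_Hom[OF X x] in
        \<open>simp_all add: point_arr_eq[OF K_small[OF X] x] lift_arr_eq chi_char_arr[OF x]\<close>)
qed

lemma app_counit [simp]: "X \<in> K \<Longrightarrow> x \<in> topspace X \<Longrightarrow> app (counit_arr X) x = point X x"
  by (simp add: counit_arr_def K_small)

lemma counit_in:
  assumes X: "X \<in> K"
  shows "counit_arr X \<in> Hom Top_cat X (pt_space P (lift_ob P X))"
  unfolding counit_arr_def
proof (rule vgraph_in_Top[OF K_small[OF X]])
  interpret small_space X by (rule space[OF X])
  let ?L = "lift_ob P X"
  note L = lift_Obj[OF X]
  have "openin X {x \<in> topspace X. point X x \<in> sigma ?L u}" if u: "u \<in> carrier (opens X)" for u
  proof -
    have "{x \<in> topspace X. point X x \<in> sigma ?L u} = elts u"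
      using point_Hom[OF X] opens_elts_subset[OF u] u by (auto simp: sigma_def split: if_splits)
    then show ?thesis
      using u by (simp add: opens_carrier_iff)
  qed
  then show "continuous_map X (pt_space P ?L) (point X)"
    unfolding continuous_map_def openin_pt_space[OF L] topspace_pt_space[OF L] O_lift[OF X]
    using point_Hom[OF X] by auto
qed

lemma preimage_Hom:
  assumes X: "X \<in> K" and Y: "Y \<in> K" and f: "f \<in> Hom Top_cat Y X"
  shows "preimage_arr X Y f \<in> Hom \<C> (lift_ob P X) (lift_ob P Y)"
proof -
  note XY = K_small[OF X] K_small[OF Y]
  have "app f y \<in> topspace X" if "y \<in> topspace Y" for y
    using vfuns_app[OF XY(2) _ that, of f "topspace X"] f by simp
  moreover have "preimage_arr X Y f \<in> vfuns (carrier (\<O> (lift_ob P X))) (carrier (opens Y))"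
    using preimage_arr_in(1)[OF XY f] by (simp add: O_lift[OF X])
  ultimately show ?thesis
    using Hom_lift_iff[OF Y lift_Obj[OF X]] preimage_arr_in(3)[OF XY f] point_Hom[OF X] by simp
qed

lemma Omega_func_Fobj [simp]: "Fobj (Omega_func P) X = lift_ob P X"
  by (simp add: Omega_func_def)

lemma Omega_func_arr:
  assumes X: "X \<in> K" and Y: "Y \<in> K" and f: "f \<in> Hom Top_cat Y X"
  shows "Farr (Omega_func P) X Y f = preimage_arr X Y f"
proof -
  interpret X: small_space X by (rule space[OF X])
  interpret Y: small_space Y by (rule space[OF Y])
  note XY = K_small[OF X] K_small[OF Y]
  let ?p = "preimage_arr X Y f"
  let ?rhs = "vcomp (vgraph (Hom Top_cat X Sierpinski) (\<lambda>g. vcomp g f)) (char_arr X)"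
  note p = preimage_arr_in[OF XY f]
  have fv: "f \<in> vfuns (topspace Y) (topspace X)"
    using f by simp
  have "vcomp (char_arr Y) ?p = vgraph (carrier (opens X)) (\<lambda>u. char_map Y (elts (app ?p u)))"
    unfolding Y.char_arr_eq by (rule vcomp_vgraph_left[OF X.small_opens Y.small_opens p(1)])
  also have "\<dots> = vgraph (carrier (opens X)) (\<lambda>u. vcomp (app (char_arr X) u) f)"
  proof (rule vgraph_cong)
    fix u assume u: "u \<in> carrier (opens X)"
    have "vcomp (char_map X (elts u)) f = vgraph (topspace Y) (\<lambda>y. if app f y \<in> elts u then v1 else v0)"
      unfolding char_map_def by (rule vcomp_vgraph_left[OF XY(2,1) fv])
    also have "\<dots> = char_map Y (elts (app ?p u))"
      unfolding char_map_def by (rule vgraph_cong) (simp add: p(2)[OF u])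
    finally show "char_map Y (elts (app ?p u)) = vcomp (app (char_arr X) u) f"
      by (simp add: X.app_char_arr[OF u])
  qed
  also have "\<dots> = ?rhs"
    by (rule vcomp_vgraph_left[OF X.small_opens X.small_Hom_Sierpinski X.char_arr_in, symmetric])
  finally have eq: "vcomp (char_arr Y) ?p = ?rhs" .
  have "(THE p. p \<in> Hom \<C> (lift_ob P X) (lift_ob P Y) \<and> vcomp (char_arr Y) p = ?rhs) = ?p"
  proof (rule the_equality)
    show "?p \<in> Hom \<C> (lift_ob P X) (lift_ob P Y) \<and> vcomp (char_arr Y) ?p = ?rhs"
      using preimage_Hom[OF X Y f] eq by simp
    fix q assume q: "q \<in> Hom \<C> (lift_ob P X) (lift_ob P Y) \<and> vcomp (char_arr Y) q = ?rhs"
    then have "q \<in> vfuns (carrier (opens X)) (carrier (opens Y))"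
      using Hom_vfuns[OF lift_Obj[OF X] lift_Obj[OF Y]] by (simp add: O_lift[OF X] O_lift[OF Y])
    then show "q = ?p"
      by (rule Y.char_arr_cancel[OF X.small_opens _ p(1)]) (use q eq in simp)
  qed
  then show ?thesis
    by (simp add: Omega_func_def lift_arr_eq del: Top_cat_simps(2))
qed

lemma pt_func_Fobj [simp]: "Fobj (pt_func P) C = pt_space P C"
  by (simp add: pt_func_def)

lemma pt_func_arr [simp]: "Farr (pt_func P) A B f = pt_arr A B f"
  by (simp add: pt_func_def pt_arr_def Comp_eq)

lemma app_pt_arr [simp]: "B \<in> Obj \<C> \<Longrightarrow> g \<in> Hom \<C> B \<t> \<Longrightarrow> app (pt_arr A B f) g = vcomp g f"
  by (simp add: pt_arr_def)

lemma pt_arr_in: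
  assumes A: "A \<in> Obj \<C>" and B: "B \<in> Obj \<C>" and f: "f \<in> Hom \<C> A B"
  shows "pt_arr A B f \<in> Hom Top_cat (pt_space P B) (pt_space P A)"
  unfolding pt_arr_def topspace_pt_space[OF B, symmetric]
proof (rule vgraph_in_Top)
  show "small (topspace (pt_space P B))"
    by (simp add: B)
  note fv = Hom_vfuns[OF A B f]
  have "{g \<in> Hom \<C> B \<t>. vcomp g f \<in> sigma A a} = sigma B (app f a)" if a: "a \<in> carrier (\<O> A)" for a
    using comp_in[OF A B two_Obj f] app_vcomp[OF small_O[OF A] small_O[OF B] fv Hom_two_vfuns[OF B] a]
    by (auto simp: sigma_def)
  moreover have "app f a \<in> carrier (\<O> B)" if "a \<in> carrier (\<O> A)" for a
    by (rule vfuns_app[OF small_O[OF A] fv that])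
  ultimately show "continuous_map (pt_space P B) (pt_space P A) (\<lambda>g. vcomp g f)"
    unfolding continuous_map_def openin_pt_space[OF A] topspace_pt_space[OF A] topspace_pt_space[OF B]
    using comp_in[OF A B two_Obj f] sigma_open[OF B] by auto
qed

end

abbreviation op_Top :: "'u::universe topology set \<Rightarrow> ('u topology, 'u) cat" where
  "op_Top T \<equiv> op_cat (full_subcat Top_cat T)"

text \<open>
  The dual adjunction, with the spaces restricted to a class \<open>T\<close> that contains the spectra of all
  objects.
\<close>

definition Dual_on :: "('o, 'u::universe) sfc \<Rightarrow> 'u topology set \<Rightarrow> ('o, 'u, 'u topology, 'u) adj" where
  "Dual_on P T = Dual P\<lparr>Rcat := op_Top T\<rparr>"

lemma Dual_on_simps [simp]:
  "Lcat (Dual_on P T) = sfc_cat P" "Rcat (Dual_on P T) = op_Top T"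
  "Ladj (Dual_on P T) = pt_func P" "Radj (Dual_on P T) = Omega_func P"
  "Aunit (Dual_on P T) = dual_unit P" "Acounit (Dual_on P T) = dual_counit P"
  by (simp_all add: Dual_on_def Dual_def)

lemma op_Top_simps [simp]:
  "X \<in> Obj (op_Top T) \<longleftrightarrow> small (topspace X) \<and> X \<in> T"
  "Hom (op_Top T) X Y = Hom Top_cat Y X"
  "Idt (op_Top T) X = vid (topspace X)"
  "Comp (op_Top T) g f = vcomp f g"
  by (simp_all add: op_cat_def full_subcat_def)

lemma incl_simps [simp]: "Fobj incl A = A" "Farr incl A B f = f"
  by (simp_all add: incl_def)

lemma comp_func_simps [simp]:
  "Fobj (G \<circ>\<^sub>F F) A = Fobj G (Fobj F A)"
  "Farr (G \<circ>\<^sub>F F) A B f = Farr G (Fobj F A) (Fobj F B) (Farr F A B f)"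
  by (simp_all add: comp_func_def)

lemma category_op_Top: "category (op_Top T)"
  by (rule category_op[OF category_full_subcat[OF category_Top]])

context concrete_sfc
begin

lemma Dual_eq_Dual_on: "Dual P = Dual_on P K"
  by (simp add: Dual_on_def Dual_def Top_of_eq)

lemma T0_part_Dual_eq: "T0_part (Dual P) = Dual_on P {X \<in> K. t0_space X}"
proof -
  have "Obj Top_cat \<inter> K \<inter> {X. t0_space X} = Obj Top_cat \<inter> {X \<in> K. t0_space X}"
    by auto
  then show ?thesis
    by (simp add: T0_part_def Dual_on_def Dual_def Top_of_eq full_subcat_def op_cat_def)
qed

lemma pt_functor:
  assumes T: "\<And>C. C \<in> Obj \<C> \<Longrightarrow> pt_space P C \<in> T"
  shows "is_functor \<C> (op_Top T) (pt_func P)"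
  unfolding is_functor_def
proof (intro conjI ballI)
  fix A assume A: "A \<in> Obj \<C>"
  show "Fobj (pt_func P) A \<in> Obj (op_Top T)"
    by (simp add: A T)
  have "vcomp g (vid (carrier (\<O> A))) = g" if "g \<in> Hom \<C> A \<t>" for g
    by (rule vcomp_vid_right[OF small_O[OF A] Hom_two_vfuns[OF A that]])
  then show "Farr (pt_func P) A A (Idt \<C> A) = Idt (op_Top T) (Fobj (pt_func P) A)"
    by (simp add: A Idt_eq pt_arr_def vid_def cong: vgraph_cong)
next
  fix A B f assume "A \<in> Obj \<C>" "B \<in> Obj \<C>" "f \<in> Hom \<C> A B"
  then show "Farr (pt_func P) A B f \<in> Hom (op_Top T) (Fobj (pt_func P) A) (Fobj (pt_func P) B)"
    using pt_arr_in by simp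
next
  fix A B D f g
  assume AB: "A \<in> Obj \<C>" "B \<in> Obj \<C>" "D \<in> Obj \<C>" "f \<in> Hom \<C> A B" "g \<in> Hom \<C> B D"
  have "vcomp (pt_arr A B f) (pt_arr B D g) = vgraph (Hom \<C> D \<t>) (\<lambda>h. vcomp (vcomp h g) f)"
    unfolding pt_arr_def by (rule vcomp_vgraph) (use AB comp_in[OF AB(2,3) two_Obj AB(5)] in auto)
  also have "\<dots> = pt_arr A D (vcomp g f)"
    unfolding pt_arr_def
  proof (rule vgraph_cong)
    fix h assume h: "h \<in> Hom \<C> D \<t>"
    show "vcomp (vcomp h g) f = vcomp h (vcomp g f)"
      by (rule vcomp_assoc[symmetric, OF small_O[OF AB(1)] small_O[OF AB(2)] small_O[OF AB(3)]
        Hom_vfuns[OF AB(1,2,4)] Hom_vfuns[OF AB(2,3,5)] Hom_two_vfuns[OF AB(3) h]])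
  qed
  finally show "Farr (pt_func P) A D (g \<cdot>\<^bsub>\<C>\<^esub> f) = Farr (pt_func P) B D g
      \<cdot>\<^bsub>op_Top T\<^esub> Farr (pt_func P) A B f"
    by (simp add: Comp_eq)
qed

lemma Omega_functor:
  assumes T: "T \<subseteq> K"
  shows "is_functor (op_Top T) \<C> (Omega_func P)"
  unfolding is_functor_def op_Top_simps
proof (intro conjI ballI; (elim conjE)?)
  fix X assume "X \<in> Obj (op_Top T)"
  then have X: "X \<in> K"
    using T by auto
  interpret small_space X by (rule space[OF X])
  show "Fobj (Omega_func P) X \<in> Obj \<C>"
    using lift_Obj[OF X] by simp
  have vid: "vid (topspace X) \<in> Hom Top_cat X X"
    using categoryD(1)[OF category_Top, of X] by simp
  have "preimage_arr X X (vid (topspace X)) = vid (carrier (opens X))"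
    unfolding preimage_arr_def vid_def[of "carrier (opens X)"]
  proof (rule vgraph_cong)
    fix u assume u: "u \<in> carrier (opens X)"
    have "{y \<in> topspace X. app (vid (topspace X)) y \<in> elts u} = elts u"
      using opens_elts_subset[OF u] by auto
    then show "vset {y \<in> topspace X. app (vid (topspace X)) y \<in> elts u} = u"
      by simp
  qed
  then show "Farr (Omega_func P) X X (vid (topspace X)) = Idt \<C> (Fobj (Omega_func P) X)"
    unfolding Omega_func_arr[OF X X vid] by (simp add: Idt_eq lift_Obj[OF X] O_lift[OF X])
next
  fix X Y f assume "X \<in> Obj (op_Top T)" "Y \<in> Obj (op_Top T)"
    and f: "f \<in> Hom Top_cat Y X"
  then have "X \<in> K" "Y \<in> K"
    using T by auto
  then show "Farr (Omega_func P) X Y f \<in> Hom \<C> (Fobj (Omega_func P) X) (Fobj (Omega_func P) Y)"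
    using f preimage_Hom by (simp add: Omega_func_arr del: Top_cat_simps(2))
next
  fix X Y Z f g
  assume "X \<in> Obj (op_Top T)" "Y \<in> Obj (op_Top T)"
    "Z \<in> Obj (op_Top T)" and f: "f \<in> Hom Top_cat Y X" and g: "g \<in> Hom Top_cat Z Y"
  then have X: "X \<in> K" and Y: "Y \<in> K" and Z: "Z \<in> K"
    using T by auto
  note s = K_small[OF X] K_small[OF Y] K_small[OF Z]
  interpret X: small_space X by (rule space[OF X])
  interpret Y: small_space Y by (rule space[OF Y])
  interpret Z: small_space Z by (rule space[OF Z])
  have fg: "vcomp f g \<in> Hom Top_cat Z X"
    using categoryD(2)[OF category_Top _ _ _ g f] s by simp
  have fv: "f \<in> vfuns (topspace Y) (topspace X)" and gv: "g \<in> vfuns (topspace Z) (topspace Y)"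
    using f g by auto
  note p = preimage_arr_in[OF s(1,2) f] and q = preimage_arr_in[OF s(2,3) g]
    and r = preimage_arr_in[OF s(1,3) fg]
  have "preimage_arr X Z (vcomp f g) = vcomp (preimage_arr Y Z g) (preimage_arr X Y f)"
  proof (rule vfuns_eqI[OF X.small_opens r(1) vcomp_in_vfuns[OF X.small_opens Y.small_opens p(1) q(1)]])
    fix u assume u: "u \<in> carrier (opens X)"
    show "app (preimage_arr X Z (vcomp f g)) u = app (vcomp (preimage_arr Y Z g) (preimage_arr X Y f)) u"
      using app_vcomp[OF s(3,2) gv fv] vfuns_app[OF X.small_opens p(1) u] vfuns_app[OF s(3) gv]
      by (intro elts_inject)
        (auto simp: r(2)[OF u] app_vcomp[OF X.small_opens Y.small_opens p(1) q(1) u] q(2) p(2)[OF u])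
  qed
  then show "Farr (Omega_func P) X Z (vcomp f g) = Farr (Omega_func P) Y Z g \<cdot>\<^bsub>\<C>\<^esub> Farr (Omega_func P) X Y f"
    unfolding Omega_func_arr[OF X Z fg] Omega_func_arr[OF X Y f] Omega_func_arr[OF Y Z g] Comp_eq .
qed

lemma unit_natural:
  assumes A: "A \<in> Obj \<C>" and B: "B \<in> Obj \<C>" and f: "f \<in> Hom \<C> A B"
  shows "vcomp (preimage_arr (pt_space P A) (pt_space P B) (pt_arr A B f)) (unit_arr A) = vcomp (unit_arr B) f"
proof -
  interpret A: small_space "pt_space P A" by (rule small_pt_space[OF A])
  interpret B: small_space "pt_space P B" by (rule small_pt_space[OF B])
  note fv = Hom_vfuns[OF A B f]
  note p = preimage_arr_in[OF A.small_X B.small_X pt_arr_in[OF A B f]]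
  show ?thesis
  proof (rule vfuns_eqI[OF small_O[OF A] vcomp_in_vfuns[OF small_O[OF A] A.small_opens unit_vfuns[OF A] p(1)]
        vcomp_in_vfuns[OF small_O[OF A] small_O[OF B] fv unit_vfuns[OF B]]])
    fix a assume a: "a \<in> carrier (\<O> A)"
    have fa: "app f a \<in> carrier (\<O> B)"
      by (rule vfuns_app[OF small_O[OF A] fv a])
    have u: "vset (sigma A a) \<in> carrier (opens (pt_space P A))"
      using opens_pt_space[OF A] a by blast
    have "app (pt_arr A B f) g \<in> sigma A a \<longleftrightarrow> g \<in> sigma B (app f a)" if g: "g \<in> Hom \<C> B \<t>" for g
      using app_vcomp[OF small_O[OF A] small_O[OF B] fv Hom_two_vfuns[OF B g] a] comp_in[OF A B two_Obj f g] g
      by (simp add: B mem_sigma)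
    then have "g \<in> Hom \<C> B \<t> \<and> app (pt_arr A B f) g \<in> sigma A a \<longleftrightarrow> g \<in> sigma B (app f a)" for g
      by (cases "g \<in> Hom \<C> B \<t>") (simp_all add: mem_sigma)
    then have "{g \<in> Hom \<C> B \<t>. app (pt_arr A B f) g \<in> sigma A a} = sigma B (app f a)"
      by simp
    then show "app (vcomp (preimage_arr (pt_space P A) (pt_space P B) (pt_arr A B f)) (unit_arr A)) a
        = app (vcomp (unit_arr B) f) a"
      by (intro elts_inject)
        (simp add: app_vcomp[OF small_O[OF A] A.small_opens unit_vfuns[OF A] p(1) a]
          app_vcomp[OF small_O[OF A] small_O[OF B] fv unit_vfuns[OF B] a] A B a fa p(2)[OF u])
  qed
qed

lemma counit_natural:
  assumes X: "X \<in> K" and Y: "Y \<in> K" and f: "f \<in> Hom Top_cat Y X"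
  shows "vcomp (counit_arr X) f
    = vcomp (pt_arr (lift_ob P X) (lift_ob P Y) (preimage_arr X Y f)) (counit_arr Y)"
proof -
  note XY = K_small[OF X] K_small[OF Y]
  note L = lift_Obj[OF X] lift_Obj[OF Y]
  have fv: "f \<in> vfuns (topspace Y) (topspace X)"
    using f by simp
  have cv: "counit_arr Z \<in> vfuns (topspace Z) (Hom \<C> (lift_ob P Z) \<t>)" if "Z \<in> K" for Z
    using counit_in[OF that] by (simp add: lift_Obj[OF that])
  have pv: "pt_arr (lift_ob P X) (lift_ob P Y) (preimage_arr X Y f)
      \<in> vfuns (Hom \<C> (lift_ob P Y) \<t>) (Hom \<C> (lift_ob P X) \<t>)"
    using pt_arr_in[OF L preimage_Hom[OF X Y f]] by (simp add: L)
  show ?thesis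
  proof (rule vfuns_eqI[OF XY(2) vcomp_in_vfuns[OF XY(2,1) fv cv[OF X]]
        vcomp_in_vfuns[OF XY(2) small_Hom_two[OF L(2)] cv[OF Y] pv]])
    fix y assume y: "y \<in> topspace Y"
    show "app (vcomp (counit_arr X) f) y
      = app (vcomp (pt_arr (lift_ob P X) (lift_ob P Y) (preimage_arr X Y f)) (counit_arr Y)) y"
      using preimage_arr_in(3)[OF XY f y] vfuns_app[OF XY(2) fv y] point_Hom[OF Y y]
      by (simp add: app_vcomp[OF XY(2,1) fv cv[OF X] y]
          app_vcomp[OF XY(2) small_Hom_two[OF L(2)] cv[OF Y] pv y] X Y y L)
  qed
qed

theorem is_adjunction:
  assumes TK: "T \<subseteq> K" and T: "\<And>C. C \<in> Obj \<C> \<Longrightarrow> pt_space P C \<in> T"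
  shows "is_adjunction (Dual_on P T)"
  unfolding is_adjunction_def Dual_on_simps
proof (intro conjI category_C category_op_Top pt_functor[OF T] Omega_functor[OF TK])
  let ?T = "op_Top T"
  have ObjT: "X \<in> K" if "X \<in> Obj ?T" for X
    using that TK by auto
  show "nat_trans \<C> \<C> incl (Omega_func P \<circ>\<^sub>F pt_func P) (dual_unit P)"
    unfolding nat_trans_def
  proof (intro conjI ballI)
    fix A assume A: "A \<in> Obj \<C>"
    then show "dual_unit P A \<in> Hom \<C> (Fobj incl A) (Fobj (Omega_func P \<circ>\<^sub>F pt_func P) A)"
      using unit_in by (simp add: dual_unit_eq)
    fix B f assume B: "B \<in> Obj \<C>" and f: "f \<in> Hom \<C> A B"
    show "Farr (Omega_func P \<circ>\<^sub>F pt_func P) A B f \<cdot>\<^bsub>\<C>\<^esub> dual_unit P A = dual_unit P B \<cdot>\<^bsub>\<C>\<^esub> Farr incl A B f"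
      using unit_natural[OF A B f] Omega_func_arr[OF pt_K[OF A] pt_K[OF B] pt_arr_in[OF A B f]]
      by (simp add: dual_unit_eq A B Comp_eq)
  qed
  show "nat_trans ?T ?T (pt_func P \<circ>\<^sub>F Omega_func P) incl (dual_counit P)"
    unfolding nat_trans_def
  proof (intro conjI ballI)
    fix X assume "X \<in> Obj ?T"
    then have X: "X \<in> K"
      by (rule ObjT)
    then show "dual_counit P X \<in> Hom ?T (Fobj (pt_func P \<circ>\<^sub>F Omega_func P) X) (Fobj incl X)"
      using counit_in[OF X] by (simp add: dual_counit_eq del: Top_cat_simps(2))
    fix Y f assume "Y \<in> Obj ?T" and "f \<in> Hom ?T X Y"
    then have Y: "Y \<in> K" and f: "f \<in> Hom Top_cat Y X"
      using ObjT by (auto simp del: Top_cat_simps(2))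
    show "Farr incl X Y f \<cdot>\<^bsub>?T\<^esub> dual_counit P X
        = dual_counit P Y \<cdot>\<^bsub>?T\<^esub> Farr (pt_func P \<circ>\<^sub>F Omega_func P) X Y f"
      using counit_natural[OF X Y f] by (simp add: dual_counit_eq X Y Omega_func_arr[OF X Y f])
  qed
  show "\<forall>C\<in>Obj \<C>. dual_counit P (Fobj (pt_func P) C) \<cdot>\<^bsub>?T\<^esub>
      Farr (pt_func P) C (Fobj (Omega_func P) (Fobj (pt_func P) C)) (dual_unit P C)
      = Idt ?T (Fobj (pt_func P) C)"
  proof
    fix C assume C: "C \<in> Obj \<C>"
    let ?X = "pt_space P C"
    note X = pt_K[OF C]
    have "vcomp (pt_arr C (lift_ob P ?X) (unit_arr C)) (counit_arr ?X)
        = vgraph (topspace ?X) (\<lambda>f. vcomp (point ?X f) (unit_arr C))"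
      unfolding pt_arr_def counit_arr_def
      by (rule vcomp_vgraph) (use C point_Hom[OF X] lift_Obj[OF X] in auto)
    also have "\<dots> = vid (topspace ?X)"
      unfolding vid_def by (rule vgraph_cong) (simp add: C point_unit)
    finally show "dual_counit P (Fobj (pt_func P) C) \<cdot>\<^bsub>?T\<^esub>
        Farr (pt_func P) C (Fobj (Omega_func P) (Fobj (pt_func P) C)) (dual_unit P C)
        = Idt ?T (Fobj (pt_func P) C)"
      by (simp add: dual_counit_eq[OF X] dual_unit_eq[OF C])
  qed
  show "\<forall>D\<in>Obj ?T. Farr (Omega_func P) (Fobj (pt_func P) (Fobj (Omega_func P) D)) D (dual_counit P D) \<cdot>\<^bsub>\<C>\<^esub>
      dual_unit P (Fobj (Omega_func P) D) = Idt \<C> (Fobj (Omega_func P) D)"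
  proof
    fix X assume "X \<in> Obj ?T"
    then have X: "X \<in> K"
      by (rule ObjT)
    let ?L = "lift_ob P X" and ?Y = "pt_space P (lift_ob P X)"
    note L = lift_Obj[OF X]
    interpret X: small_space X by (rule space[OF X])
    interpret Y: small_space ?Y by (rule small_pt_space[OF L])
    note p = preimage_arr_in[OF Y.small_X X.small_X counit_in[OF X]]
    have uv: "unit_arr ?L \<in> vfuns (carrier (opens X)) (carrier (opens ?Y))"
      using unit_vfuns[OF L] by (simp add: O_lift[OF X])
    have "vcomp (preimage_arr ?Y X (counit_arr X)) (unit_arr ?L) = vid (carrier (opens X))"
    proof (rule vfuns_eqI[OF X.small_opens vcomp_in_vfuns[OF X.small_opens Y.small_opens uv p(1)]
          vid_in_vfuns[OF subset_refl]])
      fix u assume u: "u \<in> carrier (opens X)"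
      have uO: "u \<in> carrier (\<O> ?L)"
        using u by (simp add: O_lift[OF X])
      have "{x \<in> topspace X. app (counit_arr X) x \<in> sigma ?L u} = elts u"
        using X.opens_elts_subset[OF u] point_Hom[OF X] u X
        by (auto simp: mem_sigma split: if_splits)
      then show "app (vcomp (preimage_arr ?Y X (counit_arr X)) (unit_arr ?L)) u = app (vid (carrier (opens X))) u"
        using vfuns_app[OF X.small_opens uv u]
        by (intro elts_inject)
          (simp add: app_vcomp[OF X.small_opens Y.small_opens uv p(1) u] p(2) L uO u)
    qed
    then show "Farr (Omega_func P) (Fobj (pt_func P) (Fobj (Omega_func P) X)) X (dual_counit P X) \<cdot>\<^bsub>\<C>\<^esub>
        dual_unit P (Fobj (Omega_func P) X) = Idt \<C> (Fobj (Omega_func P) X)"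
      by (simp add: dual_counit_eq[OF X] dual_unit_eq[OF L] Omega_func_arr[OF pt_K[OF L] X counit_in[OF X]]
          Comp_eq Idt_eq[OF L] O_lift[OF X])
  qed
qed

lemma adjunction_betweenI:
  assumes TK: "T \<subseteq> K" and T: "\<And>C. C \<in> Obj \<C> \<Longrightarrow> pt_space P C \<in> T"
    and D: "D = op_Top T"
    and F: "\<And>C. C \<in> Obj \<C> \<Longrightarrow> Fobj F C = hom_space (Hom \<C> C \<t>) (carrier (\<O> C))"
    "\<And>A B f. A \<in> Obj \<C> \<Longrightarrow> B \<in> Obj \<C> \<Longrightarrow> Farr F A B f = vgraph (Hom \<C> B \<t>) (\<lambda>g. vcomp g f)"
    and G: "\<And>X. X \<in> T \<Longrightarrow> Fobj G X = lift_ob P X" "\<And>X Y f. Farr G X Y f = preimage_arr X Y f"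
  shows "adjunction_between (Dual_on P T) \<C> D F G"
  unfolding adjunction_between_def functors_agree_def Dual_on_simps D
proof (intro conjI ballI is_adjunction[OF TK T] refl)
  fix X Y f assume "X \<in> Obj (op_Top T)" "Y \<in> Obj (op_Top T)"
    "f \<in> Hom (op_Top T) X Y"
  then have "X \<in> K" "Y \<in> K" "f \<in> Hom Top_cat Y X"
    using TK by (auto simp del: Top_cat_simps(2))
  then show "Farr (Omega_func P) X Y f = Farr G X Y f"
    by (simp add: Omega_func_arr G del: Top_cat_simps(2))
qed (auto simp: pt_space_eq pt_arr_def F G)

end

section \<open>Strict morphisms of concrete SFC-categories\<close>

lemma the_in_eq: "a \<in> A \<Longrightarrow> (THE p. p \<in> A \<and> p = a) = a"
  by (rule the_equality) auto

text \<open>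
  A functor over \<open>Frm\<close> that preserves the chosen lifts on the nose. The transformations \<open>\<alpha>\<close>, \<open>i\<close>
  and \<open>\<zeta>\<close> are identities and \<open>\<xi>\<close> is the inclusion of hom-sets.
\<close>

locale concrete_sfc_mor = P: concrete_sfc P K + Q: concrete_sfc Q K'
  for P :: "('o, 'u::universe) sfc" and K and Q :: "('p, 'u) sfc" and K' +
  fixes H :: "('o, 'u, 'p, 'u) func"
  assumes H_Obj: "A \<in> Obj (sfc_cat P) \<Longrightarrow> Fobj H A \<in> Obj (sfc_cat Q)"
    and O_H: "A \<in> Obj (sfc_cat P) \<Longrightarrow> Fobj (sfc_O Q) (Fobj H A) = Fobj (sfc_O P) A"
    and H_arr: "Farr H A B f = f"
    and H_Hom: "A \<in> Obj (sfc_cat P) \<Longrightarrow> B \<in> Obj (sfc_cat P) \<Longrightarrow> f \<in> Hom (sfc_cat P) A B \<Longrightarrow>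
      f \<in> Hom (sfc_cat Q) (Fobj H A) (Fobj H B)"
    and H_two: "Fobj H (sfc_two P) = sfc_two Q"
    and H_lift: "X \<in> K \<Longrightarrow> Fobj H (lift_ob P X) = lift_ob Q X"
    and K_sub: "K \<subseteq> K'"
begin

abbreviation "\<m> \<equiv> strict_mor P Q H"

lemma strict_simps [simp]:
  "mor_H \<m> = H" "mor_alpha \<m> C = vid (carrier (P.\<O> C))" "mor_i \<m> = vid (carrier two)"
  by (simp_all add: strict_mor_def Q.Idt_eq[OF Q.two_Obj] Q.O_two)

lemma H_functor: "is_functor (sfc_cat P) (sfc_cat Q) H"
  by (simp add: is_functor_def H_Obj H_arr H_Hom P.Idt_eq Q.Idt_eq O_H P.Comp_eq Q.Comp_eq)

lemma alpha_iso: "nat_iso (sfc_cat P) Frm_cat (sfc_O Q \<circ>\<^sub>F H) (sfc_O P) (mor_alpha \<m>)"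
  unfolding nat_iso_def nat_trans_def
proof (intro conjI ballI)
  fix A assume A: "A \<in> Obj (sfc_cat P)"
  show "is_iso Frm_cat (Fobj (sfc_O Q \<circ>\<^sub>F H) A) (P.\<O> A) (mor_alpha \<m> A)"
    using is_iso_Idt[OF category_Frm P.O_Obj[OF A]] by (simp add: O_H[OF A])
  then show "mor_alpha \<m> A \<in> Hom Frm_cat (Fobj (sfc_O Q \<circ>\<^sub>F H) A) (P.\<O> A)"
    by (simp add: is_iso_def)
  fix B f assume B: "B \<in> Obj (sfc_cat P)" and f: "f \<in> Hom (sfc_cat P) A B"
  note fv = P.Hom_vfuns[OF A B f]
  show "Farr (sfc_O P) A B f \<cdot>\<^bsub>Frm_cat\<^esub> mor_alpha \<m> A = mor_alpha \<m> B \<cdot>\<^bsub>Frm_cat\<^esub> Farr (sfc_O Q \<circ>\<^sub>F H) A B f"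
    by (simp add: P.O_arr Q.O_arr H_arr vcomp_vid_right[OF P.small_O[OF A] fv]
        vcomp_vid_left[OF P.small_O[OF A] P.small_O[OF B] fv])
qed

theorem sfc_morphism: "sfc_morphism P Q \<m>"
  unfolding sfc_morphism_def strict_simps(1) H_two O_H[OF P.two_Obj] Q.O_two P.O_two strict_simps(2,3)
    P.iota_eq Q.iota_eq
proof (intro conjI P.is_sfc Q.is_sfc H_functor alpha_iso[unfolded strict_simps] ballI)
  show "is_iso (sfc_cat Q) (sfc_two Q) (sfc_two Q) (vid (carrier two))"
    using is_iso_Idt[OF Q.category_C Q.two_Obj] by (simp add: Q.Idt_eq[OF Q.two_Obj] Q.O_two)
  show "Idt Frm_cat two \<cdot>\<^bsub>Frm_cat\<^esub> Farr (sfc_O Q) (sfc_two Q) (sfc_two Q) (vid (carrier two))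
      = Idt Frm_cat two \<cdot>\<^bsub>Frm_cat\<^esub> vid (carrier two)"
    by (simp add: Q.O_arr)
  fix X assume "X \<in> Obj (Top_of P)"
  then have X: "X \<in> K"
    by (simp add: P.Obj_Top_of)
  then have X': "X \<in> K'"
    using K_sub by blast
  interpret small_space X by (rule P.space[OF X])
  have chi: "chi X x \<in> vfuns (Hom Top_cat X Sierpinski) (carrier two)" if x: "x \<in> topspace X" for x
    unfolding chi_def
  proof (rule vgraph_in_vfuns, rule funcsetI)
    fix g :: 'u assume "g \<in> Hom Top_cat X Sierpinski"
    then show "app g x \<in> carrier two"
      using vfuns_app[OF small_X _ x, of g "{v0, v1}"] by simp
  qed
  have inv: "inv_arr Frm_cat two two (vid {v0, v1 :: 'u}) = vid {v0, v1}"
    by (rule P.inv_iota[unfolded Frm_cat_simps carrier_two])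
  have "inv_arr Frm_cat two two (vid (carrier two)) \<cdot>\<^bsub>Set_cat\<^esub> point_arr P X x = point_arr Q X x"
    if x: "x \<in> topspace X" for x
    using vcomp_vid_left[OF small_Hom_Sierpinski _ chi[OF x]]
    by (simp add: inv P.point_arr_eq[OF small_X x] Q.point_arr_eq[OF small_X x])
  then have "(\<lambda>x. inv_arr Frm_cat two two (vid (carrier two)) \<cdot>\<^bsub>Set_cat\<^esub> point_arr P X x) ` topspace X
      = point_arr Q X ` topspace X"
    by (rule image_cong[OF refl])
  moreover have "lift_arr P X \<cdot>\<^bsub>Set_cat\<^esub> vid (carrier (P.\<O> (lift_ob P X))) = char_arr X"
    by (simp add: P.lift_arr_eq P.O_lift[OF X] vcomp_vid_right[OF small_opens char_arr_in])
  ultimately show "cartesian_lift (sfc_cat Q) Set_cat (und Q) (Hom Top_cat X Sierpinski) (sfc_two Q)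
      ((\<lambda>x. inv_arr Frm_cat two two (vid (carrier two)) \<cdot>\<^bsub>Set_cat\<^esub> point_arr P X x) ` topspace X)
      (Fobj H (lift_ob P X)) (lift_arr P X \<cdot>\<^bsub>Set_cat\<^esub> vid (carrier (P.\<O> (lift_ob P X))))"
    using Q.is_sfc_lift[OF X'] by (simp only: H_lift[OF X] is_sfc_lift_def)
qed

abbreviation "\<d> \<equiv> Dual_mor P Q \<m>"

lemma Dual_mor_simps [simp]: "Lfun \<d> = H" "Rfun \<d> = incl"
  by (simp_all add: Dual_mor_def)

lemma zeta_eq:
  assumes X: "X \<in> K"
  shows "Mzeta \<d> X = vid (carrier (opens X))"
proof -
  interpret small_space X by (rule P.space[OF X])
  have X': "X \<in> K'"
    using X K_sub by blast
  have vid: "vid (carrier (opens X)) \<in> Hom (sfc_cat Q) (lift_ob Q X) (lift_ob Q X)"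
    using Q.vid_in[OF Q.lift_Obj[OF X']] by (simp add: Q.O_lift[OF X'])
  have "vid (carrier (opens X)) \<in> vfuns (carrier (opens X)) (carrier (opens X))"
    by (rule vid_in_vfuns) simp
  then have "vcomp (vid (carrier (opens X))) (vid (carrier (opens X))) = vid (carrier (opens X))"
    by (rule vcomp_vid_right[OF small_opens])
  then show ?thesis
    using vid by (simp add: Dual_mor_def H_lift[OF X] P.lift_arr_eq Q.lift_arr_eq Q.O_lift[OF X']
        P.O_lift[OF X] inv_char_arr the_in_eq del: Top_cat_simps)
qed

lemma Hom_two_sub: "C \<in> Obj (sfc_cat P) \<Longrightarrow> f \<in> Hom (sfc_cat P) C (sfc_two P) \<Longrightarrow>
    f \<in> Hom (sfc_cat Q) (Fobj H C) (sfc_two Q)"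
  using H_Hom[OF _ P.two_Obj] by (simp add: H_two)

lemma xi_eq:
  assumes C: "C \<in> Obj (sfc_cat P)"
  shows "Mxi \<d> C = vid (Hom (sfc_cat P) C (sfc_two P))"
proof -
  have "Mxi \<d> C = vgraph (Hom (sfc_cat P) C (sfc_two P)) (vcomp (vid {v0, v1}))"
    by (simp add: Dual_mor_def Q.Comp_eq H_arr)
  also have "\<dots> = vid (Hom (sfc_cat P) C (sfc_two P))"
    unfolding vid_def[of "Hom (sfc_cat P) C (sfc_two P)"]
    by (rule vgraph_cong) (rule vcomp_vid_left[OF P.small_O[OF C] small_v01 P.Hom_two_vfuns[OF C]])
  finally show ?thesis .
qed

lemma xi_in:
  assumes C: "C \<in> Obj (sfc_cat P)"
  shows "Mxi \<d> C \<in> Hom Top_cat (pt_space P C) (pt_space Q (Fobj H C))"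
  unfolding xi_eq[OF C] vid_def P.topspace_pt_space[OF C, symmetric]
proof (rule vgraph_in_Top)
  note HC = H_Obj[OF C]
  show "small (topspace (pt_space P C))"
    by (simp add: C)
  have "{f \<in> Hom (sfc_cat P) C (sfc_two P). f \<in> Q.sigma (Fobj H C) a} = P.sigma C a" for a
    using Hom_two_sub[OF C] by (auto simp: P.sigma_def Q.sigma_def)
  then show "continuous_map (pt_space P C) (pt_space Q (Fobj H C)) (\<lambda>f. f)"
    unfolding continuous_map_def Q.openin_pt_space[OF HC] P.topspace_pt_space[OF C]
      Q.topspace_pt_space[OF HC] O_H[OF C]
    using Hom_two_sub[OF C] P.sigma_open[OF C] by auto
qed

theorem right_adj_morphism:
  assumes TK: "T \<subseteq> K" "\<And>C. C \<in> Obj (sfc_cat P) \<Longrightarrow> pt_space P C \<in> T"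
    and TK': "T' \<subseteq> K'" "\<And>C. C \<in> Obj (sfc_cat Q) \<Longrightarrow> pt_space Q C \<in> T'"
    and TT': "T \<subseteq> T'"
  shows "right_adj_morphism (Dual_on P T) (Dual_on Q T') \<d>"
  unfolding right_adj_morphism_def Dual_on_simps Dual_mor_simps
proof (intro conjI P.is_adjunction[OF TK] Q.is_adjunction[OF TK'] H_functor)
  let ?T = "op_Top T" and ?T' = "op_Top T'"
  show "is_functor ?T ?T' incl"
    using TT' by (auto simp: is_functor_def)
  show "nat_iso ?T (sfc_cat Q) (H \<circ>\<^sub>F Omega_func P) (Omega_func Q \<circ>\<^sub>F incl) (Mzeta \<d>)"
    unfolding nat_iso_def nat_trans_def
  proof (intro conjI ballI)
    fix X assume "X \<in> Obj ?T"
    then have X: "X \<in> K"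
      using TK(1) by auto
    then have X': "X \<in> K'"
      using K_sub by blast
    show iso: "is_iso (sfc_cat Q) (Fobj (H \<circ>\<^sub>F Omega_func P) X) (Fobj (Omega_func Q \<circ>\<^sub>F incl) X) (Mzeta \<d> X)"
      using is_iso_Idt[OF Q.category_C Q.lift_Obj[OF X']]
      by (simp add: zeta_eq[OF X] H_lift[OF X] Q.Idt_eq[OF Q.lift_Obj[OF X']] Q.O_lift[OF X'])
    then show "Mzeta \<d> X \<in> Hom (sfc_cat Q) (Fobj (H \<circ>\<^sub>F Omega_func P) X) (Fobj (Omega_func Q \<circ>\<^sub>F incl) X)"
      by (simp add: is_iso_def)
    fix Y f assume "Y \<in> Obj ?T" and "f \<in> Hom ?T X Y"
    then have Y: "Y \<in> K" and f: "f \<in> Hom Top_cat Y X"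
      using TK(1) by (auto simp del: Top_cat_simps(2))
    then have Y': "Y \<in> K'"
      using K_sub by blast
    interpret X: small_space X by (rule P.space[OF X])
    interpret Y: small_space Y by (rule P.space[OF Y])
    note p = preimage_arr_in(1)[OF X.small_X Y.small_X f]
    show "Farr (Omega_func Q \<circ>\<^sub>F incl) X Y f \<cdot>\<^bsub>sfc_cat Q\<^esub> Mzeta \<d> X
        = Mzeta \<d> Y \<cdot>\<^bsub>sfc_cat Q\<^esub> Farr (H \<circ>\<^sub>F Omega_func P) X Y f"
      by (simp add: zeta_eq X Y Q.Comp_eq H_arr P.Omega_func_arr[OF X Y f] Q.Omega_func_arr[OF X' Y' f]
          vcomp_vid_right[OF X.small_opens p] vcomp_vid_left[OF X.small_opens Y.small_opens p])
  qed
  show "nat_trans (sfc_cat P) ?T' (pt_func Q \<circ>\<^sub>F H) (incl \<circ>\<^sub>F pt_func P) (Mxi \<d>)"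
    unfolding nat_trans_def
  proof (intro conjI ballI)
    fix A assume A: "A \<in> Obj (sfc_cat P)"
    show "Mxi \<d> A \<in> Hom ?T' (Fobj (pt_func Q \<circ>\<^sub>F H) A) (Fobj (incl \<circ>\<^sub>F pt_func P) A)"
      using xi_in[OF A] by (simp del: Top_cat_simps(2))
    fix B f assume B: "B \<in> Obj (sfc_cat P)" and f: "f \<in> Hom (sfc_cat P) A B"
    have "vcomp (vid (Hom (sfc_cat P) A (sfc_two P))) (P.pt_arr A B f) = P.pt_arr A B f"
      using P.pt_arr_in[OF A B f] by (intro vcomp_vid_left[OF P.small_Hom_two[OF B] P.small_Hom_two[OF A]])
        (simp add: A B)
    also have "\<dots> = vcomp (Q.pt_arr (Fobj H A) (Fobj H B) f) (vid (Hom (sfc_cat P) B (sfc_two P)))"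
      unfolding P.pt_arr_def Q.pt_arr_def vid_def
      by (rule vcomp_vgraph[symmetric, OF P.small_Hom_two[OF B] Q.small_Hom_two[OF H_Obj[OF B]]])
        (use Hom_two_sub[OF B] in auto)
    finally show "Farr (incl \<circ>\<^sub>F pt_func P) A B f \<cdot>\<^bsub>?T'\<^esub> Mxi \<d> A
        = Mxi \<d> B \<cdot>\<^bsub>?T'\<^esub> Farr (pt_func Q \<circ>\<^sub>F H) A B f"
      by (simp add: xi_eq A B H_arr)
  qed
  show "\<forall>C\<in>Obj (sfc_cat P). let FC = Fobj (pt_func P) C; UC = Fobj H C;
        UGFC = Fobj H (Fobj (Omega_func P) FC); VFC = Fobj incl FC
     in Mxi \<d> C = dual_counit Q VFC \<cdot>\<^bsub>?T'\<^esub> Farr (pt_func Q) UGFC (Fobj (Omega_func Q) VFC) (Mzeta \<d> FC)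
          \<cdot>\<^bsub>?T'\<^esub> Farr (pt_func Q) UC UGFC (Farr H C (Fobj (Omega_func P) FC) (dual_unit P C))"
  proof
    fix C assume C: "C \<in> Obj (sfc_cat P)"
    let ?X = "pt_space P C"
    let ?H = "Hom (sfc_cat P) C (sfc_two P)" and ?Q = "Hom (sfc_cat Q) (lift_ob Q ?X) (sfc_two Q)"
    note X = P.pt_K[OF C] and HC = H_Obj[OF C]
    have X': "?X \<in> K'"
      using X K_sub by blast
    note L = Q.lift_Obj[OF X']
    interpret X: small_space ?X by (rule P.space[OF X])
    have "vcomp (Q.pt_arr (lift_ob Q ?X) (lift_ob Q ?X) (vid (carrier (opens ?X)))) (Q.counit_arr ?X)
        = vgraph (topspace ?X) (\<lambda>f. vcomp (point ?X f) (vid (carrier (opens ?X))))"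
      unfolding Q.pt_arr_def Q.counit_arr_def
      by (rule vcomp_vgraph) (use Q.point_Hom[OF X'] L in auto)
    also have "\<dots> = Q.counit_arr ?X"
      unfolding Q.counit_arr_def
    proof (rule vgraph_cong)
      fix f assume "f \<in> topspace ?X"
      then have "point ?X f \<in> vfuns (carrier (opens ?X)) (carrier two)"
        using X.point_in by simp
      then show "vcomp (point ?X f) (vid (carrier (opens ?X))) = point ?X f"
        by (rule vcomp_vid_right[OF X.small_opens])
    qed
    finally have 1: "vcomp (Q.pt_arr (lift_ob Q ?X) (lift_ob Q ?X) (vid (carrier (opens ?X)))) (Q.counit_arr ?X)
        = Q.counit_arr ?X" .
    have "vcomp (Q.pt_arr (Fobj H C) (lift_ob Q ?X) (P.unit_arr C)) (Q.counit_arr ?X)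
        = vgraph (topspace ?X) (\<lambda>f. vcomp (point ?X f) (P.unit_arr C))"
      unfolding Q.pt_arr_def Q.counit_arr_def
      by (rule vcomp_vgraph) (use Q.point_Hom[OF X'] L in auto)
    also have "\<dots> = vid ?H"
      unfolding vid_def P.topspace_pt_space[OF C] by (rule vgraph_cong) (rule P.point_unit[OF C])
    finally have 2: "vcomp (Q.pt_arr (Fobj H C) (lift_ob Q ?X) (P.unit_arr C)) (Q.counit_arr ?X) = vid ?H" .
    show "let FC = Fobj (pt_func P) C; UC = Fobj H C;
        UGFC = Fobj H (Fobj (Omega_func P) FC); VFC = Fobj incl FC
     in Mxi \<d> C = dual_counit Q VFC \<cdot>\<^bsub>?T'\<^esub> Farr (pt_func Q) UGFC (Fobj (Omega_func Q) VFC) (Mzeta \<d> FC)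
          \<cdot>\<^bsub>?T'\<^esub> Farr (pt_func Q) UC UGFC (Farr H C (Fobj (Omega_func P) FC) (dual_unit P C))"
      using 1 2 by (simp add: Let_def xi_eq[OF C] zeta_eq[OF X] H_arr H_lift[OF X] Q.dual_counit_eq[OF X']
          P.dual_unit_eq[OF C])
  qed
qed

text \<open>If \<open>P\<close> and \<open>Q\<close> have the same points, then \<open>\<xi>\<close> is the identity.\<close>

theorem strong_adj_morphism:
  assumes TK: "T \<subseteq> K" "\<And>C. C \<in> Obj (sfc_cat P) \<Longrightarrow> pt_space P C \<in> T"
    and TK': "T' \<subseteq> K'" "\<And>C. C \<in> Obj (sfc_cat Q) \<Longrightarrow> pt_space Q C \<in> T'"
    and TT': "T \<subseteq> T'"
    and full: "\<And>C. C \<in> Obj (sfc_cat P) \<Longrightarrow>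
      Hom (sfc_cat Q) (Fobj H C) (sfc_two Q) = Hom (sfc_cat P) C (sfc_two P)"
  shows "strong_adj_morphism (Dual_on P T) (Dual_on Q T') \<d>"
proof -
  note right = right_adj_morphism[OF TK TK' TT']
  let ?T' = "op_Top T'"
  have "is_iso ?T' (pt_space Q (Fobj H C)) (pt_space P C) (Mxi \<d> C)" if C: "C \<in> Obj (sfc_cat P)" for C
  proof -
    have "pt_space Q (Fobj H C) = pt_space P C"
      by (simp add: P.pt_space_eq[OF C] Q.pt_space_eq[OF H_Obj[OF C]] full[OF C] O_H[OF C])
    moreover have "pt_space P C \<in> Obj ?T'"
      using TK(2)[OF C] TT' C by auto
    moreover from this have "is_iso ?T' (pt_space P C) (pt_space P C) (Idt ?T' (pt_space P C))"
      by (rule is_iso_Idt[OF category_op_Top])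
    ultimately show ?thesis
      by (simp add: xi_eq[OF C] C)
  qed
  then show ?thesis
    using right by (simp add: strong_adj_morphism_def nat_iso_def right_adj_morphism_def)
qed

end

section \<open>Filters of open sets\<close>

text \<open>The filter of open neighbourhoods of a set.\<close>

definition up_filter :: "'u::universe topology \<Rightarrow> 'u set \<Rightarrow> 'u set" where
  "up_filter X A = {u \<in> carrier (opens X). A \<subseteq> elts u}"

lemma mem_up_filter: "u \<in> up_filter X A \<longleftrightarrow> u \<in> carrier (opens X) \<and> A \<subseteq> elts u"
  by (simp add: up_filter_def)

context small_space
begin

sublocale opens: frm "opens X"
  by unfold_locales (rule frame_opens)

text \<open>Passing to the saturation of \<open>A\<close> does not change its neighbourhood filter.\<close>

lemma saturated_filters_eq: "saturated_filters X = {up_filter X A | A. A \<subseteq> topspace X}"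
proof (rule subset_antisym; rule subsetI)
  fix F assume "F \<in> saturated_filters X"
  then obtain A \<V> where "F = up_filter X A" "A = topspace X \<inter> \<Inter>\<V>"
    unfolding saturated_filters_def up_filter_def by blast
  then show "F \<in> {up_filter X A | A. A \<subseteq> topspace X}"
    by auto
next
  fix F assume "F \<in> {up_filter X A | A. A \<subseteq> topspace X}"
  then obtain A where A: "A \<subseteq> topspace X" and F: "F = up_filter X A"
    by auto
  let ?V = "{U. openin X U \<and> A \<subseteq> U}"
  let ?B = "topspace X \<inter> \<Inter>?V"
  have "A \<subseteq> elts u \<longleftrightarrow> ?B \<subseteq> elts u" if u: "u \<in> carrier (opens X)" for u
  proof
    assume "A \<subseteq> elts u"
    then have "elts u \<in> ?V"
      using u by (simp add: opens_carrier_iff)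
    then show "?B \<subseteq> elts u"
      by (intro le_infI2 Inter_lower)
  next
    assume "?B \<subseteq> elts u"
    moreover have "A \<subseteq> ?B"
      using A by auto
    ultimately show "A \<subseteq> elts u"
      by (rule subset_trans[rotated])
  qed
  then have "F = {u \<in> carrier (opens X). ?B \<subseteq> elts u}"
    unfolding F up_filter_def by (intro Collect_cong conj_cong refl)
  moreover have "\<forall>V\<in>?V. openin X V"
    by simp
  ultimately show "F \<in> saturated_filters X"
    unfolding saturated_filters_def mem_Collect_eq by (intro exI[of _ ?B] exI[of _ ?V] conjI refl)
qed

lemma up_filter_filter: "A \<subseteq> topspace X \<Longrightarrow> up_filter X A \<in> filters (opens X)"
  unfolding filters_def
  by (rule CollectI, intro conjI ballI impI)
    (auto simp: mem_up_filter elts_top_opens elts_meet_opens le_opens_iff)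

text \<open>
  Neighbourhood filters are strongly exact: at a point \<open>x\<close>, test against the largest open set that
  misses \<open>x\<close>.
\<close>

lemma up_filter_FiltSE:
  assumes A: "A \<subseteq> topspace X"
  shows "up_filter X A \<in> FiltSE (opens X)"
proof -
  have "x \<in> elts (\<Sqinter>\<^bsub>opens X\<^esub> S)"
    if S: "S \<subseteq> up_filter X A" "strongly_exact (opens X) S" and x: "x \<in> A" for S x
  proof (rule ccontr)
    assume not: "x \<notin> elts (\<Sqinter>\<^bsub>opens X\<^esub> S)"
    have xX: "x \<in> topspace X"
      using x A by blast
    have SX: "S \<subseteq> carrier (opens X)"
      using S(1) by (auto simp: mem_up_filter)
    let ?Y = "topspace X - X closure_of {x}"
    have Y: "openin X ?Y"
      by (rule openin_diff) simp_all
    have le_Y: "c \<sqsubseteq>\<^bsub>opens X\<^esub> vset ?Y \<longleftrightarrow> x \<notin> elts c" if c: "c \<in> carrier (opens X)" for c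
    proof -
      have "elts c \<subseteq> ?Y \<longleftrightarrow> elts c \<inter> X closure_of {x} = {}"
        using opens_elts_subset[OF c] by blast
      also have "\<dots> \<longleftrightarrow> x \<notin> elts c"
        using openin_Int_closure_of_eq_empty[of X "elts c" "{x}"] c by (auto simp: opens_carrier_iff)
      finally show ?thesis
        using c Y by (simp add: le_opens_iff)
    qed
    have "\<top>\<^bsub>opens X\<^esub> \<sqsubseteq>\<^bsub>opens X\<^esub> vset ?Y"
    proof (rule opens.strongly_exactD[OF S(2)])
      show "\<Sqinter>\<^bsub>opens X\<^esub> S \<sqsubseteq>\<^bsub>opens X\<^esub> vset ?Y"
        using not SX by (simp add: le_Y)
      fix s c assume s: "s \<in> S" and c: "c \<in> carrier (opens X)"
        and cs: "c \<sqinter>\<^bsub>opens X\<^esub> s \<sqsubseteq>\<^bsub>opens X\<^esub> vset ?Y"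
      have "s \<in> up_filter X A"
        using s S(1) by blast
      then have "s \<in> carrier (opens X)" "x \<in> elts s"
        using x by (auto simp: mem_up_filter)
      then show "c \<sqsubseteq>\<^bsub>opens X\<^esub> vset ?Y"
        using cs c by (simp add: le_Y elts_meet_opens)
    qed (use Y in simp_all)
    then show False
      using xX by (simp add: le_Y elts_top_opens)
  qed
  moreover have "\<Sqinter>\<^bsub>opens X\<^esub> S \<in> carrier (opens X)" if "strongly_exact (opens X) S" for S
    using that by (simp add: strongly_exact_def)
  ultimately show ?thesis
    using up_filter_filter[OF A] by (auto simp: FiltSE_def mem_up_filter)
qed

lemma FiltE_saturated: "FiltE (opens X) \<subseteq> saturated_filters X"
proof
  fix F assume F: "F \<in> FiltE (opens X)"
  then have FX: "F \<subseteq> carrier (opens X)"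
    using opens.filtersD(1)[of F] by (simp add: FiltE_def)
  \<comment> \<open>\<open>F\<close> is the intersection of the filters \<open>{c. b \<subseteq> a \<union> c} = {c. b - a \<subseteq> c}\<close>.\<close>
  define A where "A = {x \<in> topspace X. \<exists>a\<in>carrier (opens X). \<exists>b\<in>carrier (opens X).
    (\<forall>c\<in>F. b \<sqsubseteq>\<^bsub>opens X\<^esub> a \<squnion>\<^bsub>opens X\<^esub> c) \<and> x \<in> elts b - elts a}"
  have le: "b \<sqsubseteq>\<^bsub>opens X\<^esub> a \<squnion>\<^bsub>opens X\<^esub> c \<longleftrightarrow> elts b \<subseteq> elts a \<union> elts c"
    if "a \<in> carrier (opens X)" "b \<in> carrier (opens X)" "c \<in> carrier (opens X)" for a b c
    using that by (simp add: le_opens_iff elts_join_opens)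
  have "F = up_filter X A"
  proof (rule subset_antisym)
    show "F \<subseteq> up_filter X A"
    proof
      fix c assume c: "c \<in> F"
      then have cX: "c \<in> carrier (opens X)"
        using FX by blast
      have "x \<in> elts c" if x: "x \<in> A" for x
      proof -
        obtain a b where ab: "a \<in> carrier (opens X)" "b \<in> carrier (opens X)"
          "\<forall>c\<in>F. b \<sqsubseteq>\<^bsub>opens X\<^esub> a \<squnion>\<^bsub>opens X\<^esub> c" "x \<in> elts b - elts a"
          using x unfolding A_def by blast
        then have "elts b \<subseteq> elts a \<union> elts c"
          using c le[OF ab(1,2) cX] by simp
        then show ?thesis
          using ab(4) by blast
      qed
      then show "c \<in> up_filter X A"
        using cX by (auto simp: mem_up_filter)
    qed
    show "up_filter X A \<subseteq> F"
    proof
      fix w assume "w \<in> up_filter X A"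
      then have w: "w \<in> carrier (opens X)" "A \<subseteq> elts w"
        by (simp_all add: mem_up_filter)
      have "b \<sqsubseteq>\<^bsub>opens X\<^esub> a \<squnion>\<^bsub>opens X\<^esub> w"
        if ab: "a \<in> carrier (opens X)" "b \<in> carrier (opens X)" "\<forall>c\<in>F. b \<sqsubseteq>\<^bsub>opens X\<^esub> a \<squnion>\<^bsub>opens X\<^esub> c" for a b
      proof -
        have "elts b - elts a \<subseteq> A"
          unfolding A_def using ab opens_elts_subset[OF ab(2)] by blast
        then have "elts b \<subseteq> elts a \<union> elts w"
          using w(2) by blast
        then show ?thesis
          by (simp add: le ab(1,2) w(1))
      qed
      then show "w \<in> F"
        using F w(1) unfolding opens.FiltE_iff by simp
    qed
  qed
  moreover have "A \<subseteq> topspace X"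
    by (auto simp: A_def)
  ultimately show "F \<in> saturated_filters X"
    unfolding saturated_filters_eq by blast
qed

text \<open>Unions of sets give intersections of filters, and set differences give co-differences.\<close>

lemma subcolocale_saturated: "subcolocale (Filt (opens X)) (saturated_filters X)"
  unfolding opens.subcolocale_iff
proof (intro conjI allI impI ballI)
  show "saturated_filters X \<subseteq> filters (opens X)"
    unfolding saturated_filters_eq using up_filter_filter by auto
  fix \<B> assume "\<B> \<subseteq> saturated_filters X"
  then have B: "\<And>F. F \<in> \<B> \<Longrightarrow> \<exists>A. A \<subseteq> topspace X \<and> F = up_filter X A"
    unfolding saturated_filters_eq by auto
  define A where "A = \<Union>{A. A \<subseteq> topspace X \<and> up_filter X A \<in> \<B>}"
  have "carrier (opens X) \<inter> \<Inter>\<B> = up_filter X A"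
  proof (rule subset_antisym)
    show "carrier (opens X) \<inter> \<Inter>\<B> \<subseteq> up_filter X A"
    proof
      fix u assume u: "u \<in> carrier (opens X) \<inter> \<Inter>\<B>"
      have "A' \<subseteq> elts u" if "up_filter X A' \<in> \<B>" for A'
        using u that mem_up_filter[of u X A'] by blast
      then show "u \<in> up_filter X A"
        using u by (auto simp: A_def mem_up_filter)
    qed
    show "up_filter X A \<subseteq> carrier (opens X) \<inter> \<Inter>\<B>"
    proof (intro subsetI IntI InterI)
      fix u F assume u: "u \<in> up_filter X A" and F: "F \<in> \<B>"
      obtain A' where A': "A' \<subseteq> topspace X" "F = up_filter X A'"
        using B[OF F] by blast
      then have "A' \<subseteq> A"
        using F unfolding A_def by blast
      then show "u \<in> F"
        using u by (auto simp: A'(2) mem_up_filter)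
    qed (simp add: mem_up_filter)
  qed
  moreover have "A \<subseteq> topspace X"
    by (auto simp: A_def)
  ultimately show "carrier (opens X) \<inter> \<Inter>\<B> \<in> saturated_filters X"
    unfolding saturated_filters_eq by blast
next
  fix F \<K> assume "F \<in> saturated_filters X" and K: "\<K> \<in> filters (opens X)"
  then obtain A where A: "A \<subseteq> topspace X" "F = up_filter X A"
    unfolding saturated_filters_eq by blast
  have KX: "k \<in> carrier (opens X)" if "k \<in> \<K>" for k
    using opens.filtersD(1)[OF K] that by blast
  define B where "B = (\<Union>k\<in>\<K>. A - elts k)"
  have "(\<forall>k\<in>\<K>. k \<squnion>\<^bsub>opens X\<^esub> c \<in> F) \<longleftrightarrow> B \<subseteq> elts c" if c: "c \<in> carrier (opens X)" for c
  proof -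
    have "(\<forall>k\<in>\<K>. k \<squnion>\<^bsub>opens X\<^esub> c \<in> F) \<longleftrightarrow> (\<forall>k\<in>\<K>. A \<subseteq> elts k \<union> elts c)"
      using c KX by (simp add: A(2) mem_up_filter elts_join_opens)
    also have "\<dots> \<longleftrightarrow> B \<subseteq> elts c"
      unfolding B_def by blast
    finally show ?thesis .
  qed
  then have "{c \<in> carrier (opens X). \<forall>k\<in>\<K>. k \<squnion>\<^bsub>opens X\<^esub> c \<in> F} = up_filter X B"
    unfolding up_filter_def by (intro Collect_cong conj_cong refl)
  moreover have "B \<subseteq> topspace X"
    using A(1) by (auto simp: B_def)
  ultimately show "{c \<in> carrier (opens X). \<forall>k\<in>\<K>. k \<squnion>\<^bsub>opens X\<^esub> c \<in> F} \<in> saturated_filters X"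
    unfolding saturated_filters_eq by blast
qed

lemma saturated_FiltSE: "saturated_filters X \<subseteq> FiltSE (opens X)"
  unfolding saturated_filters_eq using up_filter_FiltSE by auto

text \<open>
  Exactness of the neighbourhood filters of points is the condition under which \<open>\<Omega> X\<close> is a lift
  along exact frame maps. The lemmas below show that together with \<open>T\<^sub>0\<close> it is the axiom \<open>T\<^sub>D\<close>.
\<close>

lemma saturated_eq_FiltE:
  assumes "\<And>x. x \<in> topspace X \<Longrightarrow> up_filter X {x} \<in> FiltE (opens X)"
  shows "saturated_filters X = FiltE (opens X)"
proof (rule subset_antisym[OF _ FiltE_saturated])
  show "saturated_filters X \<subseteq> FiltE (opens X)"
  proof
    fix F assume "F \<in> saturated_filters X"
    then obtain A where A: "A \<subseteq> topspace X" "F = up_filter X A"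
      unfolding saturated_filters_eq by blast
    have "F = carrier (opens X) \<inter> \<Inter>((\<lambda>x. up_filter X {x}) ` A)"
      by (auto simp: A(2) mem_up_filter)
    also have "\<dots> \<in> FiltE (opens X)"
      by (rule opens.FiltE_Inter) (use A(1) assms in auto)
    finally show "F \<in> FiltE (opens X)" .
  qed
qed

lemma TD_point_exact:
  assumes TD: "TD_space X" and x: "x \<in> topspace X"
  shows "up_filter X {x} \<in> FiltE (opens X)"
  unfolding opens.FiltE_iff
proof (intro conjI ballI impI)
  show "up_filter X {x} \<in> filters (opens X)"
    using x by (intro up_filter_filter) simp
  obtain U C where U: "openin X U" and C: "closedin X C" and UC: "{x} = U \<inter> C"
    using bspec[OF TD[unfolded TD_space_def] x] by (elim exE conjE) (rule that)
  have C': "openin X (topspace X - C)"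
    using C by (simp add: closedin_def)
  fix w assume w: "w \<in> carrier (opens X)"
    and sep: "\<forall>a\<in>carrier (opens X). \<forall>b\<in>carrier (opens X). (\<forall>c\<in>up_filter X {x}.
      b \<sqsubseteq>\<^bsub>opens X\<^esub> a \<squnion>\<^bsub>opens X\<^esub> c) \<longrightarrow> b \<sqsubseteq>\<^bsub>opens X\<^esub> a \<squnion>\<^bsub>opens X\<^esub> w"
  have UC': "y \<in> U \<and> y \<in> C \<longleftrightarrow> y = x" for y
    unfolding Int_iff[symmetric] UC[symmetric] by simp
  \<comment> \<open>The point \<open>x\<close> is \<open>U - (X - C)\<close>, so its neighbourhood filter is the co-difference of \<open>U\<close> and
    \<open>X - C\<close>.\<close>
  have le: "vset U \<sqsubseteq>\<^bsub>opens X\<^esub> vset (topspace X - C) \<squnion>\<^bsub>opens X\<^esub> c \<longleftrightarrow> x \<in> elts c"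
    if c: "c \<in> carrier (opens X)" for c
  proof -
    have "U \<subseteq> (topspace X - C) \<union> elts c \<longleftrightarrow> x \<in> elts c"
    proof
      show "x \<in> elts c" if "U \<subseteq> (topspace X - C) \<union> elts c"
        using that UC'[of x] by auto
      show "U \<subseteq> (topspace X - C) \<union> elts c" if "x \<in> elts c"
      proof
        fix y assume "y \<in> U"
        then show "y \<in> (topspace X - C) \<union> elts c"
          using that UC'[of y] openin_subset[OF U] by auto
      qed
    qed
    then show ?thesis
      using c U C' by (simp add: le_opens_iff elts_join_opens)
  qed
  have "\<forall>c\<in>up_filter X {x}. vset U \<sqsubseteq>\<^bsub>opens X\<^esub> vset (topspace X - C) \<squnion>\<^bsub>opens X\<^esub> c"
    by (simp add: mem_up_filter le)
  then have "vset U \<sqsubseteq>\<^bsub>opens X\<^esub> vset (topspace X - C) \<squnion>\<^bsub>opens X\<^esub> w"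
    using sep[rule_format, of "vset (topspace X - C)" "vset U"] U C' by simp
  then show "w \<in> up_filter X {x}"
    using w by (simp add: le mem_up_filter)
qed

lemma T0_exact_TD:
  assumes T0: "t0_space X" and exact: "\<And>x. x \<in> topspace X \<Longrightarrow> up_filter X {x} \<in> FiltE (opens X)"
  shows "TD_space X"
  unfolding TD_space_def
proof
  fix x assume x: "x \<in> topspace X"
  let ?cl = "X closure_of {x}"
  have W: "openin X (topspace X - ?cl)"
    by (rule openin_diff) simp_all
  have xcl: "x \<in> ?cl"
    using x by (simp add: in_closure_of)
  then have "vset (topspace X - ?cl) \<notin> up_filter X {x}"
    using W by (simp add: mem_up_filter)
  then obtain a b where ab: "a \<in> carrier (opens X)" "b \<in> carrier (opens X)"
    and le: "\<forall>c\<in>up_filter X {x}. b \<sqsubseteq>\<^bsub>opens X\<^esub> a \<squnion>\<^bsub>opens X\<^esub> c"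
    and not: "\<not> b \<sqsubseteq>\<^bsub>opens X\<^esub> a \<squnion>\<^bsub>opens X\<^esub> vset (topspace X - ?cl)"
    using exact[OF x] W unfolding opens.FiltE_iff by (metis vset_open)
  \<comment> \<open>A point of \<open>b - a\<close> in the closure of \<open>x\<close> has the same neighbourhoods as \<open>x\<close>.\<close>
  have eq_x: "z = x" if z: "z \<in> elts b" "z \<notin> elts a" "z \<in> ?cl" for z
  proof (rule ccontr)
    assume "z \<noteq> x"
    have zX: "z \<in> topspace X"
      using z(3) by (simp add: in_closure_of)
    then obtain V where V: "openin X V" "z \<notin> V \<longleftrightarrow> x \<in> V"
      using T0 x \<open>z \<noteq> x\<close> unfolding t0_space_def by metis
    show False
    proof (cases "x \<in> V")
      case True
      then have "vset V \<in> up_filter X {x}"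
        using V(1) by (simp add: mem_up_filter)
      then have "elts b \<subseteq> elts a \<union> V"
        using bspec[OF le, of "vset V"] ab V(1) by (simp add: le_opens_iff elts_join_opens)
      then show False
        using z True V(2) by blast
    next
      case False
      then show False
        using z(3) V unfolding in_closure_of by blast
    qed
  qed
  have "\<not> elts b \<subseteq> elts a \<union> (topspace X - ?cl)"
    using not ab W by (simp add: le_opens_iff elts_join_opens)
  then obtain z where "z \<in> elts b" "z \<notin> elts a" "z \<in> ?cl"
    using opens_elts_subset[OF ab(2)] by blast
  with eq_x have "x \<in> elts b" "x \<notin> elts a"
    by blast+
  then have "{x} = elts b \<inter> (?cl \<inter> (topspace X - elts a))"
    using eq_x xcl x by blast
  moreover have "openin X (elts b)" "openin X (elts a)"
    using ab by (simp_all add: opens_carrier_iff)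
  moreover from this(2) have "closedin X (?cl \<inter> (topspace X - elts a))"
    by (intro closedin_Int closedin_closure_of closedin_diff closedin_topspace)
  ultimately show "\<exists>U C. openin X U \<and> closedin X C \<and> {x} = U \<inter> C"
    by blast
qed

end

lemma TD_imp_T0:
  assumes "TD_space X"
  shows "t0_space X"
  unfolding t0_space_def
proof (intro ballI impI)
  fix x y assume x: "x \<in> topspace X" and y: "y \<in> topspace X" and xy: "x \<noteq> y"
  obtain U C where U: "openin X U" and C: "closedin X C" and UC: "{x} = U \<inter> C"
    using bspec[OF assms[unfolded TD_space_def] x] by (elim exE conjE) (rule that)
  show "\<exists>U. openin X U \<and> (x \<notin> U \<longleftrightarrow> y \<in> U)"
  proof (cases "y \<in> U")
    case True
    have "z \<in> U \<and> z \<in> C \<longleftrightarrow> z = x" for z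
      unfolding Int_iff[symmetric] UC[symmetric] by simp
    from this[of x] this[of y] True have "x \<in> C" "y \<notin> C"
      using xy by simp_all
    then show ?thesis
      using C y by (intro exI[of _ "topspace X - C"]) (auto simp: closedin_def)
  next
    case False
    then show ?thesis
      using U UC by (intro exI[of _ U]) blast
  qed
qed

lemma TD_Sierpinski: "TD_space Sierpinski"
  unfolding TD_space_def topspace_Sierpinski
proof
  let ?S = "Sierpinski :: 'a topology"
  have S1: "openin ?S {v1}"
    by (simp add: openin_Sierpinski)
  have "topspace ?S - {v1} = {v0}"
    by auto
  then have S0: "closedin ?S {v0}"
    using S1 by (metis closedin_diff closedin_topspace openin_closedin_eq)
  fix x :: 'a assume "x \<in> {v0, v1}"
  then consider "x = v0" | "x = v1"
    by blast
  then show "\<exists>U C. openin ?S U \<and> closedin ?S C \<and> {x} = U \<inter> C"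
  proof cases
    case 1
    with S0 have "openin ?S (topspace ?S) \<and> closedin ?S {v0} \<and>
        {x} = topspace ?S \<inter> {v0}"
      using openin_topspace[of ?S] by auto
    then show ?thesis
      by blast
  next
    case 2
    with S1 have "openin ?S {v1} \<and> closedin ?S (topspace ?S) \<and>
        {x} = {v1} \<inter> topspace ?S"
      using closedin_topspace[of ?S] by auto
    then show ?thesis
      by blast
  qed
qed

text \<open>
  The spectrum of an object is a \<open>T\<^sub>D\<close>-space if all its points are exact. If \<open>p\<close> is the largest element
  not in the filter of a point, and \<open>(a, b)\<close> separates \<open>p\<close> from that filter, then the point is the
  only one that contains \<open>b\<close> but neither \<open>a\<close> nor \<open>p\<close>.
\<close>

lemma (in concrete_pfc) TD_pt_space:
  assumes C: "C \<in> Obj \<C>"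
    and exact: "\<And>f. f \<in> Hom \<C> C \<t> \<Longrightarrow> {a \<in> carrier (\<O> C). app f a = v1} \<in> FiltE (\<O> C)"
  shows "TD_space (pt_space P C)"
  unfolding TD_space_def topspace_pt_space[OF C]
proof
  interpret L: frm "\<O> C" by unfold_locales (rule frame_O[OF C])
  note two_iff = frame_map_two_iff[OF frame_O[OF C]]
  have fm: "frame_map (\<O> C) two (app f)" if "f \<in> Hom \<C> C \<t>" for f
    using Hom_Frm[OF C two_Obj that] by (simp add: O_two)
  have sup: "app f (\<Squnion>\<^bsub>\<O> C\<^esub> A) = v1 \<longleftrightarrow> (\<exists>a\<in>A. app f a = v1)"
    if "f \<in> Hom \<C> C \<t>" "A \<subseteq> carrier (\<O> C)" for f A
    using fm[OF that(1)] that(2) unfolding two_iff by simp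
  have join: "app f (a \<squnion>\<^bsub>\<O> C\<^esub> b) = v1 \<longleftrightarrow> app f a = v1 \<or> app f b = v1"
    if "f \<in> Hom \<C> C \<t>" "a \<in> carrier (\<O> C)" "b \<in> carrier (\<O> C)" for f a b
    using sup[OF that(1), of "{a, b}"] that by (simp add: join_def)
  have mono: "app f b = v1" if "f \<in> Hom \<C> C \<t>" "a \<sqsubseteq>\<^bsub>\<O> C\<^esub> b" "app f a = v1" for f a b
  proof -
    have ab: "a \<in> carrier (\<O> C)" "b \<in> carrier (\<O> C)"
      using L.le_carrier[OF that(2)] by auto
    have "a \<squnion>\<^bsub>\<O> C\<^esub> b = b"
      by (rule L.antisym') (use that(2) ab in \<open>simp_all add: L.join_le_iff L.join_right\<close>)
    then show ?thesis
      using join[OF that(1) ab] that(3) by simp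
  qed
  fix f assume f: "f \<in> Hom \<C> C \<t>"
  let ?N = "{a \<in> carrier (\<O> C). app f a \<noteq> v1}"
  let ?p = "\<Squnion>\<^bsub>\<O> C\<^esub> ?N"
  have N: "?N \<subseteq> carrier (\<O> C)"
    by blast
  have p: "?p \<in> carrier (\<O> C)" "app f ?p \<noteq> v1"
    using sup[OF f N] N by auto
  have le_p: "c \<sqsubseteq>\<^bsub>\<O> C\<^esub> ?p" if "c \<in> carrier (\<O> C)" "app f c \<noteq> v1" for c
    by (rule L.sup_upper[OF N]) (use that in simp)
  obtain a b where ab: "a \<in> carrier (\<O> C)" "b \<in> carrier (\<O> C)"
    and le: "\<forall>c\<in>{a \<in> carrier (\<O> C). app f a = v1}. b \<sqsubseteq>\<^bsub>\<O> C\<^esub> a \<squnion>\<^bsub>\<O> C\<^esub> c"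
    and not: "\<not> b \<sqsubseteq>\<^bsub>\<O> C\<^esub> a \<squnion>\<^bsub>\<O> C\<^esub> ?p"
    using exact[OF f] p unfolding L.FiltE_iff by blast
  have fa: "app f a \<noteq> v1"
  proof
    assume "app f a = v1"
    then have "b \<sqsubseteq>\<^bsub>\<O> C\<^esub> a \<squnion>\<^bsub>\<O> C\<^esub> a"
      using le ab by simp
    moreover have "a \<squnion>\<^bsub>\<O> C\<^esub> a \<sqsubseteq>\<^bsub>\<O> C\<^esub> a \<squnion>\<^bsub>\<O> C\<^esub> ?p"
      using ab p by (simp add: L.join_le_iff L.join_left)
    ultimately show False
      using not L.trans' by blast
  qed
  have fb: "app f b = v1"
  proof (rule ccontr)
    assume "app f b \<noteq> v1"
    then have "b \<sqsubseteq>\<^bsub>\<O> C\<^esub> ?p"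
      using ab by (intro le_p)
    moreover have "?p \<sqsubseteq>\<^bsub>\<O> C\<^esub> a \<squnion>\<^bsub>\<O> C\<^esub> ?p"
      using ab p by (simp add: L.join_right)
    ultimately show False
      using not L.trans' by blast
  qed
  let ?ap = "a \<squnion>\<^bsub>\<O> C\<^esub> ?p"
  have ap: "?ap \<in> carrier (\<O> C)"
    using ab p by simp
  have "g = f" if g: "g \<in> Hom \<C> C \<t>" "app g b = v1" "app g ?ap \<noteq> v1" for g
  proof (rule vfuns_eqI[OF small_O[OF C] Hom_two_vfuns[OF C g(1)] Hom_two_vfuns[OF C f]])
    have gap: "app g a \<noteq> v1" "app g ?p \<noteq> v1"
      using g(3) join[OF g(1) ab(1) p(1)] by simp_all
    fix c assume c: "c \<in> carrier (\<O> C)"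
    have "app g c = v1 \<longleftrightarrow> app f c = v1"
    proof
      assume "app f c = v1"
      then have "b \<sqsubseteq>\<^bsub>\<O> C\<^esub> a \<squnion>\<^bsub>\<O> C\<^esub> c"
        using le c by simp
      then show "app g c = v1"
        using mono[OF g(1) _ g(2)] join[OF g(1) ab(1) c] gap(1) by blast
    next
      assume "app g c = v1"
      then show "app f c = v1"
        using mono[OF g(1) le_p[OF c]] gap(2) by blast
    qed
    then show "app g c = app f c"
      using app_two[OF C g(1) c] app_two[OF C f c] by auto
  qed
  then have "{f} = sigma C b \<inter> (Hom \<C> C \<t> - sigma C ?ap)"
    using f fb fa p(2) join[OF f ab(1) p(1)] by (auto simp: sigma_def)
  moreover have "openin (pt_space P C) (sigma C b)" "openin (pt_space P C) (sigma C ?ap)"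
    using openin_pt_space[OF C] ab(2) ap by blast+
  moreover from this(2) have "closedin (pt_space P C) (Hom \<C> C \<t> - sigma C ?ap)"
    using closedin_diff[OF closedin_topspace, of "pt_space P C"] by (simp add: C)
  ultimately show "\<exists>U Z. openin (pt_space P C) U \<and> closedin (pt_space P C) Z \<and> {f} = U \<inter> Z"
    by blast
qed

section \<open>Raney extensions\<close>

lemma Raney_Obj: "A \<in> Obj Raney_cat \<longleftrightarrow> fst A \<in> Obj Frm_cat \<and> subcolocale (Filt (fst A)) (snd A) \<and>
    FiltE (fst A) \<subseteq> snd A \<and> snd A \<subseteq> FiltSE (fst A)"
  by (cases A) (simp add: Raney_cat_def)

lemma Raney_Hom: "f \<in> Hom Raney_cat A B \<longleftrightarrow> f \<in> Hom Frm_cat (fst A) (fst B) \<and>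
    (\<forall>G\<in>snd B. {a \<in> carrier (fst A). app f a \<in> G} \<in> snd A)"
  by (cases A; cases B) (simp add: Raney_cat_def)

lemma Raney_Idt: "Idt Raney_cat A = vid (carrier (fst A))"
  by (cases A) (simp add: Raney_cat_def)

lemma Raney_Comp: "Comp Raney_cat = vcomp"
  by (simp add: Raney_cat_def)

lemma Raney_frm: "A \<in> Obj Raney_cat \<Longrightarrow> frm (fst A)"
  by unfold_locales (simp add: Raney_Obj)

lemma Raney_E: "L \<in> Obj Frm_cat \<Longrightarrow> (L, FiltE L) \<in> Obj Raney_cat"
  and Raney_SE: "L \<in> Obj Frm_cat \<Longrightarrow> (L, FiltSE L) \<in> Obj Raney_cat"
proof -
  assume L: "L \<in> Obj Frm_cat"
  interpret frm L by unfold_locales (use L in simp)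
  show "(L, FiltE L) \<in> Obj Raney_cat" "(L, FiltSE L) \<in> Obj Raney_cat"
    using L subcolocale_FiltE subcolocale_FiltSE FiltE_subset_FiltSE by (simp_all add: Raney_Obj)
qed

lemma Raney_Inter:
  assumes A: "A \<in> Obj Raney_cat" and B: "\<B> \<subseteq> snd A"
  shows "carrier (fst A) \<inter> \<Inter>\<B> \<in> snd A"
proof -
  interpret frm "fst A" by (rule Raney_frm[OF A])
  show ?thesis
    using A B unfolding Raney_Obj subcolocale_iff by simp
qed

lemma Raney_carrier: "A \<in> Obj Raney_cat \<Longrightarrow> carrier (fst A) \<in> snd A"
  using Raney_Inter[of A "{}"] by simp

lemma Raney_filters:
  assumes A: "A \<in> Obj Raney_cat"
  shows "snd A \<subseteq> filters (fst A)"
  using A by (auto simp: Raney_Obj FiltSE_def)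

lemma vid_vimage:
  assumes A: "A \<in> Obj Raney_cat" and G: "G \<subseteq> carrier (fst A)"
  shows "{a \<in> carrier (fst A). app (vid (carrier (fst A))) a \<in> G} = G"
proof -
  have "small (carrier (fst A))"
    using A by (simp add: Raney_Obj)
  then show ?thesis
    using G by auto
qed

lemma Raney_vid_iff:
  assumes A: "A \<in> Obj Raney_cat" and B: "B \<in> Obj Raney_cat" and eq: "fst B = fst A"
  shows "vid (carrier (fst A)) \<in> Hom Raney_cat A B \<longleftrightarrow> snd B \<subseteq> snd A"
proof -
  have "{a \<in> carrier (fst A). app (vid (carrier (fst A))) a \<in> G} = G" if "G \<in> snd B" for G
    by (rule vid_vimage[OF A]) (use Raney_filters[OF B] that eq in \<open>auto simp: filters_def\<close>)
  moreover have "vid (carrier (fst A)) \<in> Hom Frm_cat (fst A) (fst B)"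
    using categoryD(1)[OF category_Frm, of "fst A"] A unfolding eq Raney_Obj by simp
  ultimately show ?thesis
    unfolding Raney_Hom by (auto simp del: Frm_cat_simps)
qed

lemma Raney_comp_in:
  assumes A: "A \<in> Obj Raney_cat" and B: "B \<in> Obj Raney_cat" and D: "D \<in> Obj Raney_cat"
    and f: "f \<in> Hom Raney_cat A B" and g: "g \<in> Hom Raney_cat B D"
  shows "vcomp g f \<in> Hom Raney_cat A D"
proof -
  have ABD: "fst A \<in> Obj Frm_cat" "fst B \<in> Obj Frm_cat" "fst D \<in> Obj Frm_cat"
    using A B D unfolding Raney_Obj by blast+
  have f': "f \<in> Hom Frm_cat (fst A) (fst B)" and g': "g \<in> Hom Frm_cat (fst B) (fst D)"
    using f g unfolding Raney_Hom by blast+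
  have s: "small (carrier (fst A))" "small (carrier (fst B))"
    and fv: "f \<in> vfuns (carrier (fst A)) (carrier (fst B))"
    and gv: "g \<in> vfuns (carrier (fst B)) (carrier (fst D))"
    using ABD f' g' by simp_all
  have "{a \<in> carrier (fst A). app (vcomp g f) a \<in> G} \<in> snd A" if G: "G \<in> snd D" for G
  proof -
    have "{b \<in> carrier (fst B). app g b \<in> G} \<in> snd B"
      using g G by (simp add: Raney_Hom)
    then have "{a \<in> carrier (fst A). app f a \<in> {b \<in> carrier (fst B). app g b \<in> G}} \<in> snd A"
      using f unfolding Raney_Hom by blast
    also have "{a \<in> carrier (fst A). app f a \<in> {b \<in> carrier (fst B). app g b \<in> G}}
        = {a \<in> carrier (fst A). app (vcomp g f) a \<in> G}"
      using app_vcomp[OF s fv gv] vfuns_app[OF s(1) fv] by auto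
    finally show ?thesis .
  qed
  moreover have "vcomp g f \<in> Hom Frm_cat (fst A) (fst D)"
    using categoryD(2)[OF category_Frm ABD f' g'] unfolding Frm_cat_simps(4) .
  ultimately show ?thesis
    unfolding Raney_Hom by blast
qed

lemma two_R_eq: "two_R = (two, FiltE two)" "two_R = (two, FiltSE two)"
  by (simp_all add: two_R_def FiltE_two FiltSE_two)

lemma two_R_Obj: "two_R \<in> Obj Raney_cat"
  unfolding two_R_eq(1) by (rule Raney_E[OF two_Frm])

text \<open>The points of a Raney extension are the completely prime filters that belong to it.\<close>

lemma Raney_Hom_two:
  assumes A: "A \<in> Obj Raney_cat"
  shows "f \<in> Hom Raney_cat A two_R \<longleftrightarrow> f \<in> Hom Frm_cat (fst A) two \<and>
    {a \<in> carrier (fst A). app f a = v1} \<in> snd A"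
proof -
  have "{a \<in> carrier (fst A). app f a \<in> {v0, v1}} = carrier (fst A)" if "f \<in> Hom Frm_cat (fst A) two"
    using that A vfuns_app[of "carrier (fst A)" f "{v0, v1}"] by (auto simp: Raney_Obj)
  then show ?thesis
    using Raney_carrier[OF A] unfolding Raney_Hom
    by (auto simp: two_R_def filters_two simp del: Frm_cat_simps)
qed

text \<open>
  Frame maps pull strongly exact filters back to strongly exact filters, so the largest Raney
  extension of a frame imposes no condition on arrows out of it.
\<close>

lemma Raney_Hom_SE:
  assumes L: "L \<in> Obj Frm_cat" and B: "B \<in> Obj Raney_cat"
  shows "Hom Raney_cat (L, FiltSE L) B = Hom Frm_cat L (fst B)"
proof -
  have "{a \<in> carrier L. app f a \<in> G} \<in> FiltSE L"
    if f: "f \<in> Hom Frm_cat L (fst B)" and G: "G \<in> snd B" for f G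
  proof -
    interpret frm_map L "fst B" "app f"
      by unfold_locales (use L B f in \<open>simp_all add: Raney_Obj\<close>)
    show ?thesis
      using B G by (intro vimage_FiltSE) (auto simp: Raney_Obj)
  qed
  then show ?thesis
    by (auto simp: Raney_Hom simp del: Frm_cat_simps)
qed

lemma Frm_iso:
  assumes L: "L \<in> Obj Frm_cat" and M: "M \<in> Obj Frm_cat" and t: "is_iso Frm_cat L M t"
  obtains s where "t \<in> Hom Frm_cat L M" "s \<in> Hom Frm_cat M L" "vcomp s t = vid (carrier L)"
    "vcomp t s = vid (carrier M)" "bij_betw (app t) (carrier L) (carrier M)"
proof -
  obtain s where s: "t \<in> Hom Frm_cat L M" "s \<in> Hom Frm_cat M L" "vcomp s t = vid (carrier L)"
    "vcomp t s = vid (carrier M)"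
    using t unfolding is_iso_def is_inverse_def Frm_cat_simps(3,4) by blast
  have sm: "small (carrier L)" "small (carrier M)"
    and tv: "t \<in> vfuns (carrier L) (carrier M)" and sv: "s \<in> vfuns (carrier M) (carrier L)"
    using L M s by simp_all
  have "bij_betw (app t) (carrier L) (carrier M)"
  proof (rule bij_betw_byWitness[where f' = "app s"])
    show "\<forall>a\<in>carrier L. app s (app t a) = a"
      using app_vcomp[OF sm tv sv] s(3) sm by simp
    show "\<forall>b\<in>carrier M. app t (app s b) = b"
      using app_vcomp[OF sm(2,1) sv tv] s(4) sm by simp
    show "app t ` carrier L \<subseteq> carrier M" "app s ` carrier M \<subseteq> carrier L"
      using vfuns_app[OF sm(1) tv] vfuns_app[OF sm(2) sv] by blast+
  qed
  with s that show thesis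
    by blast
qed

lemma O_R_simps [simp]: "Fobj O_R A = fst A" "Farr O_R A B f = f"
  by (simp_all add: O_R_def)

text \<open>
  The fiber-terminal and the fiber-initial extensions of \<open>L\<close> are those by the exact and by the
  strongly exact filters; a given one is compared with these along the identity of \<open>L\<close>.
\<close>

theorem fiber_terminal_iff: "fiber_terminal Raney_cat O_R C \<longleftrightarrow> fst C \<in> Obj Frm_cat \<and> snd C = FiltE (fst C)"
proof
  assume *: "fiber_terminal Raney_cat O_R C"
  then have C: "C \<in> Obj Raney_cat"
    by (simp add: fiber_terminal_def)
  then have L: "fst C \<in> Obj Frm_cat"
    unfolding Raney_Obj by blast
  have "is_iso Frm_cat (fst C) (fst C) (vid (carrier (fst C)))"
    using is_iso_Idt[OF category_Frm L] by simp
  then have "vid (carrier (fst C)) \<in> Hom Raney_cat (fst C, FiltE (fst C)) C"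
    using * Raney_E[OF L] unfolding fiber_terminal_def by fastforce
  then have "snd C \<subseteq> FiltE (fst C)"
    using Raney_vid_iff[OF Raney_E[OF L] C] by simp
  with L C show "fst C \<in> Obj Frm_cat \<and> snd C = FiltE (fst C)"
    by (auto simp: Raney_Obj)
next
  assume *: "fst C \<in> Obj Frm_cat \<and> snd C = FiltE (fst C)"
  then have L: "fst C \<in> Obj Frm_cat" and C: "C \<in> Obj Raney_cat"
    using Raney_E[of "fst C"] by (auto simp del: Frm_cat_simps) (metis prod.collapse)
  have "t \<in> Hom Raney_cat D C" if D: "D \<in> Obj Raney_cat" and t: "is_iso Frm_cat (fst D) (fst C) t" for D t
  proof -
    have M: "fst D \<in> Obj Frm_cat"
      using D unfolding Raney_Obj by blast
    from Frm_iso[OF M L t] obtain s where s: "t \<in> Hom Frm_cat (fst D) (fst C)"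
      "bij_betw (app t) (carrier (fst D)) (carrier (fst C))" by blast
    interpret frm_map "fst D" "fst C" "app t"
      by unfold_locales (use L M s in simp_all)
    have "{a \<in> carrier (fst D). app t a \<in> G} \<in> snd D" if "G \<in> snd C" for G
      using bij_vimage_FiltE[OF s(2), of G] that * D by (auto simp: Raney_Obj)
    with s(1) show ?thesis
      by (simp add: Raney_Hom)
  qed
  with C show "fiber_terminal Raney_cat O_R C"
    by (auto simp: fiber_terminal_def)
qed

theorem fiber_initial_iff: "fiber_initial Raney_cat O_R C \<longleftrightarrow> fst C \<in> Obj Frm_cat \<and> snd C = FiltSE (fst C)"
proof
  assume *: "fiber_initial Raney_cat O_R C"
  then have C: "C \<in> Obj Raney_cat"
    by (simp add: fiber_initial_def)
  then have L: "fst C \<in> Obj Frm_cat"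
    unfolding Raney_Obj by blast
  let ?i = "vid (carrier (fst C))"
  have "is_iso Frm_cat (fst C) (fst C) ?i"
    using is_iso_Idt[OF category_Frm L] by simp
  then obtain p where p: "p \<in> Hom Raney_cat C (fst C, FiltSE (fst C))" "vcomp ?i p = ?i"
    using * Raney_SE[OF L] unfolding fiber_initial_def by fastforce
  have "p \<in> vfuns (carrier (fst C)) (carrier (fst C))" "small (carrier (fst C))"
    using p(1) L by (simp_all add: Raney_Hom)
  then have "p = ?i"
    using p(2) vcomp_vid_left[of "carrier (fst C)" "carrier (fst C)" p] by simp
  then have "FiltSE (fst C) \<subseteq> snd C"
    using p(1) Raney_vid_iff[OF C Raney_SE[OF L]] by simp
  with L C show "fst C \<in> Obj Frm_cat \<and> snd C = FiltSE (fst C)"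
    by (auto simp: Raney_Obj)
next
  assume *: "fst C \<in> Obj Frm_cat \<and> snd C = FiltSE (fst C)"
  then have L: "fst C \<in> Obj Frm_cat" and C_eq: "C = (fst C, FiltSE (fst C))"
    by (simp_all add: prod_eq_iff)
  have C: "C \<in> Obj Raney_cat"
    by (subst C_eq) (rule Raney_SE[OF L])
  have "\<exists>p\<in>Hom Raney_cat C D. vcomp t p = vid (carrier (fst C))"
    if D: "D \<in> Obj Raney_cat" and t: "is_iso Frm_cat (fst D) (fst C) t" for D t
  proof -
    have M: "fst D \<in> Obj Frm_cat"
      using D unfolding Raney_Obj by blast
    from Frm_iso[OF M L t] obtain s where s: "s \<in> Hom Frm_cat (fst C) (fst D)"
      "vcomp t s = vid (carrier (fst C))" by blast
    then have "s \<in> Hom Raney_cat C D"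
      using Raney_Hom_SE[OF L D] by (subst C_eq) simp
    with s(2) show ?thesis
      by blast
  qed
  with C show "fiber_initial Raney_cat O_R C"
    by (simp add: fiber_initial_def)
qed

lemma Obj_RaneyT: "C \<in> Obj RaneyT_cat \<longleftrightarrow> fst C \<in> Obj Frm_cat \<and> snd C = FiltE (fst C)"
proof -
  have "C \<in> Obj RaneyT_cat \<longleftrightarrow> fiber_terminal Raney_cat O_R C"
    by (auto simp: RaneyT_cat_def full_subcat_def fiber_terminal_def)
  then show ?thesis
    by (simp only: fiber_terminal_iff)
qed

lemma Obj_RaneyI: "C \<in> Obj RaneyI_cat \<longleftrightarrow> fst C \<in> Obj Frm_cat \<and> snd C = FiltSE (fst C)"
proof -
  have "C \<in> Obj RaneyI_cat \<longleftrightarrow> fiber_initial Raney_cat O_R C"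
    by (auto simp: RaneyI_cat_def full_subcat_def fiber_initial_def)
  then show ?thesis
    by (simp only: fiber_initial_iff)
qed

lemma FrmE_Hom: "f \<in> Hom FrmE_cat L M \<longleftrightarrow> f \<in> Hom Raney_cat (L, FiltE L) (M, FiltE M)"
  by (simp add: FrmE_cat_def Raney_Hom)

lemma FrmE_simps [simp]: "Obj FrmE_cat = Obj Frm_cat" "Idt FrmE_cat L = vid (carrier L)" "Comp FrmE_cat = vcomp"
  by (simp_all add: FrmE_cat_def)

text \<open>
  Whether a frame map to \<open>\<Omega> X\<close> is an arrow to \<open>\<U> X\<close> is detected by the points of \<open>X\<close>, since every
  filter in \<open>\<U>\<^sup>* X\<close> is an intersection of neighbourhood filters of points.
\<close>

lemma (in small_space) Raney_Obj_saturated: "(opens X, saturated_filters X) \<in> Obj Raney_cat"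
  using opens_Frm[OF small_X] subcolocale_saturated FiltE_saturated saturated_FiltSE
  by (simp add: Raney_Obj del: Frm_cat_simps)

lemma (in small_space) Raney_Hom_saturated:
  assumes D: "D \<in> Obj Raney_cat" and h: "h \<in> Hom Frm_cat (fst D) (opens X)"
  shows "h \<in> Hom Raney_cat D (opens X, saturated_filters X) \<longleftrightarrow>
    (\<forall>x\<in>topspace X. vcomp (point X x) h \<in> Hom Raney_cat D two_R)"
proof -
  have L: "small (carrier (fst D))" "fst D \<in> Obj Frm_cat" and hv: "h \<in> vfuns (carrier (fst D)) (carrier (opens X))"
    using D h by (simp_all add: Raney_Obj)
  let ?pre = "\<lambda>A. {a \<in> carrier (fst D). app h a \<in> up_filter X A}"
  have "vcomp (point X x) h \<in> Hom Raney_cat D two_R \<longleftrightarrow> ?pre {x} \<in> snd D" if x: "x \<in> topspace X" for x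
  proof -
    have "{a \<in> carrier (fst D). app (vcomp (point X x) h) a = v1} = ?pre {x}"
      using vfuns_app[OF L(1) hv] L(1) by (auto simp: vcomp_point[OF L(1) hv] mem_up_filter split: if_splits)
    moreover have "vcomp (point X x) h \<in> Hom Frm_cat (fst D) two"
      using Frm_opens_iff[OF L(2) hv] h x by blast
    ultimately show ?thesis
      unfolding Raney_Hom_two[OF D] by simp
  qed
  moreover have "(\<forall>F\<in>saturated_filters X. {a \<in> carrier (fst D). app h a \<in> F} \<in> snd D) \<longleftrightarrow>
      (\<forall>x\<in>topspace X. ?pre {x} \<in> snd D)"
  proof
    assume *: "\<forall>F\<in>saturated_filters X. {a \<in> carrier (fst D). app h a \<in> F} \<in> snd D"
    show "\<forall>x\<in>topspace X. ?pre {x} \<in> snd D"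
    proof
      fix x assume "x \<in> topspace X"
      then have "up_filter X {x} \<in> saturated_filters X"
        unfolding saturated_filters_eq by auto
      then show "?pre {x} \<in> snd D"
        using * by simp
    qed
  next
    assume *: "\<forall>x\<in>topspace X. ?pre {x} \<in> snd D"
    have "?pre A \<in> snd D" if A: "A \<subseteq> topspace X" for A
    proof -
      have "?pre A = carrier (fst D) \<inter> \<Inter>((\<lambda>x. ?pre {x}) ` A)"
        using vfuns_app[OF L(1) hv] by (auto simp: mem_up_filter)
      also have "\<dots> \<in> snd D"
        by (rule Raney_Inter[OF D]) (use A * in auto)
      finally show ?thesis .
    qed
    then show "\<forall>F\<in>saturated_filters X. {a \<in> carrier (fst D). app h a \<in> F} \<in> snd D"
      unfolding saturated_filters_eq by auto
  qed
  ultimately show ?thesis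
    using h by (simp add: Raney_Hom del: Frm_cat_simps)
qed

text \<open>
  The spaces \<open>Top\<^sub>C\<close> when \<open>C\<close> is \<open>Raney\<^sub>T\<close> or \<open>Frm\<^sub>E\<close>. They need not be \<open>T\<^sub>0\<close>: a two-point indiscrete
  space is one of them.
\<close>

definition exact_spaces :: "'u::universe topology set" where
  "exact_spaces = {X. small (topspace X) \<and> (\<forall>x\<in>topspace X. up_filter X {x} \<in> FiltE (opens X))}"

lemma exact_spaces_small: "X \<in> exact_spaces \<Longrightarrow> small_space X"
  by unfold_locales (simp add: exact_spaces_def)

lemma exact_spaces_saturated: "X \<in> exact_spaces \<Longrightarrow> saturated_filters X = FiltE (opens X)"
  by (rule small_space.saturated_eq_FiltE[OF exact_spaces_small]) (simp_all add: exact_spaces_def)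

lemma TD_exact_spaces: "small (topspace X) \<Longrightarrow> TD_space X \<Longrightarrow> X \<in> exact_spaces"
  using small_space.TD_point_exact[of X] by (simp add: exact_spaces_def small_space_def)

lemma exact_spaces_TD: "X \<in> exact_spaces \<Longrightarrow> t0_space X \<Longrightarrow> TD_space X"
  by (rule small_space.T0_exact_TD[OF exact_spaces_small]) (simp_all add: exact_spaces_def)

lemma T0_exact_spaces: "{X \<in> exact_spaces. t0_space X} = {X. small (topspace X) \<and> TD_space X}"
  by (intro Collect_cong) (metis TD_exact_spaces TD_imp_T0 exact_spaces_TD exact_spaces_small small_space.small_X)

text \<open>
  A lift of \<open>X\<close> is isomorphic to \<open>\<Omega> X\<close>, and exactness of filters is invariant under isomorphism.
\<close>

lemma exact_spaces_if_lift:
  assumes X: "small (topspace X)" and L: "L \<in> Obj Frm_cat" and g: "g \<in> Hom Frm_cat L (opens X)"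
    and bij: "bij_betw (app g) (carrier L) (carrier (opens X))"
    and pts: "\<And>x. x \<in> topspace X \<Longrightarrow> vcomp (point X x) g \<in> Hom Raney_cat (L, FiltE L) two_R"
  shows "X \<in> exact_spaces"
proof -
  interpret X: small_space X by unfold_locales fact
  let ?r = "inv_into (carrier L) (app g)"
  have L': "frame L" "small (carrier L)" and gv: "g \<in> vfuns (carrier L) (carrier (opens X))"
    and gm: "frame_map L (opens X) (app g)"
    using L g by simp_all
  interpret r: frm_map "opens X" L ?r
    by unfold_locales (rule L'(1), rule frame_map_inv_into[OF L'(1) gm bij])
  have gr: "?r u \<in> carrier L" "app g (?r u) = u" if "u \<in> carrier (opens X)" for u
    using that inv_into_into[of u "app g" "carrier L"] f_inv_into_f[of u "app g" "carrier L"]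
      bij_betw_imp_surj_on[OF bij] by simp_all
  have "up_filter X {x} \<in> FiltE (opens X)" if x: "x \<in> topspace X" for x
  proof -
    let ?F = "{a \<in> carrier L. app g a \<in> up_filter X {x}}"
    have "{a \<in> carrier L. app (vcomp (point X x) g) a = v1} = ?F"
      using vfuns_app[OF L'(2) gv] L'(2)
      by (auto simp: X.vcomp_point[OF L'(2) gv] mem_up_filter split: if_splits)
    then have "?F \<in> FiltE L"
      using pts[OF x] Raney_Hom_two[OF Raney_E[OF L]] by simp
    then have "{u \<in> carrier (opens X). ?r u \<in> ?F} \<in> FiltE (opens X)"
      by (rule r.bij_vimage_FiltE[OF bij_betw_inv_into[OF bij]])
    also have "{u \<in> carrier (opens X). ?r u \<in> ?F} = up_filter X {x}"
      using gr by (auto simp: mem_up_filter)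
    finally show ?thesis .
  qed
  with X show ?thesis
    by (simp add: exact_spaces_def)
qed

section \<open>The five SFC-categories\<close>

text \<open>The spaces \<open>Top\<^sub>C\<close> when \<open>C\<close> is \<open>Raney\<close>, \<open>Raney\<^sub>I\<close> or \<open>Frm\<close>.\<close>

definition all_spaces :: "'u::universe topology set" where
  "all_spaces = {X. small (topspace X)}"

lemma full_subcat_simps [simp]:
  "A \<in> Obj (full_subcat C S) \<longleftrightarrow> A \<in> Obj C \<and> A \<in> S" "Hom (full_subcat C S) = Hom C"
  "Idt (full_subcat C S) = Idt C" "Comp (full_subcat C S) = Comp C"
  by (simp_all add: full_subcat_def)

text \<open>Full subcategories of the category of Raney extensions, with a choice \<open>\<Omega>\<close> of lifts.\<close>

definition sfc_sub :: "('u::universe raney) set \<Rightarrow> ('u topology \<Rightarrow> 'u raney) \<Rightarrow> ('u raney, 'u) sfc" where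
  "sfc_sub S \<Omega> = \<lparr>sfc_cat = full_subcat Raney_cat S, sfc_O = O_R, sfc_two = two_R,
     sfc_iota = Idt Frm_cat two, lift_ob = \<Omega>, lift_arr = char_arr\<rparr>"

lemma sfc_sub_simps [simp]:
  "sfc_cat (sfc_sub S \<Omega>) = full_subcat Raney_cat S" "sfc_O (sfc_sub S \<Omega>) = O_R"
  "sfc_two (sfc_sub S \<Omega>) = two_R" "sfc_iota (sfc_sub S \<Omega>) = Idt Frm_cat two"
  "lift_ob (sfc_sub S \<Omega>) = \<Omega>" "lift_arr (sfc_sub S \<Omega>) = char_arr"
  by (simp_all add: sfc_sub_def)

lemma concrete_pfc_sub:
  assumes "two_R \<in> S"
  shows "concrete_pfc (sfc_sub S \<Omega>)"
proof (unfold_locales, unfold sfc_sub_simps full_subcat_simps O_R_simps)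
  fix A :: "'a raney" assume A: "A \<in> Obj Raney_cat \<and> A \<in> S"
  then show "fst A \<in> Obj Frm_cat"
    unfolding Raney_Obj by blast
  show "vid (carrier (fst A)) \<in> Hom Raney_cat A A"
    using A by (simp add: Raney_vid_iff)
  fix B f assume B: "B \<in> Obj Raney_cat \<and> B \<in> S" and f: "f \<in> Hom Raney_cat A B"
  then show "f \<in> Hom Frm_cat (fst A) (fst B)"
    unfolding Raney_Hom by blast
  fix D g assume "D \<in> Obj Raney_cat \<and> D \<in> S" "g \<in> Hom Raney_cat B D"
  then show "vcomp g f \<in> Hom Raney_cat A D"
    using A B f Raney_comp_in by blast
qed (use assms two_R_Obj in \<open>simp_all add: Raney_Comp Raney_Idt two_R_def\<close>)

lemma sfc_Raney_eq: "sfc_Raney = sfc_sub UNIV (Fobj U_func)"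
  by (simp add: sfc_Raney_def sfc_sub_def full_subcat_def)

lemma sfc_RaneyI_eq: "sfc_RaneyI = sfc_sub {C. fiber_initial Raney_cat O_R C} (Fobj (FiltSE_func \<circ>\<^sub>F O_R \<circ>\<^sub>F U_func))"
  by (simp add: sfc_RaneyI_def sfc_sub_def RaneyI_cat_def)

lemma sfc_RaneyT_eq: "sfc_RaneyT = sfc_sub {C. fiber_terminal Raney_cat O_R C} (Fobj U_func)"
  by (simp add: sfc_RaneyT_def sfc_sub_def RaneyT_cat_def)

lemma two_R_fiber: "fiber_initial Raney_cat O_R two_R" "fiber_terminal Raney_cat O_R two_R"
  using two_Frm by (simp_all add: fiber_initial_iff fiber_terminal_iff two_R_def FiltE_two FiltSE_two
      del: Frm_cat_simps)

lemma U_func_simps [simp]: "Fobj U_func X = (opens X, saturated_filters X)" "Farr U_func X Y f = preimage_arr X Y f"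
  by (simp_all add: U_func_def)

lemma FiltSE_func_simps [simp]: "Fobj FiltSE_func L = (L, FiltSE L)" "Farr FiltSE_func L M f = f"
  by (simp_all add: FiltSE_func_def)

lemma Omega_simps [simp]: "Fobj Omega X = opens X" "Farr Omega X Y f = preimage_arr X Y f"
  by (simp_all add: Omega_def)

interpretation Raney: concrete_pfc sfc_Raney
  unfolding sfc_Raney_eq by (rule concrete_pfc_sub) simp

interpretation RaneyI: concrete_pfc sfc_RaneyI
  unfolding sfc_RaneyI_eq by (rule concrete_pfc_sub) (simp add: two_R_fiber)

interpretation RaneyT: concrete_pfc sfc_RaneyT
  unfolding sfc_RaneyT_eq by (rule concrete_pfc_sub) (simp add: two_R_fiber)

lemma sfc_Raney_simps [simp]:
  "sfc_cat sfc_Raney = Raney_cat" "sfc_O sfc_Raney = O_R" "sfc_two sfc_Raney = two_R"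
  "lift_ob sfc_Raney = Fobj U_func" "lift_arr sfc_Raney = char_arr"
  by (simp_all add: sfc_Raney_def)

lemma sfc_RaneyI_simps [simp]:
  "sfc_cat sfc_RaneyI = RaneyI_cat" "sfc_O sfc_RaneyI = O_R" "sfc_two sfc_RaneyI = two_R"
  "lift_ob sfc_RaneyI = Fobj (FiltSE_func \<circ>\<^sub>F O_R \<circ>\<^sub>F U_func)" "lift_arr sfc_RaneyI = char_arr"
  by (simp_all add: sfc_RaneyI_def)

lemma sfc_RaneyT_simps [simp]:
  "sfc_cat sfc_RaneyT = RaneyT_cat" "sfc_O sfc_RaneyT = O_R" "sfc_two sfc_RaneyT = two_R"
  "lift_ob sfc_RaneyT = Fobj U_func" "lift_arr sfc_RaneyT = char_arr"
  by (simp_all add: sfc_RaneyT_def)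

lemma sfc_FrmE_simps [simp]:
  "sfc_cat sfc_FrmE = FrmE_cat" "sfc_O sfc_FrmE = incl" "sfc_two sfc_FrmE = two"
  "sfc_iota sfc_FrmE = Idt Frm_cat two" "lift_ob sfc_FrmE = opens" "lift_arr sfc_FrmE = char_arr"
  by (simp_all add: sfc_FrmE_def Omega_def)

lemma sfc_Frm_simps [simp]:
  "sfc_cat sfc_Frm = Frm_cat" "sfc_O sfc_Frm = incl" "sfc_two sfc_Frm = two"
  "sfc_iota sfc_Frm = Idt Frm_cat two" "lift_ob sfc_Frm = opens" "lift_arr sfc_Frm = char_arr"
  by (simp_all add: sfc_Frm_def Omega_def)

lemma Hom_RaneyI [simp]: "Hom RaneyI_cat = Hom Raney_cat"
  by (simp add: RaneyI_cat_def)

lemma Hom_RaneyT [simp]: "Hom RaneyT_cat = Hom Raney_cat"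
  by (simp add: RaneyT_cat_def)

lemma RaneyT_Raney: "C \<in> Obj RaneyT_cat \<Longrightarrow> C \<in> Obj Raney_cat"
  by (simp add: RaneyT_cat_def)

lemma RaneyI_Raney: "C \<in> Obj RaneyI_cat \<Longrightarrow> C \<in> Obj Raney_cat"
  by (simp add: RaneyI_cat_def)

lemma FrmE_pfc: "concrete_pfc sfc_FrmE"
proof (unfold_locales, unfold sfc_FrmE_simps FrmE_simps incl_simps)
  fix A :: "'a gorder" assume A: "A \<in> Obj Frm_cat"
  show "vid (carrier A) \<in> Hom FrmE_cat A A"
    using Raney_vid_iff[OF Raney_E[OF A] Raney_E[OF A]] by (simp add: FrmE_Hom)
  fix B f assume B: "B \<in> Obj Frm_cat" and f: "f \<in> Hom FrmE_cat A B"
  then show "f \<in> Hom Frm_cat A B"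
    by (simp add: FrmE_Hom Raney_Hom)
  fix D g assume D: "D \<in> Obj Frm_cat" and g: "g \<in> Hom FrmE_cat B D"
  show "vcomp g f \<in> Hom FrmE_cat A D"
    using Raney_comp_in[OF Raney_E[OF A] Raney_E[OF B] Raney_E[OF D]] f g by (simp add: FrmE_Hom)
qed (use two_Frm in \<open>simp_all del: Frm_cat_simps(1)\<close>)

interpretation FrmE: concrete_pfc sfc_FrmE
  by (rule FrmE_pfc)

lemma Frm_pfc: "concrete_pfc sfc_Frm"
proof (unfold_locales, unfold sfc_Frm_simps incl_simps)
  fix A :: "'a gorder" assume A: "A \<in> Obj Frm_cat"
  then show "vid (carrier A) \<in> Hom Frm_cat A A"
    using categoryD(1)[OF category_Frm A] by simp
  fix B D f g assume "B \<in> Obj Frm_cat" "D \<in> Obj Frm_cat" "f \<in> Hom Frm_cat A B" "g \<in> Hom Frm_cat B D"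
  then show "vcomp g f \<in> Hom Frm_cat A D"
    using categoryD(2)[OF category_Frm A, of B D f g] unfolding Frm_cat_simps(4) by blast
qed (use two_Frm in \<open>simp_all del: Frm_cat_simps(1)\<close>)

interpretation Frm: concrete_pfc sfc_Frm
  by (rule Frm_pfc)

lemma RaneyT_TD: "C \<in> Obj RaneyT_cat \<Longrightarrow> TD_space (pt_space sfc_RaneyT C)"
  using Raney_Hom_two[OF RaneyT_Raney[of C]]
  by (intro RaneyT.TD_pt_space) (simp_all add: Obj_RaneyT del: Frm_cat_simps)

lemma FrmE_TD: "L \<in> Obj Frm_cat \<Longrightarrow> TD_space (pt_space sfc_FrmE L)"
  using Raney_Hom_two[OF Raney_E[of L]]
  by (intro FrmE.TD_pt_space) (simp_all add: FrmE_Hom two_R_eq(1) del: Frm_cat_simps)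

interpretation Raney: concrete_sfc sfc_Raney all_spaces
proof (unfold_locales, unfold sfc_Raney_simps O_R_simps U_func_simps fst_conv)
  fix X :: "'a topology" and D h
  assume X: "X \<in> all_spaces"
  then interpret small_space X by unfold_locales (simp add: all_spaces_def)
  show "(opens X, saturated_filters X) \<in> Obj Raney_cat"
    by (rule Raney_Obj_saturated)
  show "h \<in> Hom Raney_cat D (opens X, saturated_filters X) \<longleftrightarrow>
      (\<forall>x\<in>topspace X. vcomp (point X x) h \<in> Hom Raney_cat D two_R)"
    if "D \<in> Obj Raney_cat" "h \<in> Hom Frm_cat (fst D) (opens X)"
    using that by (rule Raney_Hom_saturated)
next
  fix C :: "'a raney" assume "C \<in> Obj Raney_cat"
  then show "pt_space sfc_Raney C \<in> all_spaces"
    using small_space.small_X[OF Raney.small_pt_space[of C]] by (simp add: all_spaces_def)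
qed (simp_all add: all_spaces_def)

interpretation RaneyI: concrete_sfc sfc_RaneyI all_spaces
proof (unfold_locales, unfold sfc_RaneyI_simps O_R_simps U_func_simps comp_func_simps FiltSE_func_simps
    fst_conv Hom_RaneyI)
  fix X :: "'a topology" and D h
  assume X: "X \<in> all_spaces"
  then interpret small_space X by unfold_locales (simp add: all_spaces_def)
  show X': "(opens X, FiltSE (opens X)) \<in> Obj RaneyI_cat"
    using opens_Frm[OF small_X] by (simp add: Obj_RaneyI del: Frm_cat_simps)
  assume D: "D \<in> Obj RaneyI_cat" and h: "h \<in> Hom Frm_cat (fst D) (opens X)"
  have D': "fst D \<in> Obj Frm_cat" "(fst D, FiltSE (fst D)) = D"
    using D by (simp_all add: Obj_RaneyI prod_eq_iff)
  have Hom: "Hom Raney_cat D B = Hom Frm_cat (fst D) (fst B)" if "B \<in> Obj Raney_cat" for B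
    using Raney_Hom_SE[OF D'(1) that] D'(2) by simp
  have "h \<in> vfuns (carrier (fst D)) (carrier (opens X))"
    using h by simp
  from Frm_opens_iff[OF D'(1) this]
  show "h \<in> Hom Raney_cat D (opens X, FiltSE (opens X)) \<longleftrightarrow>
      (\<forall>x\<in>topspace X. vcomp (point X x) h \<in> Hom Raney_cat D two_R)"
    unfolding Hom[OF two_R_Obj] Hom[OF RaneyI_Raney[OF X']] by (simp add: two_R_def del: Frm_cat_simps)
next
  fix C :: "'a raney" assume "C \<in> Obj RaneyI_cat"
  then show "pt_space sfc_RaneyI C \<in> all_spaces"
    using small_space.small_X[OF RaneyI.small_pt_space[of C]] by (simp add: all_spaces_def)
qed (simp_all add: all_spaces_def)

interpretation RaneyT: concrete_sfc sfc_RaneyT exact_spaces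
proof (unfold_locales, unfold sfc_RaneyT_simps O_R_simps U_func_simps fst_conv Hom_RaneyT)
  fix X :: "'a topology" and D h
  assume X: "X \<in> exact_spaces"
  then interpret small_space X by (rule exact_spaces_small)
  show "small (topspace X)"
    by simp
  show "(opens X, saturated_filters X) \<in> Obj RaneyT_cat"
    using opens_Frm[OF small_X] exact_spaces_saturated[OF X] by (simp add: Obj_RaneyT del: Frm_cat_simps)
  show "h \<in> Hom Raney_cat D (opens X, saturated_filters X) \<longleftrightarrow>
      (\<forall>x\<in>topspace X. vcomp (point X x) h \<in> Hom Raney_cat D two_R)"
    if "D \<in> Obj RaneyT_cat" "h \<in> Hom Frm_cat (fst D) (opens X)"
    using RaneyT_Raney[OF that(1)] that(2) by (rule Raney_Hom_saturated)
next
  fix X :: "'a topology" and Y g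
  assume X: "small (topspace X)" and Y: "Y \<in> Obj RaneyT_cat"
    and g: "g \<in> Hom Frm_cat (fst Y) (opens X)" "bij_betw (app g) (carrier (fst Y)) (carrier (opens X))"
      "\<And>x. x \<in> topspace X \<Longrightarrow> vcomp (point X x) g \<in> Hom Raney_cat Y two_R"
  have Y': "fst Y \<in> Obj Frm_cat" "(fst Y, FiltE (fst Y)) = Y"
    using Y by (simp_all add: Obj_RaneyT prod_eq_iff)
  show "X \<in> exact_spaces"
    by (rule exact_spaces_if_lift[OF X Y'(1) g(1,2), unfolded Y'(2), OF g(3)])
next
  show "Sierpinski \<in> exact_spaces"
    by (rule TD_exact_spaces[OF _ TD_Sierpinski]) simp
  fix C :: "'a raney" assume C: "C \<in> Obj RaneyT_cat"
  then show "pt_space sfc_RaneyT C \<in> exact_spaces"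
    using small_space.small_X[OF RaneyT.small_pt_space[of C]] TD_exact_spaces[OF _ RaneyT_TD[OF C]] by simp
qed simp_all

interpretation FrmE: concrete_sfc sfc_FrmE exact_spaces
proof (unfold_locales, unfold sfc_FrmE_simps incl_simps FrmE_simps)
  fix X :: "'a topology" and D h
  assume X: "X \<in> exact_spaces"
  then interpret small_space X by (rule exact_spaces_small)
  show "small (topspace X)"
    by simp
  show "opens X \<in> Obj Frm_cat"
    by (rule opens_Frm[OF small_X])
  assume D: "D \<in> Obj Frm_cat" and h: "h \<in> Hom Frm_cat D (opens X)"
  show "h \<in> Hom FrmE_cat D (opens X) \<longleftrightarrow> (\<forall>x\<in>topspace X. vcomp (point X x) h \<in> Hom FrmE_cat D two)"
    using Raney_Hom_saturated[OF Raney_E[OF D], of h] h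
    by (simp add: FrmE_Hom two_R_eq(1) exact_spaces_saturated[OF X] del: Frm_cat_simps)
next
  fix X :: "'a topology" and Y g
  assume X: "small (topspace X)" and Y: "Y \<in> Obj Frm_cat"
    and g: "g \<in> Hom Frm_cat Y (opens X)" "bij_betw (app g) (carrier Y) (carrier (opens X))"
      "\<And>x. x \<in> topspace X \<Longrightarrow> vcomp (point X x) g \<in> Hom FrmE_cat Y two"
  show "X \<in> exact_spaces"
    using g(3) by (intro exact_spaces_if_lift[OF X Y g(1,2)]) (simp add: FrmE_Hom two_R_eq(1))
next
  show "Sierpinski \<in> exact_spaces"
    by (rule TD_exact_spaces[OF _ TD_Sierpinski]) simp
  fix C :: "'a gorder" assume C: "C \<in> Obj Frm_cat"
  then show "pt_space sfc_FrmE C \<in> exact_spaces"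
    using small_space.small_X[OF FrmE.small_pt_space[of C]] TD_exact_spaces[OF _ FrmE_TD[OF C]] by simp
qed simp_all

interpretation Frm: concrete_sfc sfc_Frm all_spaces
proof (unfold_locales, unfold sfc_Frm_simps incl_simps)
  fix X :: "'a topology" and D h
  assume X: "X \<in> all_spaces"
  then interpret small_space X by unfold_locales (simp add: all_spaces_def)
  show "opens X \<in> Obj Frm_cat"
    by (rule opens_Frm[OF small_X])
  assume D: "D \<in> Obj Frm_cat" and h: "h \<in> Hom Frm_cat D (opens X)"
  then show "h \<in> Hom Frm_cat D (opens X) \<longleftrightarrow> (\<forall>x\<in>topspace X. vcomp (point X x) h \<in> Hom Frm_cat D two)"
    by (intro Frm_opens_iff) simp_all
next
  fix C :: "'a gorder" assume "C \<in> Obj Frm_cat"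
  then show "pt_space sfc_Frm C \<in> all_spaces"
    using small_space.small_X[OF Frm.small_pt_space[of C]] by (simp add: all_spaces_def)
qed (simp_all add: all_spaces_def)


section \<open>The diagram\<close>

interpretation Filt: concrete_sfc_mor sfc_Raney all_spaces sfc_RaneyI all_spaces "FiltSE_func \<circ>\<^sub>F O_R"
proof (unfold_locales, unfold sfc_Raney_simps sfc_RaneyI_simps comp_func_simps O_R_simps FiltSE_func_simps
    fst_conv Hom_RaneyI)
  fix A B :: "'a raney" and f
  assume A: "A \<in> Obj Raney_cat"
  then have L: "fst A \<in> Obj Frm_cat"
    unfolding Raney_Obj by blast
  then show "(fst A, FiltSE (fst A)) \<in> Obj RaneyI_cat"
    by (simp add: Obj_RaneyI)
  assume B: "B \<in> Obj Raney_cat" and f: "f \<in> Hom Raney_cat A B"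
  then have "fst B \<in> Obj Frm_cat"
    unfolding Raney_Obj by blast
  from Raney_Hom_SE[OF L Raney_SE[OF this]]
  show "f \<in> Hom Raney_cat (fst A, FiltSE (fst A)) (fst B, FiltSE (fst B))"
    using f by (simp add: Raney_Hom del: Frm_cat_simps)
qed (simp_all add: two_R_def FiltSE_two)

lemma exact_spaces_sub: "exact_spaces \<subseteq> all_spaces"
  by (auto simp: exact_spaces_def all_spaces_def)

interpretation IT: concrete_sfc_mor sfc_RaneyT exact_spaces sfc_Raney all_spaces incl
  by unfold_locales (simp_all add: RaneyT_Raney exact_spaces_sub)

lemma RaneyT_Hom:
  assumes "A \<in> Obj RaneyT_cat" "B \<in> Obj RaneyT_cat"
  shows "Hom Raney_cat A B = Hom FrmE_cat (fst A) (fst B)"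
proof -
  have "A = (fst A, FiltE (fst A))" "B = (fst B, FiltE (fst B))"
    using assms by (simp_all add: Obj_RaneyT prod_eq_iff)
  then show ?thesis
    using FrmE_Hom[of _ "fst A" "fst B"] by auto
qed

interpretation OIT: concrete_sfc_mor sfc_RaneyT exact_spaces sfc_FrmE exact_spaces "O_R \<circ>\<^sub>F incl"
proof (unfold_locales, unfold sfc_RaneyT_simps sfc_FrmE_simps comp_func_simps incl_simps O_R_simps FrmE_simps
    Hom_RaneyT)
  fix A B :: "'a raney" and f
  assume A: "A \<in> Obj RaneyT_cat"
  then show "fst A \<in> Obj Frm_cat"
    unfolding Obj_RaneyT by blast
  assume "B \<in> Obj RaneyT_cat" "f \<in> Hom Raney_cat A B"
  then show "f \<in> Hom FrmE_cat (fst A) (fst B)"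
    using RaneyT_Hom[OF A] by simp
qed (simp_all add: two_R_def)

interpretation E: concrete_sfc_mor sfc_FrmE exact_spaces sfc_Frm all_spaces incl
  by unfold_locales (simp_all add: exact_spaces_sub FrmE_Hom Raney_Hom)

lemma op_Top_all: "op_cat Top_cat = op_Top (all_spaces :: 'u::universe topology set)"
proof -
  have "Obj Top_cat \<inter> all_spaces = Obj (Top_cat :: ('u topology, 'u) cat)"
    by (auto simp: all_spaces_def)
  then show ?thesis
    by (simp add: full_subcat_def)
qed

lemma T0_sub: "{X \<in> exact_spaces. t0_space X} \<subseteq> exact_spaces"
  by blast

lemma op_TopD:
  "op_cat TopD_cat = op_Top {X \<in> exact_spaces. t0_space (X :: 'u::universe topology)}"
proof -
  have "Obj Top_cat \<inter> {X. TD_space X} = Obj Top_cat \<inter> {X :: 'u topology. small (topspace X) \<and> TD_space X}"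
    by auto
  then show ?thesis
    by (simp only: TopD_cat_def full_subcat_def T0_exact_spaces)
qed

lemma RaneyT_pt_T0: "C \<in> Obj (sfc_cat sfc_RaneyT) \<Longrightarrow> pt_space sfc_RaneyT C \<in> {X \<in> exact_spaces. t0_space X}"
  using RaneyT.pt_K[of C] TD_imp_T0[OF RaneyT_TD[of C]] by simp

lemma FrmE_pt_T0: "C \<in> Obj (sfc_cat sfc_FrmE) \<Longrightarrow> pt_space sfc_FrmE C \<in> {X \<in> exact_spaces. t0_space X}"
  using FrmE.pt_K[of C] TD_imp_T0[OF FrmE_TD[of C]] by (simp del: Frm_cat_simps)

text \<open>The inverse equivalence sends \<open>L\<close> to its extension by the exact filters.\<close>

lemma equivalence_OIT:
  "equivalence_functor RaneyT_cat FrmE_cat (O_R \<circ>\<^sub>F incl :: ('u::universe raney, 'u, 'u gorder, 'u) func)"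
proof -
  let ?F = "O_R \<circ>\<^sub>F incl :: ('u raney, 'u, 'u gorder, 'u) func"
  let ?G = "\<lparr>Fobj = (\<lambda>L. (L, FiltE L)), Farr = (\<lambda>L M f. f)\<rparr> :: ('u gorder, 'u, 'u raney, 'u) func"
  have T: "category (RaneyT_cat :: ('u raney, 'u) cat)" and E: "category (FrmE_cat :: ('u gorder, 'u) cat)"
    using RaneyT.category_C FrmE.category_C by simp_all
  have G_Obj: "(L, FiltE L) \<in> Obj RaneyT_cat" if "L \<in> Obj FrmE_cat" for L :: "'u gorder"
    using that by (simp add: Obj_RaneyT)
  have T_eq: "(fst A, FiltE (fst A)) = A" if "A \<in> Obj RaneyT_cat" for A :: "'u raney"
    using that by (simp add: Obj_RaneyT prod_eq_iff)
  have Idt_T: "Idt RaneyT_cat A = vid (carrier (fst A))" for A :: "'u raney"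
    by (simp add: RaneyT_cat_def Raney_Idt)
  have Comp_T: "Comp RaneyT_cat = (vcomp :: 'u \<Rightarrow> _)"
    by (simp add: RaneyT_cat_def Raney_Comp)
  have F: "is_functor RaneyT_cat FrmE_cat ?F"
    using OIT.H_functor by simp
  have G: "is_functor FrmE_cat RaneyT_cat ?G"
    using G_Obj by (simp add: is_functor_def Idt_T Comp_T FrmE_Hom)
  have s: "nat_iso RaneyT_cat RaneyT_cat incl (?G \<circ>\<^sub>F ?F) (Idt RaneyT_cat)"
    unfolding nat_iso_def nat_trans_def
    using is_iso_Idt[OF T] categoryD(1,3,4)[OF T] by (simp add: T_eq)
  have t: "nat_iso FrmE_cat FrmE_cat (?F \<circ>\<^sub>F ?G) incl (Idt FrmE_cat)"
    unfolding nat_iso_def nat_trans_def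
    using is_iso_Idt[OF E] categoryD(1,3,4)[OF E] by (simp del: Frm_cat_simps(1))
  show ?thesis
    unfolding equivalence_functor_def using F G s t by blast
qed

lemma two_R_T: "two_R \<in> Obj RaneyT_cat"
  by (simp add: Obj_RaneyT two_R_def FiltE_two frame_two)

lemma RaneyT_Hom_two: "C \<in> Obj RaneyT_cat \<Longrightarrow> Hom FrmE_cat (fst C) two = Hom Raney_cat C two_R"
  using RaneyT_Hom[OF _ two_R_T, of C] by (simp add: two_R_def)

lemma pt_simps:
  "Fobj pt_R C = hom_space (Hom Raney_cat C two_R) (carrier (fst C))"
  "Farr pt_R C D f = vgraph (Hom Raney_cat D two_R) (\<lambda>g. vcomp g f)"
  "Fobj pt_E L = hom_space (Hom FrmE_cat L two) (carrier L)"
  "Farr pt_E L M f = vgraph (Hom FrmE_cat M two) (\<lambda>g. vcomp g f)"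
  "Fobj pt L = hom_space (Hom Frm_cat L two) (carrier L)"
  "Farr pt L M f = vgraph (Hom Frm_cat M two) (\<lambda>g. vcomp g f)"
  by (simp_all add: pt_R_def pt_E_def pt_def)

theorem theorem3p25:
  shows
    \<comment> \<open>morphisms of SFC-categories\<close>
    "sfc_morphism sfc_RaneyT sfc_Raney (mor_IT :: ('u::universe raney, 'u raney, 'u) sfc_mor) \<and>
     sfc_morphism sfc_Raney sfc_RaneyI (mor_Filt :: ('u raney, 'u raney, 'u) sfc_mor) \<and>
     sfc_morphism sfc_RaneyT sfc_FrmE (mor_OIT :: ('u raney, 'u gorder, 'u) sfc_mor) \<and>
     sfc_morphism sfc_FrmE sfc_Frm (mor_E :: ('u gorder, 'u gorder, 'u) sfc_mor) \<and>
     \<comment> \<open>(A1) -- (A5)\<close>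
     adjunction_between (Dual (sfc_RaneyI :: ('u raney, 'u) sfc))
       RaneyI_cat (op_cat Top_cat) pt_R (FiltSE_func \<circ>\<^sub>F O_R \<circ>\<^sub>F U_func) \<and>
     adjunction_between (Dual (sfc_Raney :: ('u raney, 'u) sfc))
       Raney_cat (op_cat Top_cat) pt_R U_func \<and>
     adjunction_between (T0_part (Dual (sfc_RaneyT :: ('u raney, 'u) sfc)))
       RaneyT_cat (op_cat TopD_cat) pt_R U_func \<and>
     adjunction_between (T0_part (Dual (sfc_FrmE :: ('u gorder, 'u) sfc)))
       FrmE_cat (op_cat TopD_cat) pt_E Omega \<and>
     adjunction_between (Dual (sfc_Frm :: ('u gorder, 'u) sfc))
       Frm_cat (op_cat Top_cat) pt Omega \<and>
     \<comment> \<open>the morphisms of the diagram\<close>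
     right_adj_morphism (Dual sfc_Raney) (Dual sfc_RaneyI)
       (Dual_mor sfc_Raney sfc_RaneyI (mor_Filt :: ('u raney, 'u raney, 'u) sfc_mor)) \<and>
     strong_adj_morphism (T0_part (Dual sfc_RaneyT)) (Dual sfc_Raney)
       (Dual_mor sfc_RaneyT sfc_Raney (mor_IT :: ('u raney, 'u raney, 'u) sfc_mor)) \<and>
     strong_adj_morphism (T0_part (Dual sfc_RaneyT)) (T0_part (Dual sfc_FrmE))
       (Dual_mor sfc_RaneyT sfc_FrmE (mor_OIT :: ('u raney, 'u gorder, 'u) sfc_mor)) \<and>
     right_adj_morphism (T0_part (Dual sfc_FrmE)) (Dual sfc_Frm)
       (Dual_mor sfc_FrmE sfc_Frm (mor_E :: ('u gorder, 'u gorder, 'u) sfc_mor)) \<and>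
     equivalence_functor RaneyT_cat FrmE_cat
       (O_R \<circ>\<^sub>F incl :: ('u raney, 'u, 'u gorder, 'u) func) \<and>
     \<comment> \<open>the same for the unrestricted duals\<close>
     strong_adj_morphism (Dual sfc_RaneyT) (Dual sfc_Raney)
       (Dual_mor sfc_RaneyT sfc_Raney (mor_IT :: ('u raney, 'u raney, 'u) sfc_mor)) \<and>
     strong_adj_morphism (Dual sfc_RaneyT) (Dual sfc_FrmE)
       (Dual_mor sfc_RaneyT sfc_FrmE (mor_OIT :: ('u raney, 'u gorder, 'u) sfc_mor)) \<and>
     right_adj_morphism (Dual sfc_FrmE) (Dual sfc_Frm)
       (Dual_mor sfc_FrmE sfc_Frm (mor_E :: ('u gorder, 'u gorder, 'u) sfc_mor))"
proof (intro conjI)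
  note dual = Raney.Dual_eq_Dual_on RaneyI.Dual_eq_Dual_on RaneyT.Dual_eq_Dual_on FrmE.Dual_eq_Dual_on
    Frm.Dual_eq_Dual_on and dual_T0 = RaneyT.T0_part_Dual_eq FrmE.T0_part_Dual_eq
  show "sfc_morphism sfc_RaneyT sfc_Raney mor_IT"
    unfolding mor_IT_def by (rule IT.sfc_morphism)
  show "sfc_morphism sfc_Raney sfc_RaneyI mor_Filt"
    unfolding mor_Filt_def by (rule Filt.sfc_morphism)
  show "sfc_morphism sfc_RaneyT sfc_FrmE mor_OIT"
    unfolding mor_OIT_def by (rule OIT.sfc_morphism)
  show "sfc_morphism sfc_FrmE sfc_Frm mor_E"
    unfolding mor_E_def by (rule E.sfc_morphism)
  show "adjunction_between (Dual (sfc_RaneyI))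
      RaneyI_cat (op_cat Top_cat) pt_R (FiltSE_func \<circ>\<^sub>F O_R \<circ>\<^sub>F U_func)"
    unfolding dual
    by (rule RaneyI.adjunction_betweenI[OF subset_refl RaneyI.pt_K op_Top_all, unfolded sfc_RaneyI_simps(1)])
      (simp_all add: pt_simps)
  show "adjunction_between (Dual (sfc_Raney))
      Raney_cat (op_cat Top_cat) pt_R U_func"
    unfolding dual
    by (rule Raney.adjunction_betweenI[OF subset_refl Raney.pt_K op_Top_all, unfolded sfc_Raney_simps(1)])
      (simp_all add: pt_simps)
  show "adjunction_between (T0_part (Dual (sfc_RaneyT)))
      RaneyT_cat (op_cat TopD_cat) pt_R U_func"
    unfolding dual_T0
    by (rule RaneyT.adjunction_betweenI[OF T0_sub RaneyT_pt_T0 op_TopD, unfolded sfc_RaneyT_simps(1)])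
      (simp_all add: pt_simps)
  show "adjunction_between (T0_part (Dual (sfc_FrmE)))
      FrmE_cat (op_cat TopD_cat) pt_E Omega"
    unfolding dual_T0
    by (rule FrmE.adjunction_betweenI[OF T0_sub FrmE_pt_T0 op_TopD, unfolded sfc_FrmE_simps(1)])
      (simp_all add: pt_simps)
  show "adjunction_between (Dual (sfc_Frm)) Frm_cat (op_cat Top_cat) pt Omega"
    unfolding dual
    by (rule Frm.adjunction_betweenI[OF subset_refl Frm.pt_K op_Top_all, unfolded sfc_Frm_simps(1)])
      (simp_all add: pt_simps)
  show "right_adj_morphism (Dual sfc_Raney) (Dual sfc_RaneyI)
      (Dual_mor sfc_Raney sfc_RaneyI mor_Filt)"
    unfolding dual mor_Filt_def
    by (rule Filt.right_adj_morphism[OF subset_refl Raney.pt_K subset_refl RaneyI.pt_K subset_refl])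
  show "strong_adj_morphism (T0_part (Dual sfc_RaneyT)) (Dual sfc_Raney)
      (Dual_mor sfc_RaneyT sfc_Raney mor_IT)"
    unfolding dual_T0 Raney.Dual_eq_Dual_on mor_IT_def
    by (rule IT.strong_adj_morphism[OF T0_sub RaneyT_pt_T0 subset_refl Raney.pt_K
          subset_trans[OF T0_sub exact_spaces_sub]]) simp_all
  show "strong_adj_morphism (T0_part (Dual sfc_RaneyT)) (T0_part (Dual sfc_FrmE))
      (Dual_mor sfc_RaneyT sfc_FrmE mor_OIT)"
    unfolding dual_T0 mor_OIT_def
    by (rule OIT.strong_adj_morphism[OF T0_sub RaneyT_pt_T0 T0_sub FrmE_pt_T0 subset_refl])
      (simp_all add: RaneyT_Hom_two)
  show "right_adj_morphism (T0_part (Dual sfc_FrmE)) (Dual sfc_Frm)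
      (Dual_mor sfc_FrmE sfc_Frm mor_E)"
    unfolding dual_T0 Frm.Dual_eq_Dual_on mor_E_def
    by (rule E.right_adj_morphism[OF T0_sub FrmE_pt_T0 subset_refl Frm.pt_K
          subset_trans[OF T0_sub exact_spaces_sub]])
  show "equivalence_functor RaneyT_cat FrmE_cat
      (O_R \<circ>\<^sub>F incl)"
    by (rule equivalence_OIT)
  show "strong_adj_morphism (Dual sfc_RaneyT) (Dual sfc_Raney)
      (Dual_mor sfc_RaneyT sfc_Raney mor_IT)"
    unfolding dual mor_IT_def
    by (rule IT.strong_adj_morphism[OF subset_refl RaneyT.pt_K subset_refl Raney.pt_K exact_spaces_sub]) simp_all
  show "strong_adj_morphism (Dual sfc_RaneyT) (Dual sfc_FrmE)
      (Dual_mor sfc_RaneyT sfc_FrmE mor_OIT)"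
    unfolding dual mor_OIT_def
    by (rule OIT.strong_adj_morphism[OF subset_refl RaneyT.pt_K subset_refl FrmE.pt_K subset_refl])
      (simp_all add: RaneyT_Hom_two)
  show "right_adj_morphism (Dual sfc_FrmE) (Dual sfc_Frm)
      (Dual_mor sfc_FrmE sfc_Frm mor_E)"
    unfolding dual mor_E_def
    by (rule E.right_adj_morphism[OF subset_refl FrmE.pt_K subset_refl Frm.pt_K exact_spaces_sub])
qed

end
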